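(* Let $(X,\mathscr{B},\mu)$ be a probability space and let $T,S:X\to X$ be measure preserving automorphisms for which $T$ has singular spectrum. Let $(k_n)_{n=1}^\infty\subseteq\mathbb{N}$ be a sequence for which $((k_{n+h}-k_n)\alpha)_{n=1}^\infty$ is uniformly distributed in $\overline{\{n\alpha\mid n\in\mathbb{N}\}}$ for all $\alpha\in\mathbb{R}$ and $h\in\mathbb{N}$. (i) For any $f,g\in L^\infty(X,\mu)$, $$\lim_{N\to\infty}\frac1N\sum_{n=1}^N T^nf\cdot S^{k_n}g=\mathbb{E}[f|\mathcal{I}_T]\,\mathbb{E}[g|\mathcal{I}_S],$$ with convergence taking place in $L^2(X,\mu)$. (ii) If $A\in\mathscr{B}$, then $$\lim_{N\to\infty}\frac1N\sum_{n=1}^N\mu\left(A\cap T^{-n}A\cap S^{-k_n}A\right)\ge\mu(A)^3.$$ (iii) If we only assume that $((k_{n+h}-k_n)\alpha)_{n=1}^\infty$ is uniformly distributed for all $\alpha\in\mathbb{R}\setminus\mathbb{Q}$ and $h\in\mathbb{N}$, then (i) and (ii) hold when $S$ is totally ergodic.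
   Context: $\mathbb{N}=\{1,2,\dots\}$. A measure preserving automorphism $R$ of $(X,\mathscr{B},\mu)$ is an invertible bi-measurable map with $\mu(R^{-1}A)=\mu(A)=\mu(RA)$ for all $A\in\mathscr{B}$; it acts on functions by $Rf=f\circ R$. $\mathcal{I}_R$ is the $\sigma$-algebra of $R$-invariant sets, and $\mathbb{E}[\cdot|\mathscr{A}]$ is the orthogonal projection of $L^2(X,\mathscr{B},\mu)$ onto $L^2(X,\mathscr{A},\mu)$. $R$ is totally ergodic if $R^n$ is ergodic for all $n\in\mathbb{N}$. For $f\in L^2(X,\mu)$, the spectral measure $\mu_{f,R}$ is the positive measure on $[0,1]$ with $\widehat{\mu_{f,R}}(n)=\langle R^nf,f\rangle$ (Fourier coefficients). There is a measure $\mu_R$ representing the maximal spectral type of $R$, i.e. the maximal spectral type of the unitary operator $R$ on $L^2_0(X,\mu)=\{f\in L^2(X,\mu):\int f\,d\mu=0\}$, so $\mu_{f,R}\ll\mu_R$ for all $f\in L^2_0(X,\mu)$. $R$ has singular spectrum if $\mu_R\perp\mathcal{L}$, where $\mathcal{L}$ is Lebesgue measure on $[0,1]$. Quantities such as $(k_{n+h}-k_n)\alpha$ and $n\alpha$ are reduced modulo $1$. The closure $\overline{\{n\alpha\mid n\in\mathbb{N}\}}$ is taken in $\mathbb{R}/\mathbb{Z}$; it is a closed subgroup, and uniform distribution in it is with respect to its Haar probability measure. "Uniformly distributed" without further specification means uniformly distributed modulo $1$ with respect to Lebesgue measure. *)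

theory Defs
  imports "HOL-Probability.Probability"
begin

section \<open>Function spaces\<close>

text \<open>Functions are complex valued and are not identified when they agree almost everywhere.\<close>

definition L2 :: "'a measure \<Rightarrow> ('a \<Rightarrow> complex) set" where
  "L2 M = {f \<in> borel_measurable M. integrable M (\<lambda>x. (cmod (f x))\<^sup>2)}"

definition L2_inner :: "'a measure \<Rightarrow> ('a \<Rightarrow> complex) \<Rightarrow> ('a \<Rightarrow> complex) \<Rightarrow> complex" where
  "L2_inner M f g = (\<integral>x. f x * cnj (g x) \<partial>M)"

definition L2_zero_mean :: "'a measure \<Rightarrow> ('a \<Rightarrow> complex) set" where
  "L2_zero_mean M = {f \<in> L2 M. (\<integral>x. f x \<partial>M) = 0}"

definition Linf :: "'a measure \<Rightarrow> ('a \<Rightarrow> complex) set" where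
  "Linf M = {f \<in> borel_measurable M. \<exists>C. AE x in M. cmod (f x) \<le> C}"

definition tendsto_L2 :: "'a measure \<Rightarrow> (nat \<Rightarrow> 'a \<Rightarrow> complex) \<Rightarrow> ('a \<Rightarrow> complex) \<Rightarrow> bool" where
  "tendsto_L2 M u l \<longleftrightarrow> (\<forall>N. u N \<in> L2 M) \<and> l \<in> L2 M \<and>
     (\<lambda>N. \<integral>x. (cmod (u N x - l x))\<^sup>2 \<partial>M) \<longlonglongrightarrow> 0"

section \<open>Automorphisms\<close>

definition measure_preserving_automorphism :: "'a measure \<Rightarrow> ('a \<Rightarrow> 'a) \<Rightarrow> bool" where
  "measure_preserving_automorphism M R \<longleftrightarrow>
     bij_betw R (space M) (space M) \<and>
     R \<in> measurable M M \<and> the_inv_into (space M) R \<in> measurable M M \<and>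
     (\<forall>A\<in>sets M. emeasure M (R -` A \<inter> space M) = emeasure M A \<and>
                  emeasure M (R ` A) = emeasure M A)"

definition int_iterate :: "'a measure \<Rightarrow> ('a \<Rightarrow> 'a) \<Rightarrow> int \<Rightarrow> 'a \<Rightarrow> 'a" where
  "int_iterate M R n =
     (if 0 \<le> n then R ^^ nat n else the_inv_into (space M) R ^^ nat (- n))"

definition invariant_sets :: "'a measure \<Rightarrow> ('a \<Rightarrow> 'a) \<Rightarrow> 'a set set" where
  "invariant_sets M R = {A \<in> sets M. R -` A \<inter> space M = A}"

definition invariant_algebra :: "'a measure \<Rightarrow> ('a \<Rightarrow> 'a) \<Rightarrow> 'a measure" where
  "invariant_algebra M R = sigma (space M) (invariant_sets M R)"

definition ergodic :: "'a measure \<Rightarrow> ('a \<Rightarrow> 'a) \<Rightarrow> bool" where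
  "ergodic M R \<longleftrightarrow> (\<forall>A\<in>invariant_sets M R. measure M A = 0 \<or> measure M A = 1)"

definition totally_ergodic :: "'a measure \<Rightarrow> ('a \<Rightarrow> 'a) \<Rightarrow> bool" where
  "totally_ergodic M R \<longleftrightarrow> (\<forall>n\<ge>1. ergodic M (R ^^ n))"

section \<open>Conditional expectation\<close>

text \<open>
  The library's conditional expectation, applied to real and imaginary parts.  On square
  integrable functions it is the orthogonal projection onto the square integrable functions
  measurable for the subalgebra; see \<open>cond_exp_orthogonal_projection\<close> below.
\<close>

definition cond_exp :: "'a measure \<Rightarrow> 'a measure \<Rightarrow> ('a \<Rightarrow> complex) \<Rightarrow> 'a \<Rightarrow> complex" where
  "cond_exp M F f x =
     Complex (real_cond_exp M F (\<lambda>y. Re (f y)) x) (real_cond_exp M F (\<lambda>y. Im (f y)) x)"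

section \<open>Spectral measures\<close>

text \<open>
  The coefficient of a measure is taken against \<open>cis (2 * pi * n * t)\<close>; the opposite sign only
  reflects the measure by \<open>t \<mapsto> 1 - t\<close>, which preserves Lebesgue null sets.  Both endpoints of
  \<open>[0, 1]\<close> stand for the same point of the circle, so coefficients determine a measure on
  \<open>[0, 1]\<close> only up to moving mass between 0 and 1.  We therefore use a predicate and
  quantify over all spectral measures of \<open>f\<close>; as the endpoints form a Lebesgue null set, this has
  no influence on singularity.
\<close>

definition spectral_measure ::
    "'a measure \<Rightarrow> ('a \<Rightarrow> 'a) \<Rightarrow> ('a \<Rightarrow> complex) \<Rightarrow> real measure \<Rightarrow> bool" where
  "spectral_measure M R f \<sigma> \<longleftrightarrow>
     sets \<sigma> = sets (restrict_space borel {0..1}) \<and> finite_measure \<sigma> \<and>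
     (\<forall>n::int. (\<integral>t. cis (2 * pi * of_int n * t) \<partial>\<sigma>) =
               L2_inner M (\<lambda>x. f (int_iterate M R n x)) f)"

text \<open>
  The library's \<open>absolutely_continuous \<tau> \<sigma>\<close> says that \<open>\<sigma>\<close> is absolutely continuous with respect
  to \<open>\<tau>\<close>.
\<close>

definition dominates_spectrum :: "'a measure \<Rightarrow> ('a \<Rightarrow> 'a) \<Rightarrow> real measure \<Rightarrow> bool" where
  "dominates_spectrum M R \<tau> \<longleftrightarrow>
     sets \<tau> = sets (restrict_space borel {0..1}) \<and>
     (\<forall>f\<in>L2_zero_mean M. \<forall>\<sigma>. spectral_measure M R f \<sigma> \<longrightarrow> absolutely_continuous \<tau> \<sigma>)"

text \<open>
  The maximal spectral type is the least measure class dominating every spectral measure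
  of a zero mean function.  Only the null sets of \<open>\<tau>\<close> matter.  Finiteness of \<open>\<tau>\<close> is not required,
  so that a representative exists also when \<open>L2 M\<close> is not separable; if it is separable,
  the class contains a finite measure.
\<close>

definition maximal_spectral_type :: "'a measure \<Rightarrow> ('a \<Rightarrow> 'a) \<Rightarrow> real measure \<Rightarrow> bool" where
  "maximal_spectral_type M R \<tau> \<longleftrightarrow>
     dominates_spectrum M R \<tau> \<and>
     (\<forall>\<nu>. dominates_spectrum M R \<nu> \<longrightarrow> absolutely_continuous \<nu> \<tau>)"

definition mutually_singular :: "'b measure \<Rightarrow> 'b measure \<Rightarrow> bool" where
  "mutually_singular \<mu> \<nu> \<longleftrightarrow>
     sets \<mu> = sets \<nu> \<and> (\<exists>B\<in>sets \<mu>. emeasure \<mu> B = 0 \<and> emeasure \<nu> (space \<nu> - B) = 0)"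

definition singular_spectrum :: "'a measure \<Rightarrow> ('a \<Rightarrow> 'a) \<Rightarrow> bool" where
  "singular_spectrum M R \<longleftrightarrow>
     (\<exists>\<tau>. maximal_spectral_type M R \<tau> \<and> mutually_singular \<tau> (restrict_space lborel {0..1}))"

section \<open>Uniform distribution in closed subgroups of the circle group\<close>

text \<open>
  Measures on \<open>\<real>/\<int>\<close> are measures on the fundamental domain \<open>{0..<1}\<close>; subsets of \<open>\<real>/\<int>\<close> are
  1-periodic subsets of \<open>\<real>\<close>; continuous functions on \<open>\<real>/\<int>\<close> are 1-periodic continuous functions
  on \<open>\<real>\<close>.  Sequences are indexed from 1.  Uniform distribution with respect to a probability
  measure is weak convergence of the empirical measures.
\<close>

definition uniformly_distributed_wrt :: "real measure \<Rightarrow> (nat \<Rightarrow> real) \<Rightarrow> bool" where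
  "uniformly_distributed_wrt H x \<longleftrightarrow>
     (\<forall>\<phi> :: real \<Rightarrow> complex. continuous_on UNIV \<phi> \<longrightarrow> (\<forall>t. \<phi> (t + 1) = \<phi> t) \<longrightarrow>
        (\<lambda>N. (\<Sum>n=1..N. \<phi> (x n)) / of_nat N) \<longlonglongrightarrow> (\<integral>t. \<phi> t \<partial>H))"

definition uniformly_distributed_mod1 :: "(nat \<Rightarrow> real) \<Rightarrow> bool" where
  "uniformly_distributed_mod1 x \<longleftrightarrow>
     uniformly_distributed_wrt (restrict_space lborel {0..<1}) x"

text \<open>
  The preimage in \<open>\<real>\<close> of the closure of \<open>{n \<alpha> | n \<ge> 1}\<close> in \<open>\<real>/\<int>\<close>: as \<open>\<real> \<rightarrow> \<real>/\<int>\<close> is open, the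
  preimage of a closure is the closure of the preimage.
\<close>

definition orbit_closure :: "real \<Rightarrow> real set" where
  "orbit_closure \<alpha> = closure {of_nat n * \<alpha> + of_int m | (n::nat) (m::int). n \<ge> 1}"

definition haar_probability :: "real set \<Rightarrow> real measure \<Rightarrow> bool" where
  "haar_probability G H \<longleftrightarrow>
     sets H = sets (restrict_space borel {0..<1}) \<and> prob_space H \<and>
     emeasure H (G \<inter> {0..<1}) = 1 \<and>
     (\<forall>g\<in>G. distr H H (\<lambda>t. frac (t + g)) = H)"

definition uniformly_distributed_in :: "real set \<Rightarrow> (nat \<Rightarrow> real) \<Rightarrow> bool" where
  "uniformly_distributed_in G x \<longleftrightarrow>
     (\<forall>n\<ge>1. x n \<in> G) \<and> (\<exists>H. haar_probability G H \<and> uniformly_distributed_wrt H x)"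

section \<open>Conditional expectation as an orthogonal projection\<close>

lemma cond_exp_orthogonal_projection:
  assumes "prob_space M" and sub: "subalgebra M F" and f: "f \<in> L2 M"
  shows "cond_exp M F f \<in> L2 M"
    and "cond_exp M F f \<in> borel_measurable F"
    and "\<And>u. u \<in> L2 M \<Longrightarrow> u \<in> borel_measurable F \<Longrightarrow>
           L2_inner M (\<lambda>x. f x - cond_exp M F f x) u = 0"
proof -
  interpret prob_space M by fact
  interpret finite_measure_subalgebra M F by standard (rule sub)
  have fm [measurable]: "f \<in> borel_measurable M"
    and fi: "integrable M (\<lambda>x. (cmod (f x))\<^sup>2)"
    using f by (auto simp: L2_def)
  define a where "a = (\<lambda>x. Re (f x))"
  define b where "b = (\<lambda>x. Im (f x))"
  define A where "A = real_cond_exp M F a"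
  define B where "B = real_cond_exp M F b"
  have c: "cond_exp M F f = (\<lambda>x. Complex (A x) (B x))"
    by (simp add: fun_eq_iff cond_exp_def A_def B_def a_def b_def)
  have [measurable]: "a \<in> borel_measurable M" "b \<in> borel_measurable M"
    by (simp_all add: a_def b_def)
  have AF [measurable]: "A \<in> borel_measurable F" "B \<in> borel_measurable F"
    by (simp_all add: A_def B_def)
  have AM [measurable]: "A \<in> borel_measurable M" "B \<in> borel_measurable M"
    by (simp_all add: A_def B_def)
  have sq: "integrable M (\<lambda>x. (a x)\<^sup>2)" "integrable M (\<lambda>x. (b x)\<^sup>2)"
    by (rule Bochner_Integration.integrable_bound[OF fi]; simp add: a_def b_def cmod_power2)+
  have int: "integrable M a" "integrable M b"
    using sq by (auto intro: square_integrable_imp_integrable)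
  have cv: "convex_on UNIV (\<lambda>x::real. x\<^sup>2)"
    by (rule convex_power2)
  have SQ: "integrable M (\<lambda>x. (A x)\<^sup>2)" "integrable M (\<lambda>x. (B x)\<^sup>2)"
    unfolding A_def B_def
    using integrable_convex_cond_exp[of a UNIV _ _ "\<lambda>x. x\<^sup>2"]
      integrable_convex_cond_exp[of b UNIV _ _ "\<lambda>x. x\<^sup>2"] int sq cv
    by auto
  show "cond_exp M F f \<in> L2 M"
    unfolding c L2_def using SQ by (auto simp: cmod_power2 Complex_eq)
  show "cond_exp M F f \<in> borel_measurable F"
    unfolding c Complex_eq by measurable
  fix u assume u: "u \<in> L2 M" and uF [measurable]: "u \<in> borel_measurable F"
  have uM [measurable]: "u \<in> borel_measurable M" and ui: "integrable M (\<lambda>x. (cmod (u x))\<^sup>2)"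
    using u by (auto simp: L2_def)
  define p where "p = (\<lambda>x. Re (u x))"
  define q where "q = (\<lambda>x. Im (u x))"
  have [measurable]: "p \<in> borel_measurable M" "q \<in> borel_measurable M"
    by (simp_all add: p_def q_def)
  have pF: "p \<in> borel_measurable F" "q \<in> borel_measurable F"
    unfolding p_def q_def by measurable
  have sqp: "integrable M (\<lambda>x. (p x)\<^sup>2)" "integrable M (\<lambda>x. (q x)\<^sup>2)"
    by (rule Bochner_Integration.integrable_bound[OF ui]; simp add: p_def q_def cmod_power2)+
  have prod: "integrable M (\<lambda>x. v x * w x)"
    if [measurable]: "v \<in> borel_measurable M" "w \<in> borel_measurable M"
      and v: "integrable M (\<lambda>x. (v x)\<^sup>2)" and w: "integrable M (\<lambda>x. (w x)\<^sup>2)"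
    for v w :: "'a \<Rightarrow> real"
  proof (rule Bochner_Integration.integrable_bound[OF Bochner_Integration.integrable_add[OF v w]])
    show "AE x in M. norm (v x * w x) \<le> norm ((v x)\<^sup>2 + (w x)\<^sup>2)"
    proof (rule AE_I2)
      fix x
      have "0 \<le> \<bar>v x\<bar> * \<bar>w x\<bar>" by simp
      then have "\<bar>v x\<bar> * \<bar>w x\<bar> \<le> 2 * (\<bar>v x\<bar> * \<bar>w x\<bar>)" by linarith
      also have "\<dots> \<le> (v x)\<^sup>2 + (w x)\<^sup>2"
        using sum_squares_bound[of "\<bar>v x\<bar>" "\<bar>w x\<bar>"] by (simp add: mult.assoc)
      finally show "norm (v x * w x) \<le> norm ((v x)\<^sup>2 + (w x)\<^sup>2)"
        by (simp add: abs_mult)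
    qed
  qed simp
  have ex: "(\<integral>x. v x * real_cond_exp M F w x \<partial>M) = (\<integral>x. v x * w x \<partial>M)"
    if "v \<in> borel_measurable F" and [measurable]: "v \<in> borel_measurable M" "w \<in> borel_measurable M"
      and v: "integrable M (\<lambda>x. (v x)\<^sup>2)" and w: "integrable M (\<lambda>x. (w x)\<^sup>2)"
    for v w :: "'a \<Rightarrow> real"
    by (rule real_cond_exp_intg(2)) (use that in \<open>auto intro: prod\<close>)
  have zero: "integrable M (\<lambda>x. v x * (w x - real_cond_exp M F w x)) \<and>
      (\<integral>x. v x * (w x - real_cond_exp M F w x) \<partial>M) = 0"
    if v: "v \<in> borel_measurable F" "v \<in> borel_measurable M" "integrable M (\<lambda>x. (v x)\<^sup>2)"
      and w: "w \<in> borel_measurable M" "integrable M (\<lambda>x. (w x)\<^sup>2)"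
      and W: "integrable M (\<lambda>x. (real_cond_exp M F w x)\<^sup>2)"
    for v w :: "'a \<Rightarrow> real"
  proof -
    have 1: "integrable M (\<lambda>x. v x * w x)"
      by (rule prod[OF v(2) w(1) v(3) w(2)])
    have 2: "integrable M (\<lambda>x. v x * real_cond_exp M F w x)"
      by (rule prod[OF v(2) _ v(3) W]) simp
    show ?thesis
      unfolding right_diff_distrib
      using Bochner_Integration.integrable_diff[OF 1 2] Bochner_Integration.integral_diff[OF 1 2]
        ex[OF v(1,2) w(1) v(3) w(2)]
      by simp
  qed
  have pM: "p \<in> borel_measurable M" "q \<in> borel_measurable M"
    and aM: "a \<in> borel_measurable M" "b \<in> borel_measurable M"
    by measurable
  note z = zero[OF pF(1) pM(1) sqp(1) aM(1) sq(1) SQ(1)[unfolded A_def], folded A_def]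
    zero[OF pF(1) pM(1) sqp(1) aM(2) sq(2) SQ(2)[unfolded B_def], folded B_def]
    zero[OF pF(2) pM(2) sqp(2) aM(1) sq(1) SQ(1)[unfolded A_def], folded A_def]
    zero[OF pF(2) pM(2) sqp(2) aM(2) sq(2) SQ(2)[unfolded B_def], folded B_def]
  define r where "r = (\<lambda>x. p x * (a x - A x) + q x * (b x - B x))"
  define s where "s = (\<lambda>x. p x * (b x - B x) - q x * (a x - A x))"
  have rs: "integrable M r" "integrable M s" "(\<integral>x. r x \<partial>M) = 0" "(\<integral>x. s x \<partial>M) = 0"
    unfolding r_def s_def using z by simp_all
  have "L2_inner M (\<lambda>x. f x - cond_exp M F f x) u =
      (\<integral>x. complex_of_real (r x) + \<i> * complex_of_real (s x) \<partial>M)"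
    unfolding L2_inner_def c
    by (intro Bochner_Integration.integral_cong refl)
      (simp add: complex_eq_iff r_def s_def p_def q_def a_def b_def algebra_simps)
  also have "\<dots> = (\<integral>x. complex_of_real (r x) \<partial>M) + (\<integral>x. \<i> * complex_of_real (s x) \<partial>M)"
    using rs by (intro Bochner_Integration.integral_add integrable_mult_right integrable_of_real)
  also have "\<dots> = 0"
    using rs by simp
  finally show "L2_inner M (\<lambda>x. f x - cond_exp M F f x) u = 0" .
qed

end

theory Submission
  imports Defs
begin

text \<open>
  The averages of the products are controlled by playing two spectral types against each other.  Let
  \<open>g\<close> be bounded and let \<open>G\<close> be its conditional expectation on the \<open>S\<close>-invariant sets.  In terms of the
  spectral measure of \<open>g - G\<close> under \<open>S\<close>, the average over \<open>n\<close> of the inner products of the iterates of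
  \<open>g - G\<close> with exponents \<open>k (n + h)\<close> and \<open>k n\<close> is the integral of the average of the characters
  \<open>exp (2 \<pi> i (k (n + h) - k n) t)\<close>.  By uniform distribution these averages tend to 0 except at \<open>t = 0\<close>
  (respectively, except perhaps at rational \<open>t\<close>), and the spectral measure does not charge the
  exceptional points, by the mean ergodic theorem for \<open>S\<close> (respectively, for all powers of \<open>S\<close>).  Hence
  the sequence \<open>x n\<close> of iterates of \<open>g - G\<close> is uncorrelated: on average its shifts are orthogonal, as if
  it had Lebesgue spectrum.

  On the other side, the spectral measure of \<open>f\<close> under \<open>T\<close> is singular.  It lives on a Lebesgue null set,
  so there is a trigonometric polynomial that is small in \<open>L\<^sup>2\<close> of this measure but, up to
  multiplication by a character, close to 1 in \<open>L\<^sup>2\<close> of Lebesgue measure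
  (\<open>singular_approx_polynomial\<close>).  Applying it to the sequence \<open>x\<close> hardly
  changes \<open>x\<close>; moving it over to the iterates of \<open>f\<close> makes these small.  So the averages of
  \<open>f ((T ^^ n) w) * x n w\<close> tend to 0 in \<open>L\<^sup>2\<close> (\<open>averages_uncorrelated_times_singular\<close>).  No commutation
  between \<open>S\<close> and \<open>T\<close> is needed: in each product one factor is estimated in \<open>L\<^sup>2\<close> and the other one
  by its bound.  What remains of the averages is \<open>G\<close> times the ergodic averages of \<open>f\<close>, which converge by
  the mean ergodic theorem for \<open>T\<close>.

  Spectral measures are obtained from Herglotz's theorem on positive definite sequences (\<open>herglotz\<close>); the
  mean ergodic theorem (\<open>mean_ergodic\<close>) follows from them for bounded functions.  The lower bound
  for recurrence is the inequality \<open>integral_cond_exp_product_ge_cube\<close> applied to the limit.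
\<close>

section \<open>Characters and measures on the circle\<close>

text \<open>The character \<open>t \<mapsto> exp (2 \<pi> i t)\<close> of the circle \<open>\<real>/\<int>\<close>.\<close>

definition circ :: "real \<Rightarrow> complex" where
  "circ t = cis (2 * pi * t)"

lemma norm_circ [simp]: "cmod (circ t) = 1"
  by (simp add: circ_def)

lemma circ_0 [simp]: "circ 0 = 1"
  by (simp add: circ_def)

lemma circ_add: "circ (s + t) = circ s * circ t"
  by (simp add: circ_def cis_mult algebra_simps)

lemma circ_minus: "circ (- t) = cnj (circ t)"
  by (simp add: circ_def cis_cnj)

lemma circ_diff: "circ (s - t) = circ s * cnj (circ t)"
  using circ_add[of s "- t"] by (simp add: circ_minus)

lemma circ_power: "circ t ^ n = circ (real n * t)"
  by (induction n) (simp_all add: circ_add distrib_right)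

lemma circ_of_int [simp]: "circ (of_int n) = 1"
  by (simp add: circ_def)

lemma circ_eq_1_iff: "circ t = 1 \<longleftrightarrow> t \<in> \<int>"
proof
  assume "circ t = 1"
  then have "cos (2 * pi * t) = 1" by (simp add: circ_def complex_eq_iff)
  then obtain n :: int where "2 * pi * t = of_int n * 2 * pi"
    using cos_one_2pi_int by auto
  then have "t = of_int n" by simp
  then show "t \<in> \<int>" by simp
qed (auto elim!: Ints_cases)

lemma circ_frac: "circ (frac t) = circ t"
  by (simp add: frac_def circ_diff)

lemma continuous_on_circ [continuous_intros]:
  "continuous_on A f \<Longrightarrow> continuous_on A (\<lambda>x. circ (f x))"
  unfolding circ_def by (intro continuous_intros)

lemma measurable_circ [measurable]: "circ \<in> borel_measurable borel"
  by (intro borel_measurable_continuous_onI continuous_on_circ continuous_on_id)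

text \<open>
  A finite measure on \<open>[0, 1]\<close>, both end points being kept; as in the definition of a spectral measure
  they stand for the same point of the circle.
\<close>

locale circle_measure = finite_measure \<sigma> for \<sigma> :: "real measure" +
  assumes sets_eq: "sets \<sigma> = sets (restrict_space borel {0..1})"
begin

lemma space_eq: "space \<sigma> = {0..1}"
  using sets_eq_imp_space_eq[OF sets_eq] by (simp add: space_restrict_space)

lemma borel_measurable [measurable (raw)]:
  "f \<in> borel_measurable borel \<Longrightarrow> f \<in> borel_measurable \<sigma>"
  by (subst measurable_cong_sets[OF sets_eq refl]) (rule measurable_restrict_space1)

lemma integrable_bounded:
  fixes f :: "real \<Rightarrow> 'b::{banach, second_countable_topology}"
  shows "f \<in> borel_measurable borel \<Longrightarrow> (\<And>t. norm (f t) \<le> B) \<Longrightarrow> integrable \<sigma> f"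
  by (rule integrable_const_bound[where B = B]) auto

lemma sets_I: "A \<in> sets borel \<Longrightarrow> A \<subseteq> {0..1} \<Longrightarrow> A \<in> sets \<sigma>"
  by (auto simp: sets_eq sets_restrict_space)

text \<open>The square norm of a polynomial in \<open>circ t\<close> is a Hermitian form in the Fourier coefficients.\<close>

lemma integral_norm_sum_circ:
  fixes r :: "nat \<Rightarrow> complex"
  shows "complex_of_real (\<integral>t. (cmod (\<Sum>j\<le>d. r j * circ (real j * t)))\<^sup>2 \<partial>\<sigma>) =
    (\<Sum>j\<le>d. \<Sum>l\<le>d. r j * cnj (r l) * (\<integral>t. circ (of_int (int j - int l) * t) \<partial>\<sigma>))"
proof -
  have "complex_of_real ((cmod (\<Sum>j\<le>d. r j * circ (real j * t)))\<^sup>2) =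
      (\<Sum>j\<le>d. \<Sum>l\<le>d. r j * cnj (r l) * circ (of_int (int j - int l) * t))" for t
    unfolding complex_norm_square cnj_sum sum_product
    by (intro sum.cong refl) (simp add: left_diff_distrib circ_diff)
  moreover have "complex_of_real (\<integral>t. (cmod (\<Sum>j\<le>d. r j * circ (real j * t)))\<^sup>2 \<partial>\<sigma>) =
      (\<integral>t. complex_of_real ((cmod (\<Sum>j\<le>d. r j * circ (real j * t)))\<^sup>2) \<partial>\<sigma>)"
    by (rule integral_complex_of_real[symmetric])
  moreover have "integrable \<sigma> (\<lambda>t. c * circ (of_int n * t))" for c n
    by (rule integrable_bounded[where B = "cmod c"]) (auto simp: norm_mult)
  ultimately show ?thesis
    by (simp only: Bochner_Integration.integral_sum Bochner_Integration.integrable_sum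
        integral_mult_right_zero)
qed

end

text \<open>Lebesgue measure on \<open>[0, 1]\<close>.\<close>

abbreviation lebesgue_01 :: "real measure" where
  "lebesgue_01 \<equiv> restrict_space lborel {0..1}"

interpretation lebesgue_01: circle_measure lebesgue_01
proof (intro circle_measure.intro finite_measureI circle_measure_axioms.intro)
  show "emeasure lebesgue_01 (space lebesgue_01) \<noteq> \<infinity>"
    by (simp add: emeasure_restrict_space space_restrict_space)
  show "sets lebesgue_01 = sets (restrict_space borel {0..1})"
    by (rule sets_restrict_space_cong) simp
qed

lemma integral_circ_lebesgue:
  "(\<integral>t. circ (of_int n * t) \<partial>lebesgue_01) = (if n = 0 then 1 else 0)"
proof (cases "n = 0")
  case True
  then show ?thesis by (simp add: measure_restrict_space space_restrict_space)
next
  case False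
  let ?F = "\<lambda>t. circ (of_int n * t) / (2 * pi * \<i> * of_int n)"
  have "has_bochner_integral lborel (\<lambda>t. indicator {0..1} t *\<^sub>R circ (of_int n * t)) (?F 1 - ?F 0)"
  proof (rule has_bochner_integral_FTC_Icc)
    fix t :: real
    let ?c = "2 * pi * \<i> * of_int n"
    have "((\<lambda>z. exp (?c * z) / ?c) has_field_derivative exp (?c * of_real t)) (at (of_real t))"
      using False by (auto intro!: derivative_eq_intros)
    from has_vector_derivative_real_field[OF this]
    show "(?F has_vector_derivative circ (of_int n * t)) (at t within {0..1})"
      by (simp add: circ_def cis_conv_exp algebra_simps)
    show "continuous_on {0..1} (\<lambda>t. circ (of_int n * t))"
      by (intro continuous_intros)
  qed auto
  moreover have "?F 1 - ?F 0 = 0" using circ_of_int[of n] by simp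
  ultimately show ?thesis
    using False by (simp add: integral_restrict_space has_bochner_integral_iff)
qed

lemma parseval_sum_circ:
  fixes r :: "nat \<Rightarrow> complex"
  shows "(\<integral>t. (cmod (\<Sum>j\<le>d. r j * circ (real j * t)))\<^sup>2 \<partial>lebesgue_01) = (\<Sum>j\<le>d. (cmod (r j))\<^sup>2)"
proof -
  have "complex_of_real (\<integral>t. (cmod (\<Sum>j\<le>d. r j * circ (real j * t)))\<^sup>2 \<partial>lebesgue_01) =
     (\<Sum>j\<le>d. \<Sum>l\<le>d. if l = j then r j * cnj (r j) else 0)"
    unfolding lebesgue_01.integral_norm_sum_circ
    unfolding integral_circ_lebesgue by (intro sum.cong refl) auto
  also have "\<dots> = complex_of_real (\<Sum>j\<le>d. (cmod (r j))\<^sup>2)"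
    by (simp add: complex_norm_square[symmetric] del: of_real_power)
  finally show ?thesis
    using of_real_eq_iff by blast
qed

section \<open>Trigonometric polynomials that are small on a singular measure\<close>

text \<open>
  On the unit circle, real polynomials in the real and imaginary part are Laurent polynomials in \<open>z\<close>;
  multiplying by a power of \<open>z\<close> removes the negative exponents.
\<close>

lemma real_polynomial_function_on_circle:
  fixes g :: "complex \<Rightarrow> real"
  assumes "real_polynomial_function g"
  shows "\<exists>(p :: complex poly) J. \<forall>z. cmod z = 1 \<longrightarrow> of_real (g z) * z ^ J = poly p z"
  using assms
proof induction
  case (linear f)
  interpret bounded_linear f by fact
  have zz: "cnj z * z = 1" if "cmod z = 1" for z
    using that complex_norm_square[of z] by (simp add: mult.commute)
  have "of_real (f z) * z = poly [:(of_real (f 1) + \<i> * of_real (f \<i>)) / 2, 0,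
      (of_real (f 1) - \<i> * of_real (f \<i>)) / 2:] z" if "cmod z = 1" for z
  proof -
    have "z = Re z *\<^sub>R 1 + Im z *\<^sub>R \<i>" by (simp add: complex_eq_iff)
    then have "f z = Re z * f 1 + Im z * f \<i>"
      by (metis add scale real_scaleR_def)
    moreover have "of_real (Re z) = (z + cnj z) / 2" "of_real (Im z) = (\<i> * cnj z - \<i> * z) / 2"
      by (simp_all add: complex_eq_iff)
    ultimately have "of_real (f z) * z =
        (z * z + cnj z * z) / 2 * of_real (f 1) + (\<i> * (cnj z * z) - \<i> * (z * z)) / 2 * of_real (f \<i>)"
      by (simp only: of_real_add of_real_mult) (simp add: algebra_simps add_divide_distrib diff_divide_distrib)
    then show ?thesis
      unfolding zz[OF that] by (simp add: algebra_simps add_divide_distrib diff_divide_distrib)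
  qed
  then show ?case by (metis power_one_right)
next
  case (const c)
  have "of_real c * z ^ 0 = poly [:of_real c:] z" for z :: complex by simp
  then show ?case by blast
next
  case (add f g)
  then obtain p J q L where
    "\<And>z. cmod z = 1 \<Longrightarrow> of_real (f z) * z ^ J = poly p z"
    "\<And>z. cmod z = 1 \<Longrightarrow> of_real (g z) * z ^ L = poly q z" by blast
  then have "of_real (f z + g z) * z ^ (J + L) = poly (monom 1 L * p + monom 1 J * q) z"
    if "cmod z = 1" for z
    using that by (simp add: poly_monom power_add algebra_simps)
  then show ?case by blast
next
  case (mult f g)
  then obtain p J q L where p:
    "\<And>z. cmod z = 1 \<Longrightarrow> of_real (f z) * z ^ J = poly p z"
    "\<And>z. cmod z = 1 \<Longrightarrow> of_real (g z) * z ^ L = poly q z" by blast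
  then have "of_real (f z * g z) * z ^ (J + L) = poly (p * q) z"
    if "cmod z = 1" for z
    using that by (simp add: power_add mult_ac flip: p)
  then show ?case by blast
qed

text \<open>
  A measure carried by a Lebesgue null set \<open>N\<close> admits polynomials in the character that are small in
  its \<open>L\<^sup>2\<close> norm and at \<open>t = 0\<close>, while in \<open>L\<^sup>2\<close> of Lebesgue measure they are close to a single character
  \<open>circ (J t)\<close>; by Parseval the latter closeness is stated for the coefficients.  They come from a
  continuous function on the unit circle that vanishes on a compact null set carrying most of the mass and
  is close to 1 in \<open>L\<^sup>2\<close> of Lebesgue measure, by the Stone-Weierstrass theorem.
\<close>

lemma (in circle_measure) singular_approx_polynomial:
  assumes N: "N \<in> sets borel" "N \<subseteq> {0..1}" "emeasure lborel N = 0" "emeasure \<sigma> ({0..1} - N) = 0"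
    and "\<epsilon> > 0"
  obtains d J :: nat and q :: "nat \<Rightarrow> complex"
  where "J \<le> d"
    and "(\<integral>t. (cmod (\<Sum>j\<le>d. q j * circ (real j * t)))\<^sup>2 \<partial>\<sigma>) < \<epsilon>"
    and "(cmod (\<Sum>j\<le>d. q j))\<^sup>2 < \<epsilon>"
    and "(\<Sum>j\<le>d. (cmod ((if j = J then 1 else 0) - q j))\<^sup>2) < \<epsilon>"
proof -
  define V where "V = measure \<sigma> {0..1}"
  define \<delta> where "\<delta> = min 1 (\<epsilon> / (4 * (V + 1)))"
  have V: "V \<ge> 0" by (simp add: V_def)
  have "\<delta> * (V + 1) \<le> \<epsilon> / (4 * (V + 1)) * (V + 1)"
    using V by (intro mult_right_mono) (auto simp: \<delta>_def)
  also have "\<dots> = \<epsilon> / 4" using V by (simp add: divide_simps)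
  finally have \<delta>: "0 < \<delta>" "\<delta> \<le> 1" "\<delta> * (V + 1) \<le> \<epsilon> / 4"
    using \<open>\<epsilon> > 0\<close> V by (auto simp: \<delta>_def)
  have \<delta>2: "\<delta>\<^sup>2 \<le> \<delta>" "\<delta> \<le> \<epsilon> / 4"
  proof -
    show "\<delta>\<^sup>2 \<le> \<delta>" using \<delta> by (simp add: power2_eq_square mult_left_le)
    have "\<delta> * 1 \<le> \<delta> * (V + 1)" using \<delta> V by (intro mult_left_mono) auto
    then show "\<delta> \<le> \<epsilon> / 4" using \<delta> by linarith
  qed
  \<comment> \<open>A compact null set carrying all but \<open>\<epsilon> / 8\<close> of the mass.\<close>
  obtain K where K: "compact K" "K \<subseteq> N" "measure \<sigma> ({0..1} - K) < \<epsilon> / 8"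
  proof -
    define \<sigma>' where "\<sigma>' = distr \<sigma> borel (\<lambda>x. x)"
    have em: "emeasure \<sigma>' A = emeasure \<sigma> A" if "A \<in> sets borel" "A \<subseteq> {0..1}" for A
    proof -
      have "(\<lambda>x. x) -` A \<inter> space \<sigma> = A" using that by (auto simp: space_eq)
      then show ?thesis using that by (simp add: \<sigma>'_def emeasure_distr)
    qed
    have "emeasure \<sigma>' N = (SUP K\<in>{K. K \<subseteq> N \<and> compact K}. emeasure \<sigma>' K)"
      by (rule inner_regular) (use N in \<open>auto simp: \<sigma>'_def emeasure_distr\<close>)
    then have "\<exists>K\<in>{K. K \<subseteq> N \<and> compact K}. emeasure \<sigma>' N < emeasure \<sigma>' K + ennreal (\<epsilon> / 8)"
      by (rule SUP_approx_ennreal[rotated 2]) (use \<open>\<epsilon> > 0\<close> em N in auto)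
    then obtain K where K: "K \<subseteq> N" "compact K" "emeasure \<sigma>' N < emeasure \<sigma>' K + ennreal (\<epsilon> / 8)"
      by auto
    have Ks: "K \<in> sets \<sigma>" "N \<in> sets \<sigma>"
      using N K by (auto intro!: sets_I borel_compact)
    have "measure \<sigma> N < measure \<sigma> K + \<epsilon> / 8"
      using K em[of N] em[of K] N \<open>\<epsilon> > 0\<close>
      by (simp add: borel_compact emeasure_eq_measure ennreal_plus[symmetric] ennreal_less_iff del: ennreal_plus)
    moreover have "measure \<sigma> ({0..1} - K) \<le> measure \<sigma> ({0..1} - N) + (measure \<sigma> N - measure \<sigma> K)"
    proof -
      have "measure \<sigma> ({0..1} - A) = measure \<sigma> {0..1} - measure \<sigma> A" if "A \<in> sets \<sigma>" for A
        using finite_measure_compl[OF that] by (simp add: space_eq)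
      then show ?thesis using Ks by simp
    qed
    moreover have "measure \<sigma> ({0..1} - N) = 0" using N by (simp add: measure_def)
    ultimately show ?thesis using that[of K] K by simp
  qed
  \<comment> \<open>The end points are the same point of the circle, so both are added to \<open>K\<close>.\<close>
  define L where "L = K \<union> {0, 1}"
  have L: "compact L" "L \<subseteq> {0..1}" "0 \<in> L" "1 \<in> L"
    using K N by (auto simp: L_def)
  have Lb [measurable]: "L \<in> sets borel" using L by (simp add: borel_compact)
  have L\<sigma>: "measure \<sigma> ({0..1} - L) < \<epsilon> / 8"
  proof -
    have "measure \<sigma> ({0..1} - L) \<le> measure \<sigma> ({0..1} - K)"
      using K by (intro finite_measure_mono sets_I) (auto simp: L_def borel_compact)
    then show ?thesis using K by linarith
  qed
  have Lnull: "emeasure lborel L = 0"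
  proof -
    have "emeasure lborel L \<le> emeasure lborel N + emeasure lborel {0, 1::real}"
      using K N by (intro order_trans[OF emeasure_mono emeasure_subadditive]) (auto simp: L_def)
    then show ?thesis using N by (simp add: emeasure_lborel_countable)
  qed
  define C where "C = circ ` L"
  have C: "closed C" "C \<noteq> {}" "1 \<in> C"
    using L unfolding C_def
    by (auto intro!: compact_imp_closed compact_continuous_image continuous_intros
        simp: image_iff intro: bexI[of _ 0])
  have circ_L: "t \<in> L" if t: "circ t \<in> C" "t \<in> {0..1}" for t
  proof -
    obtain s where s: "s \<in> L" "circ t = circ s" using t unfolding C_def by blast
    then have "circ (t - s) = 1"
      using complex_norm_square[of "circ s"] by (simp add: circ_diff)
    then obtain n :: int where "t - s = of_int n" by (auto simp: circ_eq_1_iff elim: Ints_cases)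
    moreover have "s \<in> {0..1}" using s L by auto
    ultimately have "real_of_int n \<le> 1" "real_of_int n \<ge> - 1" using that by auto
    then have "n = 0 \<or> n = 1 \<or> n = - 1" by linarith
    then have "t = s \<or> t = 0 \<or> t = 1"
      using \<open>t - s = of_int n\<close> that \<open>s \<in> {0..1}\<close> by (elim disjE) auto
    then show ?thesis using s L by auto
  qed
  \<comment> \<open>Vanishes on \<open>C\<close> and tends to 1 off \<open>C\<close>; as a function on the circle it needs no periodicity check.\<close>
  define \<psi> where "\<psi> m z = min 1 (real m * infdist z C)" for m z
  have \<psi>01: "0 \<le> \<psi> m z" "\<psi> m z \<le> 1" for m z by (auto simp: \<psi>_def infdist_nonneg)
  have \<psi>C: "\<psi> m z = 0" if "z \<in> C" for m z using that by (simp add: \<psi>_def)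
  have \<psi>cont: "continuous_on A (\<psi> m)" for A m
    unfolding \<psi>_def by (intro continuous_intros)
  have \<psi>meas [measurable]: "\<psi> m \<in> borel_measurable borel" for m
    by (intro borel_measurable_continuous_onI \<psi>cont)
  have "(\<lambda>m. \<integral>t. (1 - \<psi> m (circ t))\<^sup>2 \<partial>lebesgue_01) \<longlonglongrightarrow> (\<integral>t. 0 \<partial>lebesgue_01)"
  proof (rule integral_dominated_convergence[where w = "\<lambda>_. 1"])
    have "AE t in lborel. t \<notin> L"
      using Lnull by (intro AE_not_in) (simp add: null_sets_def)
    then have "AE t in lebesgue_01. t \<notin> L \<and> t \<in> {0..1}"
      by (auto simp: AE_restrict_space_iff elim: eventually_mono)
    then show "AE t in lebesgue_01. (\<lambda>m. (1 - \<psi> m (circ t))\<^sup>2) \<longlonglongrightarrow> 0"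
    proof eventually_elim
      case (elim t)
      then have "circ t \<notin> C" using circ_L by blast
      then have pos: "infdist (circ t) C > 0"
        using C by (metis in_closed_iff_infdist_zero infdist_nonneg less_eq_real_def)
      have "\<forall>\<^sub>F m in sequentially. \<psi> m (circ t) = 1"
      proof -
        obtain m0 :: nat where m0: "1 / infdist (circ t) C \<le> real m0" using real_arch_simple by blast
        have "\<psi> m (circ t) = 1" if "m \<ge> m0" for m
        proof -
          have "1 / infdist (circ t) C \<le> real m" using m0 that by linarith
          then show ?thesis using pos by (simp add: \<psi>_def field_simps)
        qed
        then show ?thesis by (auto simp: eventually_sequentially)
      qed
      then show ?case by (intro tendsto_eventually) (auto elim: eventually_mono)
    qed
    show "AE t in lebesgue_01. norm ((1 - \<psi> m (circ t))\<^sup>2) \<le> 1" for m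
      using \<psi>01 by (auto intro!: AE_I2 power_le_one)
    show "integrable lebesgue_01 (\<lambda>_. 1::real)" by (rule lebesgue_01.integrable_bounded) auto
  qed (auto intro!: lebesgue_01.borel_measurable)
  then have "\<forall>\<^sub>F m in sequentially. (\<integral>t. (1 - \<psi> m (circ t))\<^sup>2 \<partial>lebesgue_01) < \<epsilon> / 8"
    by (rule order_tendstoD) (use \<open>\<epsilon> > 0\<close> in simp)
  then obtain m where m: "(\<integral>t. (1 - \<psi> m (circ t))\<^sup>2 \<partial>lebesgue_01) < \<epsilon> / 8"
    by (auto simp: eventually_sequentially)
  obtain g where g: "real_polynomial_function g"
    "\<And>z. z \<in> sphere 0 1 \<Longrightarrow> \<bar>\<psi> m z - g z\<bar> < \<delta>"
    using Stone_Weierstrass_real_polynomial_function[OF compact_sphere[of 0 1] \<psi>cont \<delta>(1)] by metis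
  obtain p :: "complex poly" and J where p: "\<And>z. cmod z = 1 \<Longrightarrow> of_real (g z) * z ^ J = poly p z"
    using real_polynomial_function_on_circle[OF g(1)] by blast
  define d where "d = max (degree p) J"
  define G where "G t = g (circ t)" for t
  have sum: "(\<Sum>j\<le>d. coeff p j * circ (real j * t)) = of_real (G t) * circ (real J * t)" for t
      proof -
    have "(\<Sum>j\<le>d. coeff p j * circ t ^ j) = poly p (circ t)"
      unfolding poly_altdef
      by (rule sum.mono_neutral_right) (auto simp: d_def coeff_eq_0)
    then show ?thesis
      using p[of "circ t"] by (simp add: circ_power G_def)
  qed
  have gb: "\<bar>\<psi> m (circ t) - G t\<bar> < \<delta>" for t using g(2)[of "circ t"] by (simp add: G_def)
  have Gmeas [measurable]: "G \<in> borel_measurable borel"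
    unfolding G_def
    by (intro borel_measurable_continuous_onI continuous_at_imp_continuous_on ballI
        isCont_o2[OF _ continuous_real_polymonial_function[OF g(1)]])
      (auto intro!: continuous_on_interior[OF continuous_on_circ[OF continuous_on_id], of _ UNIV])
  have Gb: "\<bar>G t\<bar> \<le> 1 + \<delta>" for t using gb[of t] \<psi>01[of m "circ t"] by linarith
  have GL: "\<bar>G t\<bar> \<le> \<delta>" if "t \<in> L" for t
    using gb[of t] \<psi>C[of "circ t" m] that by (auto simp: C_def)
  show ?thesis
  proof (rule that[of J d "coeff p"])
    show "J \<le> d" by (simp add: d_def)
    have "(\<integral>t. (cmod (\<Sum>j\<le>d. coeff p j * circ (real j * t)))\<^sup>2 \<partial>\<sigma>) = (\<integral>t. (G t)\<^sup>2 \<partial>\<sigma>)"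
      by (simp add: sum norm_mult)
    also have "\<dots> \<le> (\<integral>t. \<delta>\<^sup>2 + 4 * indicator ({0..1} - L) t \<partial>\<sigma>)"
    proof (rule integral_mono)
      show "integrable \<sigma> (\<lambda>t. (G t)\<^sup>2)"
        by (rule integrable_bounded[where B = "(1 + \<delta>)\<^sup>2"])
          (use Gb in \<open>auto simp: abs_le_square_iff[symmetric] \<delta>(1) less_imp_le intro: order_trans\<close>)
      show "integrable \<sigma> (\<lambda>t. \<delta>\<^sup>2 + 4 * indicator ({0..1} - L) t)"
        by (rule integrable_bounded[where B = "\<delta>\<^sup>2 + 4"]) (auto simp: indicator_def)
      fix t assume "t \<in> space \<sigma>"
      show "(G t)\<^sup>2 \<le> \<delta>\<^sup>2 + 4 * indicator ({0..1} - L) t"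
      proof (cases "t \<in> L")
        case True
        then show ?thesis using power_mono[OF GL[OF True], of 2] by simp
      next
        case False
        have "\<bar>G t\<bar>\<^sup>2 \<le> 2\<^sup>2" using Gb[of t] \<delta> by (intro power_mono) auto
        then have "(G t)\<^sup>2 \<le> 4" by simp
        then show ?thesis using False \<open>t \<in> space \<sigma>\<close> by (simp add: space_eq)
          (meson add_increasing zero_le_power2)
      qed
    qed
    also have "\<dots> = \<delta>\<^sup>2 * V + 4 * measure \<sigma> ({0..1} - L)"
    proof -
      have "{0..1} - L \<in> sets \<sigma>" by (auto intro!: sets_I)
      moreover from this have "({0..1} - L) \<inter> {0..1} = {0..1} - L" by auto
      ultimately show ?thesis
        using integrable_bounded[of "\<lambda>_. \<delta>\<^sup>2" "\<delta>\<^sup>2"]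
        by (subst Bochner_Integration.integral_add) (auto simp: V_def space_eq less_top[symmetric])
    qed
    also have "\<dots> < \<epsilon>"
      using \<delta> \<delta>2 V L\<sigma> mult_right_mono[OF \<delta>2(1) V] by (simp add: algebra_simps)
    finally show "(\<integral>t. (cmod (\<Sum>j\<le>d. coeff p j * circ (real j * t)))\<^sup>2 \<partial>\<sigma>) < \<epsilon>" .
    have "(\<Sum>j\<le>d. coeff p j) = of_real (G 0)" using sum[of 0] by simp
    then have "(cmod (\<Sum>j\<le>d. coeff p j))\<^sup>2 = (G 0)\<^sup>2" by simp
    also have "\<dots> \<le> \<delta>\<^sup>2" using GL[OF L(3)] \<delta> by (simp add: abs_le_square_iff[symmetric])
    also have "\<dots> < \<epsilon>" using \<delta>2 \<open>\<epsilon> > 0\<close> by linarith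
    finally show "(cmod (\<Sum>j\<le>d. coeff p j))\<^sup>2 < \<epsilon>" .
    have "(\<Sum>j\<le>d. ((if j = J then 1 else 0) - coeff p j) * circ (real j * t)) = of_real (1 - G t) * circ (real J * t)" for t
    proof -
      have "(\<Sum>j\<le>d. ((if j = J then 1 else 0) - coeff p j) * circ (real j * t)) =
          (\<Sum>j\<le>d. if j = J then circ (real J * t) else 0) - of_real (G t) * circ (real J * t)"
        unfolding sum[symmetric] sum_subtractf[symmetric] by (intro sum.cong) (auto simp: algebra_simps)
      then show ?thesis by (simp add: d_def algebra_simps)
    qed
    then have "(\<Sum>j\<le>d. (cmod ((if j = J then 1 else 0) - coeff p j))\<^sup>2) =
        (\<integral>t. (cmod (of_real (1 - G t) * circ (real J * t)))\<^sup>2 \<partial>lebesgue_01)"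
      by (simp only: parseval_sum_circ[symmetric])
    also have "\<dots> = (\<integral>t. (1 - G t)\<^sup>2 \<partial>lebesgue_01)"
      by (simp only: norm_mult norm_circ norm_of_real) simp
    also have "\<dots> \<le> (\<integral>t. 2 * (1 - \<psi> m (circ t))\<^sup>2 + 2 * \<delta>\<^sup>2 \<partial>lebesgue_01)"
    proof (rule integral_mono)
      show "integrable lebesgue_01 (\<lambda>t. (1 - G t)\<^sup>2)"
      proof (rule lebesgue_01.integrable_bounded[where B = "3\<^sup>2"])
        fix t have "\<bar>1 - G t\<bar>\<^sup>2 \<le> 3\<^sup>2" using Gb[of t] \<delta> by (intro power_mono) auto
        then show "norm ((1 - G t)\<^sup>2) \<le> 3\<^sup>2" by simp
      qed simp
      show "integrable lebesgue_01 (\<lambda>t. 2 * (1 - \<psi> m (circ t))\<^sup>2 + 2 * \<delta>\<^sup>2)"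
        by (rule lebesgue_01.integrable_bounded[where B = "2 + 2 * \<delta>\<^sup>2"])
          (use \<psi>01 in \<open>auto simp: power_le_one\<close>)
      fix t
      have "(1 - G t)\<^sup>2 \<le> 2 * (1 - \<psi> m (circ t))\<^sup>2 + 2 * (\<psi> m (circ t) - G t)\<^sup>2"
        using sum_squares_bound[of "1 - \<psi> m (circ t)" "\<psi> m (circ t) - G t"]
        by (simp add: power2_eq_square algebra_simps)
      moreover have "(\<psi> m (circ t) - G t)\<^sup>2 \<le> \<delta>\<^sup>2"
        using gb[of t] by (simp add: abs_le_square_iff[symmetric])
      ultimately show "(1 - G t)\<^sup>2 \<le> 2 * (1 - \<psi> m (circ t))\<^sup>2 + 2 * \<delta>\<^sup>2" by linarith
    qed
    also have "\<dots> = 2 * (\<integral>t. (1 - \<psi> m (circ t))\<^sup>2 \<partial>lebesgue_01) + 2 * \<delta>\<^sup>2"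
    proof -
      have "integrable lebesgue_01 (\<lambda>t. 2 * (1 - \<psi> m (circ t))\<^sup>2)"
        by (rule lebesgue_01.integrable_bounded[where B = 2]) (use \<psi>01 in \<open>auto simp: power_le_one\<close>)
      moreover have "integrable lebesgue_01 (\<lambda>t. 2 * \<delta>\<^sup>2)"
        by (rule lebesgue_01.integrable_bounded) auto
      ultimately show ?thesis
        by (subst Bochner_Integration.integral_add) (auto simp: measure_restrict_space space_restrict_space)
    qed
    also have "\<dots> < \<epsilon>" using m \<delta>2 \<open>\<epsilon> > 0\<close> by linarith
    finally show "(\<Sum>j\<le>d. (cmod ((if j = J then 1 else 0) - coeff p j))\<^sup>2) < \<epsilon>" .
  qed
qed

section \<open>Positive definite sequences\<close>

text \<open>
  A sequence indexed by the integers is positive definite if all its Toeplitz forms are real and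
  nonnegative.
\<close>

definition positive_definite :: "(int \<Rightarrow> complex) \<Rightarrow> bool" where
  "positive_definite a \<longleftrightarrow> (\<forall>(N::nat) (c::nat \<Rightarrow> complex). \<exists>r\<ge>0.
     (\<Sum>j<N. \<Sum>l<N. c j * cnj (c l) * a (int j - int l)) = complex_of_real r)"

lemma positive_definite_zero:
  assumes "positive_definite a" "a 0 = 0"
  shows "a n = 0"
proof -
  have "a (int m) = 0 \<and> a (- int m) = 0" if "m > 0" for m
  proof -
    have form: "\<exists>r\<ge>0. z * a (- int m) + cnj z * a (int m) = complex_of_real r" for z
    proof -
      define c where "c = (\<lambda>j. if j = 0 then z else if j = m then 1 else (0::complex))"
      have restrict: "(\<Sum>j<Suc m. h j) = h 0 + h m" if "\<And>j. c j = 0 \<Longrightarrow> h j = 0" for h :: "nat \<Rightarrow> complex"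
      proof -
        have "(\<Sum>j<Suc m. h j) = (\<Sum>j\<in>{0, m}. h j)"
          using that by (intro sum.mono_neutral_right) (auto simp: c_def)
        then show ?thesis using \<open>m > 0\<close> by simp
      qed
      have "(\<Sum>j<Suc m. \<Sum>l<Suc m. c j * cnj (c l) * a (int j - int l)) =
          z * a (- int m) + cnj z * a (int m)"
        using \<open>m > 0\<close> assms(2)
        by (subst restrict, simp)+ (simp add: c_def)
      then show ?thesis using assms(1) unfolding positive_definite_def by metis
    qed
    have zero: "z * a (- int m) + cnj z * a (int m) = 0" for z
    proof -
      obtain r where "r \<ge> 0" "z * a (- int m) + cnj z * a (int m) = complex_of_real r"
        using form[of z] by blast
      moreover obtain s where "s \<ge> 0" "- z * a (- int m) + cnj (- z) * a (int m) = complex_of_real s"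
        using form[of "- z"] by blast
      moreover have "- z * a (- int m) + cnj (- z) * a (int m) = - (z * a (- int m) + cnj z * a (int m))"
        by simp
      ultimately have "complex_of_real (- r) = complex_of_real s" by (metis of_real_minus)
      then have "- r = s" by (simp only: of_real_eq_iff)
      then show ?thesis using \<open>r \<ge> 0\<close> \<open>s \<ge> 0\<close> \<open>_ = complex_of_real r\<close> by simp
    qed
    show ?thesis using zero[of 1] zero[of \<i>] by (auto simp: complex_eq_iff)
  qed
  from this[of "nat \<bar>n\<bar>"] show ?thesis using assms(2) by (cases "n = 0"; cases "n > 0") auto
qed

text \<open>
  The \<open>N\<close>-th Fejer mean of the formal Fourier series with coefficients \<open>a\<close>, written as a Toeplitz form so
  that its nonnegativity is visible.
\<close>

definition fejer_density :: "(int \<Rightarrow> complex) \<Rightarrow> nat \<Rightarrow> real \<Rightarrow> complex" where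
  "fejer_density a N t =
     (\<Sum>j<N. \<Sum>l<N. a (int j - int l) * circ (- (of_int (int j - int l) * t))) / of_nat N"

text \<open>
  The factor by which the \<open>N\<close>-th Fejer mean multiplies the \<open>n\<close>-th coefficient.  For \<open>N > 0\<close> it
  equals \<open>max 0 (1 - |n| / N)\<close>; only bounds are needed.
\<close>

definition fejer_weight :: "nat \<Rightarrow> int \<Rightarrow> real" where
  "fejer_weight N n = (\<Sum>j<N. \<Sum>l<N. if int j - int l = n then 1 else 0) / real N"

lemma fejer_weight_bounds:
  assumes "N > 0"
  shows "fejer_weight N n \<le> 1" "fejer_weight N n \<ge> 1 - 2 * \<bar>real_of_int n\<bar> / real N"
proof -
  have inner: "(\<Sum>l<N. if int j - int l = n then 1 else 0) = (if 0 \<le> int j - n \<and> int j - n < int N then 1 else (0::real))"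
    for j
  proof -
    have "(\<Sum>l<N. if int j - int l = n then 1 else 0) = (\<Sum>l<N. if l = nat (int j - n) \<and> 0 \<le> int j - n then 1 else (0::real))"
      by (intro sum.cong refl if_cong) auto
    also have "\<dots> = (if 0 \<le> int j - n \<and> int j - n < int N then 1 else (0::real))"
      by (cases "0 \<le> int j - n") (auto simp: nat_less_iff)
    finally show ?thesis .
  qed
  have "(\<Sum>j<N. \<Sum>l<N. if int j - int l = n then 1 else 0) \<le> (\<Sum>j<N. 1::real)"
    unfolding inner by (intro sum_mono) auto
  then show "fejer_weight N n \<le> 1" using assms by (simp add: fejer_weight_def)
  have "real N - 2 * \<bar>real_of_int n\<bar> \<le> real (card {nat \<bar>n\<bar>..<N - nat \<bar>n\<bar>})"
    by auto
  also have "\<dots> = (\<Sum>j\<in>{nat \<bar>n\<bar>..<N - nat \<bar>n\<bar>}. 1::real)" by simp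
  also have "\<dots> \<le> (\<Sum>j<N. if 0 \<le> int j - n \<and> int j - n < int N then 1 else (0::real))"
    unfolding sum.inter_filter[symmetric, OF finite_lessThan]
    by (intro sum_mono2) auto
  finally have "(real N - 2 * \<bar>real_of_int n\<bar>) / real N \<le> fejer_weight N n"
    unfolding fejer_weight_def inner by (intro divide_right_mono) auto
  then show "fejer_weight N n \<ge> 1 - 2 * \<bar>real_of_int n\<bar> / real N"
    using assms by (simp add: diff_divide_distrib)
qed

lemma fejer_weight_tendsto: "(\<lambda>N. fejer_weight N n) \<longlonglongrightarrow> 1"
proof (rule tendsto_sandwich)
  show "\<forall>\<^sub>F N in sequentially. 1 - 2 * \<bar>real_of_int n\<bar> / real N \<le> fejer_weight N n"
    "\<forall>\<^sub>F N in sequentially. fejer_weight N n \<le> 1"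
    using eventually_gt_at_top[of 0] by (eventually_elim, use fejer_weight_bounds in blast)+
  show "(\<lambda>N. 1 - 2 * \<bar>real_of_int n\<bar> / real N) \<longlonglongrightarrow> 1"
    using tendsto_diff[OF tendsto_const lim_const_over_n[of "2 * \<bar>real_of_int n\<bar>"]] by simp
qed simp

lemma integral_fejer_density:
  "(\<integral>t. fejer_density a N t * circ (of_int n * t) \<partial>lebesgue_01) = of_real (fejer_weight N n) * a n"
proof -
  have "fejer_density a N t * circ (of_int n * t) =
      (\<Sum>j<N. \<Sum>l<N. a (int j - int l) / of_nat N * circ (of_int (n - (int j - int l)) * t))" for t
  proof -
    have "circ (- (of_int k * t)) * circ (of_int n * t) = circ (of_int (n - k) * t)" for k
      by (simp add: circ_add[symmetric] algebra_simps)
    then show ?thesis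
      unfolding fejer_density_def sum_divide_distrib sum_distrib_right
      by (intro sum.cong refl) (simp only: mult.assoc times_divide_eq_left)
  qed
  moreover have "integrable lebesgue_01 (\<lambda>t. c * circ (of_int m * t))" for c m
    by (rule lebesgue_01.integrable_bounded[where B = "cmod c"]) (auto simp: norm_mult)
  ultimately have "(\<integral>t. fejer_density a N t * circ (of_int n * t) \<partial>lebesgue_01) =
      (\<Sum>j<N. \<Sum>l<N. a (int j - int l) / of_nat N * (\<integral>t. circ (of_int (n - (int j - int l)) * t) \<partial>lebesgue_01))"
    by (simp only: Bochner_Integration.integral_sum Bochner_Integration.integrable_sum
        integral_mult_right_zero)
  also have "\<dots> = (\<Sum>j<N. \<Sum>l<N. a n / of_nat N * of_real (if int j - int l = n then 1 else 0))"
    unfolding integral_circ_lebesgue by (intro sum.cong refl) auto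
  also have "\<dots> = of_real (fejer_weight N n) * a n"
    unfolding fejer_weight_def by (simp only: sum_distrib_left[symmetric] of_real_sum[symmetric]) simp
  finally show ?thesis .
qed

text \<open>
  Herglotz's theorem: the Fejer means of a positive definite sequence are nonnegative densities, and
  a weak limit of them has the prescribed coefficients.
\<close>

theorem herglotz:
  assumes pd: "positive_definite a"
  obtains \<sigma> where "circle_measure \<sigma>" "\<And>n. (\<integral>t. circ (of_int n * t) \<partial>\<sigma>) = a n"
proof -
  obtain A where A: "A \<ge> 0" "a 0 = complex_of_real A"
    using pd[unfolded positive_definite_def, THEN spec, of 1, THEN spec, of "\<lambda>_. 1"] by auto
  show ?thesis
  proof (cases "A = 0")
    case True
    let ?\<sigma> = "null_measure (restrict_space borel {0..1::real})"
    have "circle_measure ?\<sigma>"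
      by (intro circle_measure.intro finite_measureI circle_measure_axioms.intro) auto
    moreover have "(\<integral>t. circ (of_int n * t) \<partial>?\<sigma>) = a n" for n
      using positive_definite_zero[OF pd] A True by simp
    ultimately show ?thesis using that by blast
  next
    case False
    then have "A > 0" using A by simp
    define p where "p N = fejer_density a (Suc N)" for N
    have p_eq: "p N t = complex_of_real (Re (p N t))" and p_nonneg: "Re (p N t) \<ge> 0" for N t
    proof -
      have "(\<Sum>j<Suc N. \<Sum>l<Suc N. circ (- (real j * t)) * cnj (circ (- (real l * t))) * a (int j - int l)) =
          (\<Sum>j<Suc N. \<Sum>l<Suc N. a (int j - int l) * circ (- (of_int (int j - int l) * t)))"
      proof (intro sum.cong refl)
        fix j l
        have "circ (- (real j * t)) * cnj (circ (- (real l * t))) = circ (- (of_int (int j - int l) * t))"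
          by (simp add: circ_diff[symmetric] algebra_simps)
        then show "circ (- (real j * t)) * cnj (circ (- (real l * t))) * a (int j - int l) =
            a (int j - int l) * circ (- (of_int (int j - int l) * t))"
          by (simp only: mult.commute)
      qed
      then obtain r where "r \<ge> 0" "p N t = complex_of_real r / of_nat (Suc N)"
        using pd unfolding positive_definite_def p_def fejer_density_def by metis
      then have "r \<ge> 0" "p N t = complex_of_real (r / real (Suc N))" by simp_all
      then show "p N t = complex_of_real (Re (p N t))" "Re (p N t) \<ge> 0" by simp_all
    qed
    have p_cont: "continuous_on S (p N)" for N S
      unfolding p_def fejer_density_def by (intro continuous_intros) (auto simp del: of_nat_Suc)
    have p_meas [measurable]: "p N \<in> borel_measurable borel" for N
      by (intro borel_measurable_continuous_onI p_cont)
    define w where "w N t = indicator {0..1} t * Re (p N t) / A" for N and t :: real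
    have w_meas [measurable]: "w N \<in> borel_measurable borel" for N unfolding w_def by measurable
    have w_nonneg: "w N t \<ge> 0" for N t using p_nonneg \<open>A > 0\<close> by (simp add: w_def)
    define \<mu> where "\<mu> N = density lborel (\<lambda>t. ennreal (w N t))" for N
    have coeff: "(\<integral>t. circ (of_int n * t) \<partial>\<mu> N) = of_real (fejer_weight (Suc N) n) * a n / of_real A" for N n
    proof -
      have "(\<integral>t. circ (of_int n * t) \<partial>\<mu> N) = (\<integral>t. w N t *\<^sub>R circ (of_int n * t) \<partial>lborel)"
        unfolding \<mu>_def by (rule integral_density) (use w_nonneg in auto)
      also have "\<dots> = (\<integral>t. indicator {0..1} t *\<^sub>R (p N t * circ (of_int n * t) / of_real A) \<partial>lborel)"
      proof (intro Bochner_Integration.integral_cong refl)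
        fix t
        show "w N t *\<^sub>R circ (of_int n * t) = indicator {0..1} t *\<^sub>R (p N t * circ (of_int n * t) / of_real A)"
          using p_eq[of N t] by (simp add: w_def scaleR_conv_of_real)
      qed
      also have "\<dots> = (\<integral>t. p N t * circ (of_int n * t) / of_real A \<partial>lebesgue_01)"
        by (rule integral_restrict_space[symmetric]) auto
      also have "\<dots> = of_real (fejer_weight (Suc N) n) * a n / of_real A"
        by (simp add: p_def integral_fejer_density)
      finally show ?thesis .
    qed
    have rd: "real_distribution (\<mu> N)" for N
    proof (intro real_distribution.intro real_distribution_axioms.intro prob_spaceI)
      have int: "integrable lborel (w N)"
      proof -
        have "integrable lborel (\<lambda>t. indicator {0..1} t *\<^sub>R (Re (p N t) / A))"
          by (rule borel_integrable_compact) (use \<open>A > 0\<close> in \<open>auto intro!: continuous_intros p_cont\<close>)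
        then show ?thesis by (simp add: w_def[abs_def])
      qed
      have "fejer_weight (Suc N) 0 = 1"
        using fejer_weight_bounds[of "Suc N" 0] by simp
      then have "(\<integral>t. 1 \<partial>\<mu> N) = (1::complex)"
        using coeff[where n = 0 and N = N] A \<open>A > 0\<close> by simp
      also have "(\<integral>t. 1 \<partial>\<mu> N) = (\<integral>t. w N t *\<^sub>R (1::complex) \<partial>lborel)"
        unfolding \<mu>_def by (rule integral_density) (use w_nonneg in auto)
      also have "\<dots> = of_real (\<integral>t. w N t \<partial>lborel)"
        by (simp add: scaleR_conv_of_real)
      finally have "(\<integral>t. w N t \<partial>lborel) = 1" by (simp only: of_real_eq_1_iff)
      then have "(\<integral>\<^sup>+t. ennreal (w N t) \<partial>lborel) = 1"
        using nn_integral_eq_integral[OF int] w_nonneg by simp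
      then show "emeasure (\<mu> N) (space (\<mu> N)) = 1"
        by (simp add: \<mu>_def emeasure_density)
      show "sets (\<mu> N) = sets borel" by (simp add: \<mu>_def)
    qed
    have AE01: "AE t in \<mu> N. t \<in> {0..1}" for N
      unfolding \<mu>_def by (subst AE_density) (auto simp: w_def indicator_def)
    have "tight \<mu>"
      unfolding tight_def
    proof (intro conjI allI impI)
      fix \<epsilon> :: real assume "\<epsilon> > 0"
      have "measure (\<mu> N) {-1<..1} > 1 - \<epsilon>" for N
      proof -
        interpret real_distribution "\<mu> N" by (rule rd)
        have "AE t in \<mu> N. t \<in> {-1<..1}" using AE01 by eventually_elim auto
        then have "prob {-1<..1} = 1" by (subst prob_eq_1) auto
        then show ?thesis using \<open>\<epsilon> > 0\<close> by simp
      qed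
      then show "\<exists>a b. a < b \<and> (\<forall>N. measure (\<mu> N) {a<..b} > 1 - \<epsilon>)"
        by (intro exI[of _ "- 1"] exI[of _ 1]) auto
    qed (use rd in auto)
    then obtain r \<nu> where r: "strict_mono (r :: nat \<Rightarrow> nat)" "real_distribution \<nu>"
      "weak_conv_m (\<mu> \<circ> id \<circ> r) \<nu>"
      using tight_imp_convergent_subsubsequence[of \<mu> id] strict_mono_id by blast
    interpret \<nu>: real_distribution \<nu> by fact
    have lim: "(\<lambda>i. \<integral>t. f t \<partial>\<mu> (r i)) \<longlonglongrightarrow> (\<integral>t. f t \<partial>\<nu>)"
      if "continuous_on UNIV f" "\<And>t. norm (f t) \<le> 1" for f :: "real \<Rightarrow> 'b::{banach, second_countable_topology}"
      using weak_conv_imp_integral_bdd_continuous_conv[of "\<mu> \<circ> id \<circ> r" \<nu> f 1] r rd that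
      by (auto simp: continuous_on_eq_continuous_at)
    have \<nu>01: "AE t in \<nu>. t \<in> {0..1}"
    proof -
      let ?f = "\<lambda>t::real. min 1 (infdist t {0..1})"
      have nn: "0 \<le> ?f t" "?f t \<le> 1" for t by (auto simp: infdist_nonneg)
      have f_meas: "?f \<in> borel_measurable borel"
        by (intro borel_measurable_continuous_onI continuous_intros)
      have "(\<integral>t. ?f t \<partial>\<mu> (r i)) = (\<integral>t. 0 \<partial>\<mu> (r i))" for i
      proof (rule integral_cong_AE)
        show "AE t in \<mu> (r i). ?f t = 0" using AE01 by eventually_elim simp
      qed (use f_meas in \<open>auto simp: \<mu>_def\<close>)
      moreover have "(\<lambda>i. \<integral>t. ?f t \<partial>\<mu> (r i)) \<longlonglongrightarrow> (\<integral>t. ?f t \<partial>\<nu>)"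
        by (rule lim) (auto intro!: continuous_intros simp: infdist_nonneg)
      ultimately have "(\<integral>t. ?f t \<partial>\<nu>) = 0" by (simp add: LIMSEQ_const_iff)
      moreover have "integrable \<nu> ?f"
        by (rule \<nu>.integrable_const_bound[where B = 1]) (use f_meas in \<open>auto simp: infdist_nonneg\<close>)
      ultimately have "AE t in \<nu>. ?f t = 0"
        using nn f_meas by (subst (asm) integral_nonneg_eq_0_iff_AE) auto
      then show ?thesis
      proof eventually_elim
        case (elim t)
        then have "infdist t {0..1} = 0" by (auto simp: min_def split: if_splits)
        then show ?case using in_closed_iff_infdist_zero[of "{0..1::real}" t] by auto
      qed
    qed
    have \<nu>coeff: "(\<integral>t. circ (of_int n * t) \<partial>\<nu>) = a n / of_real A" for n
    proof (rule LIMSEQ_unique)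
      show "(\<lambda>i. \<integral>t. circ (of_int n * t) \<partial>\<mu> (r i)) \<longlonglongrightarrow> (\<integral>t. circ (of_int n * t) \<partial>\<nu>)"
        by (rule lim) (auto intro!: continuous_intros)
      have "(\<lambda>i. fejer_weight (Suc (r i)) n) \<longlonglongrightarrow> 1"
        using filterlim_compose[OF fejer_weight_tendsto
            filterlim_compose[OF filterlim_Suc filterlim_subseq[OF r(1)]]] .
      then have "(\<lambda>i. of_real (fejer_weight (Suc (r i)) n) * a n / of_real A) \<longlonglongrightarrow> of_real 1 * a n / of_real A"
        by (intro tendsto_intros) (use \<open>A > 0\<close> in auto)
      then show "(\<lambda>i. \<integral>t. circ (of_int n * t) \<partial>\<mu> (r i)) \<longlonglongrightarrow> a n / of_real A"
        by (simp add: coeff)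
    qed
    define \<sigma> where "\<sigma> = density (restrict_space \<nu> {0..1}) (\<lambda>_. ennreal A)"
    have "circle_measure \<sigma>"
    proof (intro circle_measure.intro finite_measureI circle_measure_axioms.intro)
      show "sets \<sigma> = sets (restrict_space borel {0..1})"
        by (simp add: \<sigma>_def) (rule sets_restrict_space_cong, simp)
      show "emeasure \<sigma> (space \<sigma>) \<noteq> \<infinity>"
        unfolding \<sigma>_def
        by (subst emeasure_density_const) (auto simp: space_restrict_space emeasure_restrict_space ennreal_mult_eq_top_iff
            sets_restrict_space image_iff intro!: bexI[of _ "{0..1}"])
    qed
    moreover have "(\<integral>t. circ (of_int n * t) \<partial>\<sigma>) = a n" for n
    proof -
      have meas: "(\<lambda>t. circ (of_int n * t)) \<in> borel_measurable (restrict_space \<nu> {0..1})"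
        by (rule measurable_restrict_space1) measurable
      have "(\<integral>t. circ (of_int n * t) \<partial>\<sigma>) = (\<integral>t. A *\<^sub>R circ (of_int n * t) \<partial>restrict_space \<nu> {0..1})"
        unfolding \<sigma>_def by (rule integral_density) (use \<open>A > 0\<close> meas in auto)
      also have "\<dots> = (\<integral>t. indicator {0..1} t *\<^sub>R (A *\<^sub>R circ (of_int n * t)) \<partial>\<nu>)"
        by (rule integral_restrict_space) auto
      also have "\<dots> = (\<integral>t. A *\<^sub>R circ (of_int n * t) \<partial>\<nu>)"
      proof (rule integral_cong_AE)
        show "AE t in \<nu>. indicator {0..1} t *\<^sub>R (A *\<^sub>R circ (of_int n * t)) = A *\<^sub>R circ (of_int n * t)"
          using \<nu>01 by eventually_elim simp
      qed auto
      also have "\<dots> = a n" using \<open>A > 0\<close> by (simp add: \<nu>coeff scaleR_conv_of_real)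
      finally show ?thesis .
    qed
    ultimately show ?thesis using that by blast
  qed
qed

section \<open>Measure preserving maps and their correlation sequences\<close>

text \<open>Invertibility is not part of the notion, which makes it stable under taking powers at no cost.\<close>

definition measure_preserving_map :: "'a measure \<Rightarrow> ('a \<Rightarrow> 'a) \<Rightarrow> bool" where
  "measure_preserving_map M R \<longleftrightarrow> R \<in> measurable M M \<and> distr M M R = M"

lemma measure_preserving_map_measurable:
  "measure_preserving_map M R \<Longrightarrow> R \<in> measurable M M"
  by (simp add: measure_preserving_map_def)

lemma measure_preserving_map_funpow:
  assumes "measure_preserving_map M R"
  shows "measure_preserving_map M (R ^^ n)"
proof (induction n)
  case 0
  then show ?case by (simp add: measure_preserving_map_def distr_id id_def)
next
  case (Suc n)
  have "distr M M (R \<circ> R ^^ n) = distr (distr M M (R ^^ n)) M R"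
    using assms Suc by (intro distr_distr[symmetric]) (auto simp: measure_preserving_map_def)
  then have "measure_preserving_map M (R \<circ> R ^^ n)"
    using assms Suc unfolding measure_preserving_map_def
    by (intro conjI measurable_comp[of _ M M]) simp_all
  then show ?case by (simp only: funpow.simps)
qed

lemma integral_measure_preserving:
  fixes f :: "'a \<Rightarrow> 'b::{banach, second_countable_topology}"
  assumes "measure_preserving_map M R" "f \<in> borel_measurable M"
  shows "(\<integral>x. f (R x) \<partial>M) = (\<integral>x. f x \<partial>M)"
  using integral_distr[of R M M f] assms by (simp add: measure_preserving_map_def)

lemma AE_measure_preserving:
  assumes "measure_preserving_map M R" "AE x in M. P x"
  shows "AE x in M. P (R x)"
proof (rule AE_distrD[where M' = M])
  have "distr M M R = M" using assms by (simp add: measure_preserving_map_def)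
  then show "AE x in distr M M R. P x" using assms(2) by (rule ssubst)
qed (rule measure_preserving_map_measurable[OF assms(1)])

lemma automorphism_measure_preserving:
  assumes "measure_preserving_automorphism M R"
  shows "measure_preserving_map M R" "measure_preserving_map M (the_inv_into (space M) R)"
proof -
  note * = assms[unfolded measure_preserving_automorphism_def]
  have inj: "inj_on R (space M)" "R ` space M = space M" using * by (auto simp: bij_betw_def)
  show "measure_preserving_map M R"
    unfolding measure_preserving_map_def
    using * by (auto intro!: measure_eqI simp: emeasure_distr)
  have "the_inv_into (space M) R -` A \<inter> space M = R ` A" if "A \<in> sets M" for A
  proof -
    have "A \<subseteq> space M" using that sets.sets_into_space by auto
    show ?thesis
    proof (intro equalityI subsetI)
      fix y assume "y \<in> the_inv_into (space M) R -` A \<inter> space M"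
      then have "the_inv_into (space M) R y \<in> A" "R (the_inv_into (space M) R y) = y"
        using f_the_inv_into_f[OF inj(1)] inj(2) by auto
      then show "y \<in> R ` A" by (metis imageI)
    next
      fix y assume "y \<in> R ` A"
      then show "y \<in> the_inv_into (space M) R -` A \<inter> space M"
        using inj \<open>A \<subseteq> space M\<close> by (auto simp: the_inv_into_f_f subset_iff)
    qed
  qed
  then show "measure_preserving_map M (the_inv_into (space M) R)"
    unfolding measure_preserving_map_def
    using * by (auto intro!: measure_eqI simp: emeasure_distr)
qed

lemma measurable_cnj [measurable]: "cnj \<in> borel_measurable borel"
  by (intro borel_measurable_continuous_onI continuous_intros)

text \<open>
  The correlation sequence of \<open>f\<close> under \<open>R\<close>, indexed by the integers.  For negative indices it is the
  complex conjugate of the value at the opposite index, so that it makes sense for non-invertible maps.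
\<close>

definition correlation :: "'a measure \<Rightarrow> ('a \<Rightarrow> 'a) \<Rightarrow> ('a \<Rightarrow> complex) \<Rightarrow> int \<Rightarrow> complex" where
  "correlation M R f n =
     (if 0 \<le> n then \<integral>x. f ((R ^^ nat n) x) * cnj (f x) \<partial>M
      else \<integral>x. f x * cnj (f ((R ^^ nat (- n)) x)) \<partial>M)"

context prob_space
begin

lemma integrable_bounded:
  fixes f :: "'a \<Rightarrow> 'b::{banach, second_countable_topology}"
  shows "f \<in> borel_measurable M \<Longrightarrow> (\<And>x. norm (f x) \<le> B) \<Longrightarrow> integrable M f"
  by (rule integrable_const_bound[where B = B]) auto

lemma integral_le_bound:
  fixes f :: "'a \<Rightarrow> real"
  assumes "f \<in> borel_measurable M" "\<And>x. norm (f x) \<le> B"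
  shows "(\<integral>x. f x \<partial>M) \<le> B"
proof -
  have "(\<integral>x. f x \<partial>M) \<le> (\<integral>x. B \<partial>M)"
    using integrable_bounded[OF assms] assms(2)
    by (intro integral_mono) (auto intro: order_trans[OF abs_ge_self])
  then show ?thesis by (simp add: prob_space)
qed

lemma correlation_shift:
  assumes R: "measure_preserving_map M R" and f: "f \<in> borel_measurable M"
  shows "(\<integral>x. f ((R ^^ j) x) * cnj (f ((R ^^ l) x)) \<partial>M) = correlation M R f (int j - int l)"
proof (cases "l \<le> j")
  case True
  note [measurable] = f measure_preserving_map_measurable[OF R]
    measure_preserving_map_measurable[OF measure_preserving_map_funpow[OF R]]
  have "(\<integral>x. f ((R ^^ (j - l)) ((R ^^ l) x)) * cnj (f ((R ^^ l) x)) \<partial>M) =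
      (\<integral>x. f ((R ^^ (j - l)) x) * cnj (f x) \<partial>M)"
    by (rule integral_measure_preserving[OF measure_preserving_map_funpow[OF R]]) measurable
  moreover have "(R ^^ (j - l)) ((R ^^ l) x) = (R ^^ j) x" for x
    using True by (metis comp_apply funpow_add le_add_diff_inverse2)
  ultimately show ?thesis using True by (simp add: correlation_def nat_diff_distrib)
next
  case False
  note [measurable] = f measure_preserving_map_measurable[OF R]
    measure_preserving_map_measurable[OF measure_preserving_map_funpow[OF R]]
  have "(\<integral>x. f ((R ^^ j) x) * cnj (f ((R ^^ (l - j)) ((R ^^ j) x))) \<partial>M) =
      (\<integral>x. f x * cnj (f ((R ^^ (l - j)) x)) \<partial>M)"
    by (rule integral_measure_preserving[OF measure_preserving_map_funpow[OF R]]) measurable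
  moreover have "(R ^^ (l - j)) ((R ^^ j) x) = (R ^^ l) x" for x
    using False by (metis comp_apply funpow_add le_add_diff_inverse2 nat_le_linear)
  ultimately show ?thesis using False by (simp add: correlation_def nat_diff_distrib)
qed

lemma correlation_form:
  assumes R: "measure_preserving_map M R" and f: "f \<in> borel_measurable M" "\<And>x. cmod (f x) \<le> C"
    and "finite A"
  shows "complex_of_real (\<integral>x. (cmod (\<Sum>j\<in>A. c j * f ((R ^^ j) x)))\<^sup>2 \<partial>M) =
    (\<Sum>j\<in>A. \<Sum>l\<in>A. c j * cnj (c l) * correlation M R f (int j - int l))"
proof -
  note [measurable] = f(1) measure_preserving_map_measurable[OF R]
    measure_preserving_map_measurable[OF measure_preserving_map_funpow[OF R]]
  have "C \<ge> 0" using f(2) norm_ge_zero order_trans by blast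
  have "complex_of_real ((cmod (\<Sum>j\<in>A. c j * f ((R ^^ j) x)))\<^sup>2) =
      (\<Sum>j\<in>A. \<Sum>l\<in>A. c j * cnj (c l) * (f ((R ^^ j) x) * cnj (f ((R ^^ l) x))))" for x
    unfolding complex_norm_square cnj_sum sum_product by (simp add: mult_ac)
  moreover have "complex_of_real (\<integral>x. (cmod (\<Sum>j\<in>A. c j * f ((R ^^ j) x)))\<^sup>2 \<partial>M) =
      (\<integral>x. complex_of_real ((cmod (\<Sum>j\<in>A. c j * f ((R ^^ j) x)))\<^sup>2) \<partial>M)"
    by (rule integral_complex_of_real[symmetric])
  moreover have "integrable M (\<lambda>x. b * (f ((R ^^ j) x) * cnj (f ((R ^^ l) x))))" for b j l
    by (rule integrable_bounded[where B = "cmod b * (C * C)"])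
      (use f(2) \<open>C \<ge> 0\<close> in \<open>auto simp: norm_mult intro!: mult_mono\<close>)
  ultimately show ?thesis
    by (simp only: Bochner_Integration.integral_sum Bochner_Integration.integrable_sum
        integral_mult_right_zero correlation_shift[OF R f(1)])
qed

lemma positive_definite_correlation:
  assumes "measure_preserving_map M R" "f \<in> borel_measurable M" "\<And>x. cmod (f x) \<le> C"
  shows "positive_definite (correlation M R f)"
  unfolding positive_definite_def
proof (intro allI)
  fix N and c :: "nat \<Rightarrow> complex"
  show "\<exists>r\<ge>0. (\<Sum>j<N. \<Sum>l<N. c j * cnj (c l) * correlation M R f (int j - int l)) = complex_of_real r"
    by (rule exI[of _ "\<integral>x. (cmod (\<Sum>j<N. c j * f ((R ^^ j) x)))\<^sup>2 \<partial>M"])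
      (simp only: correlation_form[OF assms finite_lessThan], simp)
qed

text \<open>
  A spectral measure of a bounded function under a measure preserving map, which need not be
  invertible.
\<close>

lemma obtain_spectral_measure:
  assumes R: "measure_preserving_map M R" and f: "f \<in> borel_measurable M" "\<And>x. cmod (f x) \<le> C"
  obtains \<sigma> where "circle_measure \<sigma>"
    "\<And>n. (\<integral>t. circ (of_int n * t) \<partial>\<sigma>) = correlation M R f n"
    "\<And>d q. (\<integral>x. (cmod (\<Sum>j\<le>d. q j * f ((R ^^ j) x)))\<^sup>2 \<partial>M) =
        (\<integral>t. (cmod (\<Sum>j\<le>d. q j * circ (real j * t)))\<^sup>2 \<partial>\<sigma>)"
proof -
  obtain \<sigma> where \<sigma>: "circle_measure \<sigma>"
    "\<And>n. (\<integral>t. circ (of_int n * t) \<partial>\<sigma>) = correlation M R f n"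
    using herglotz[OF positive_definite_correlation[OF assms]] by blast
  have "(\<integral>x. (cmod (\<Sum>j\<le>d. q j * f ((R ^^ j) x)))\<^sup>2 \<partial>M) =
        (\<integral>t. (cmod (\<Sum>j\<le>d. q j * circ (real j * t)))\<^sup>2 \<partial>\<sigma>)" for d and q :: "nat \<Rightarrow> complex"
    using trans[OF correlation_form[OF assms finite_atMost, of q d]
        circle_measure.integral_norm_sum_circ[OF \<sigma>(1), of q d, unfolded \<sigma>(2), symmetric]]
    by (simp only: of_real_eq_iff)
  with \<sigma> show ?thesis using that by blast
qed

end

section \<open>Averages of characters\<close>

lemma average_powers_tendsto:
  fixes z :: complex
  assumes "cmod z = 1"
  shows "(\<lambda>N. (\<Sum>n=1..N. z ^ n) / of_nat N) \<longlonglongrightarrow> (if z = 1 then 1 else 0)"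
proof (cases "z = 1")
  case True
  have "\<forall>\<^sub>F N in sequentially. (\<Sum>n=1..N. z ^ n) / of_nat N = 1"
    using eventually_gt_at_top[of 0] by eventually_elim (simp add: True)
  then show ?thesis using True by (simp add: tendsto_eventually)
next
  case False
  have "(\<lambda>N. (\<Sum>n=1..N. z ^ n) / of_nat N) \<longlonglongrightarrow> 0"
  proof (rule Lim_null_comparison)
    show "\<forall>\<^sub>F N in sequentially. norm ((\<Sum>n=1..N. z ^ n) / of_nat N) \<le> (2 / cmod (1 - z)) / real N"
    proof (rule always_eventually, rule allI)
      fix N
      have "(1 - z) * (\<Sum>n=1..N. z ^ n) = z - z ^ Suc N"
      proof (induction N)
        case (Suc N)
        have "(1 - z) * (\<Sum>n=1..Suc N. z ^ n) = (1 - z) * (\<Sum>n=1..N. z ^ n) + (1 - z) * z ^ Suc N"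
          by (simp add: distrib_left)
        also have "\<dots> = z - z ^ Suc (Suc N)" unfolding Suc.IH by (simp add: algebra_simps)
        finally show ?case .
      qed simp
      then have "cmod (1 - z) * cmod (\<Sum>n=1..N. z ^ n) \<le> cmod z + cmod (z ^ Suc N)"
        using norm_triangle_ineq4[of z "z ^ Suc N"] by (simp only: norm_mult[symmetric])
      then have "cmod (\<Sum>n=1..N. z ^ n) \<le> 2 / cmod (1 - z)"
        using False assms by (simp add: field_simps norm_mult norm_power)
      then show "norm ((\<Sum>n=1..N. z ^ n) / of_nat N) \<le> (2 / cmod (1 - z)) / real N"
        unfolding norm_divide norm_of_nat by (rule divide_right_mono) simp
    qed
    show "(\<lambda>N. (2 / cmod (1 - z)) / real N) \<longlonglongrightarrow> 0" by (rule lim_const_over_n)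
  qed
  then show ?thesis using False by simp
qed

lemma norm_average_le:
  assumes "\<And>n. cmod (a n) \<le> C" "C \<ge> 0"
  shows "cmod ((\<Sum>n=1..N. a n) / of_nat N) \<le> C"
proof (cases "N = 0")
  case False
  have "cmod (\<Sum>n=1..N. a n) \<le> (\<Sum>n=1..N. C)"
    by (rule order_trans[OF norm_sum sum_mono]) (use assms in auto)
  then show ?thesis using False by (simp add: norm_divide divide_le_eq mult.commute)
qed (use assms in simp)

lemma (in circle_measure) integral_character_averages_Cauchy:
  assumes "\<epsilon> > 0"
  shows "\<exists>N0. \<forall>N\<ge>N0. \<forall>K\<ge>N0.
    (\<integral>t. (cmod ((\<Sum>n=1..N. circ (real n * t)) / of_nat N - (\<Sum>n=1..K. circ (real n * t)) / of_nat K))\<^sup>2 \<partial>\<sigma>) < \<epsilon>"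
proof -
  define D where "D N t = (\<Sum>n=1..N. circ (real n * t)) / of_nat N" for N t
  define I where "I t = (if circ t = 1 then 1 else 0 :: complex)" for t
  have Db: "cmod (D N t) \<le> 1" for N t
    unfolding D_def by (rule norm_average_le) auto
  have Ib: "cmod (I t) \<le> 1" for t by (simp add: I_def)
  have [measurable]: "D N \<in> borel_measurable borel" for N unfolding D_def by measurable
  have [measurable]: "I \<in> borel_measurable borel" unfolding I_def by measurable
  have bound: "(cmod (u - v))\<^sup>2 \<le> 4" if "cmod u \<le> 1" "cmod v \<le> 1" for u v
  proof -
    have "cmod (u - v) \<le> 2" using norm_triangle_ineq4[of u v] that by linarith
    then have "(cmod (u - v))\<^sup>2 \<le> 2\<^sup>2" by (intro power_mono) auto
    then show ?thesis by simp
  qed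
  have int: "integrable \<sigma> (\<lambda>t. (cmod (f t - g t))\<^sup>2)"
    if [measurable]: "f \<in> borel_measurable borel" "g \<in> borel_measurable borel" and "\<And>t. cmod (f t) \<le> 1" "\<And>t. cmod (g t) \<le> 1"
    for f g
    by (rule integrable_bounded[where B = 4]) (use that bound in auto)
  have "(\<lambda>N. \<integral>t. (cmod (D N t - I t))\<^sup>2 \<partial>\<sigma>) \<longlonglongrightarrow> (\<integral>t. 0 \<partial>\<sigma>)"
  proof (rule integral_dominated_convergence[where w = "\<lambda>_. 4"])
    show "AE t in \<sigma>. (\<lambda>N. (cmod (D N t - I t))\<^sup>2) \<longlonglongrightarrow> 0"
    proof (rule AE_I2)
      fix t
      have "(\<lambda>N. D N t) \<longlonglongrightarrow> I t"
        unfolding D_def I_def circ_power[symmetric] by (rule average_powers_tendsto) simp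
      then have "(\<lambda>N. (cmod (D N t - I t))\<^sup>2) \<longlonglongrightarrow> (cmod (I t - I t))\<^sup>2"
        by (intro tendsto_intros)
      then show "(\<lambda>N. (cmod (D N t - I t))\<^sup>2) \<longlonglongrightarrow> 0" by simp
    qed
    show "AE t in \<sigma>. norm ((cmod (D N t - I t))\<^sup>2) \<le> 4" for N
      using bound[OF Db Ib] by auto
  qed (auto intro!: integrable_bounded)
  then have "\<forall>\<^sub>F N in sequentially. (\<integral>t. (cmod (D N t - I t))\<^sup>2 \<partial>\<sigma>) < \<epsilon> / 4"
    by (rule order_tendstoD) (use assms in simp)
  then obtain N0 where N0: "\<And>N. N \<ge> N0 \<Longrightarrow> (\<integral>t. (cmod (D N t - I t))\<^sup>2 \<partial>\<sigma>) < \<epsilon> / 4"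
    by (auto simp: eventually_sequentially)
  have "(\<integral>t. (cmod (D N t - D K t))\<^sup>2 \<partial>\<sigma>) < \<epsilon>" if "N \<ge> N0" "K \<ge> N0" for N K
  proof -
    have "(\<integral>t. (cmod (D N t - D K t))\<^sup>2 \<partial>\<sigma>) \<le> (\<integral>t. 2 * (cmod (D N t - I t))\<^sup>2 + 2 * (cmod (D K t - I t))\<^sup>2 \<partial>\<sigma>)"
    proof (rule integral_mono)
      fix t
      have "cmod (D N t - D K t) \<le> cmod (D N t - I t) + cmod (D K t - I t)"
        using norm_triangle_ineq4[of "D N t - I t" "D K t - I t"] by simp
      then have "(cmod (D N t - D K t))\<^sup>2 \<le> (cmod (D N t - I t) + cmod (D K t - I t))\<^sup>2"
        by (intro power_mono) auto
      also have "\<dots> \<le> 2 * (cmod (D N t - I t))\<^sup>2 + 2 * (cmod (D K t - I t))\<^sup>2"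
        using sum_squares_bound[of "cmod (D N t - I t)" "cmod (D K t - I t)"]
        by (simp add: power2_eq_square algebra_simps)
      finally show "(cmod (D N t - D K t))\<^sup>2 \<le> 2 * (cmod (D N t - I t))\<^sup>2 + 2 * (cmod (D K t - I t))\<^sup>2" .
    qed (use Db Ib in \<open>intro Bochner_Integration.integrable_add integrable_mult_right int; simp\<close>)+
    also have "\<dots> = 2 * (\<integral>t. (cmod (D N t - I t))\<^sup>2 \<partial>\<sigma>) + 2 * (\<integral>t. (cmod (D K t - I t))\<^sup>2 \<partial>\<sigma>)"
      using Db Ib by (subst Bochner_Integration.integral_add) (auto intro!: int)
    also have "\<dots> < \<epsilon>" using N0[OF that(1)] N0[OF that(2)] by linarith
    finally show ?thesis .
  qed
  then show ?thesis unfolding D_def by blast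
qed

section \<open>The mean ergodic theorem for bounded functions\<close>

lemma invariant_sets_sigma_algebra:
  assumes "R \<in> measurable M M"
  shows "sigma_algebra (space M) (invariant_sets M R)"
  unfolding sigma_algebra_iff2
proof (intro conjI ballI allI impI)
  have sp: "R x \<in> space M" if "x \<in> space M" for x
    using assms that by (rule measurable_space)
  show "invariant_sets M R \<subseteq> Pow (space M)"
    by (auto simp: invariant_sets_def dest: sets.sets_into_space)
  show "{} \<in> invariant_sets M R" by (simp add: invariant_sets_def)
  show "space M - A \<in> invariant_sets M R" if "A \<in> invariant_sets M R" for A
    using that sp by (auto simp: invariant_sets_def)
  show "(\<Union>i. A i) \<in> invariant_sets M R" if "range A \<subseteq> invariant_sets M R" for A :: "nat \<Rightarrow> 'a set"
  proof -
    have "A i \<in> sets M" "R -` A i \<inter> space M = A i" for i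
      using that by (auto simp: invariant_sets_def)
    then show ?thesis by (simp add: invariant_sets_def vimage_UN Int_UN_distrib2[symmetric] sets.countable_UN)
      (auto simp: set_eq_iff)
  qed
qed

lemma sets_invariant_algebra:
  assumes "R \<in> measurable M M"
  shows "sets (invariant_algebra M R) = invariant_sets M R"
  unfolding invariant_algebra_def
  using sigma_algebra.sets_measure_of_eq[OF invariant_sets_sigma_algebra[OF assms]] .

lemma subalgebra_invariant_algebra:
  assumes "R \<in> measurable M M"
  shows "subalgebra M (invariant_algebra M R)"
  unfolding subalgebra_def sets_invariant_algebra[OF assms]
  by (auto simp: invariant_algebra_def space_measure_of_conv invariant_sets_def)

lemma measurable_invariant_algebra:
  assumes "R \<in> measurable M M" "F \<in> borel_measurable M" "\<And>x. x \<in> space M \<Longrightarrow> F (R x) = F x"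
  shows "F \<in> borel_measurable (invariant_algebra M R)"
proof (rule measurableI)
  fix B :: "'b set" assume "B \<in> sets borel"
  have "space (invariant_algebra M R) = space M"
    using subalgebra_invariant_algebra[OF assms(1)] by (simp add: subalgebra_def)
  moreover have "F -` B \<inter> space M \<in> invariant_sets M R"
    unfolding invariant_sets_def
    using assms \<open>B \<in> sets borel\<close> measurable_space[OF assms(1)] measurable_sets[OF assms(2)] by auto
  ultimately show "F -` B \<inter> space (invariant_algebra M R) \<in> sets (invariant_algebra M R)"
    by (simp add: sets_invariant_algebra[OF assms(1)])
qed simp

text \<open>The average of \<open>f\<close> over the first \<open>N\<close> iterates of \<open>R\<close>, starting from the first one; it is 0 for \<open>N = 0\<close>.\<close>

definition ergodic_average :: "('a \<Rightarrow> 'a) \<Rightarrow> ('a \<Rightarrow> complex) \<Rightarrow> nat \<Rightarrow> 'a \<Rightarrow> complex" where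
  "ergodic_average R f N x = (\<Sum>n=1..N. f ((R ^^ n) x)) / of_nat N"

context prob_space
begin

lemma integral_cmod_less:
  fixes u :: "'a \<Rightarrow> complex"
  assumes u: "u \<in> borel_measurable M" "\<And>x. cmod (u x) \<le> B"
    and "(\<integral>x. (cmod (u x))\<^sup>2 \<partial>M) < \<epsilon>\<^sup>2" "\<epsilon> > 0"
  shows "(\<integral>x. cmod (u x) \<partial>M) < \<epsilon>"
proof -
  note [measurable] = u(1)
  have int: "integrable M (\<lambda>x. (cmod (u x))\<^sup>2)"
    by (rule integrable_bounded[where B = "B\<^sup>2"]) (auto intro!: power_mono u)
  have "(\<integral>x. cmod (u x) \<partial>M) \<le> (\<integral>x. \<epsilon> / 2 + (cmod (u x))\<^sup>2 / (2 * \<epsilon>) \<partial>M)"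
  proof (rule integral_mono)
    show "integrable M (\<lambda>x. cmod (u x))"
      by (rule integrable_bounded[where B = B]) (auto intro: u)
    show "integrable M (\<lambda>x. \<epsilon> / 2 + (cmod (u x))\<^sup>2 / (2 * \<epsilon>))"
      using int by auto
    show "cmod (u x) \<le> \<epsilon> / 2 + (cmod (u x))\<^sup>2 / (2 * \<epsilon>)" for x
      using sum_squares_bound[of \<epsilon> "cmod (u x)"] \<open>\<epsilon> > 0\<close> by (simp add: field_simps power2_eq_square)
  qed
  also have "\<dots> = \<epsilon> / 2 + (\<integral>x. (cmod (u x))\<^sup>2 \<partial>M) / (2 * \<epsilon>)"
    using int by (simp add: prob_space)
  also have "\<dots> < \<epsilon> / 2 + \<epsilon>\<^sup>2 / (2 * \<epsilon>)"
    using assms(3,4) by (intro add_strict_left_mono divide_strict_right_mono) auto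
  also have "\<dots> = \<epsilon>" using \<open>\<epsilon> > 0\<close> by (simp add: power2_eq_square)
  finally show ?thesis .
qed

lemma square_diff_le:
  fixes u v w :: complex
  shows "(cmod (u - w))\<^sup>2 \<le> 2 * (cmod (u - v))\<^sup>2 + 2 * (cmod (v - w))\<^sup>2"
proof -
  have "cmod (u - w) \<le> cmod (u - v) + cmod (v - w)"
    using norm_triangle_ineq[of "u - v" "v - w"] by simp
  then have "(cmod (u - w))\<^sup>2 \<le> (cmod (u - v) + cmod (v - w))\<^sup>2"
    by (intro power_mono) auto
  then show ?thesis
    using sum_squares_bound[of "cmod (u - v)" "cmod (v - w)"] by (simp add: power2_eq_square algebra_simps)
qed

lemma square_diff_bound:
  assumes "cmod u \<le> C" "cmod v \<le> C"
  shows "(cmod (u - v))\<^sup>2 \<le> 4 * C\<^sup>2"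
proof -
  have "cmod (u - v) \<le> 2 * C" using norm_triangle_ineq4[of u v] assms by linarith
  then have "(cmod (u - v))\<^sup>2 \<le> (2 * C)\<^sup>2" by (intro power_mono) auto
  then show ?thesis by (simp add: power_mult_distrib)
qed

lemma integral_square_diff_le:
  fixes u v w :: "'a \<Rightarrow> complex"
  assumes [measurable]: "u \<in> borel_measurable M" "v \<in> borel_measurable M" "w \<in> borel_measurable M"
    and b: "\<And>x. cmod (u x) \<le> B" "\<And>x. cmod (v x) \<le> B" "\<And>x. cmod (w x) \<le> B"
  shows "(\<integral>x. (cmod (u x - w x))\<^sup>2 \<partial>M) \<le> 2 * (\<integral>x. (cmod (u x - v x))\<^sup>2 \<partial>M) + 2 * (\<integral>x. (cmod (v x - w x))\<^sup>2 \<partial>M)"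
proof -
  have int: "integrable M (\<lambda>x. (cmod (f x - g x))\<^sup>2)"
    if [measurable]: "f \<in> borel_measurable M" "g \<in> borel_measurable M"
      and "\<And>x. cmod (f x) \<le> B" "\<And>x. cmod (g x) \<le> B" for f g :: "'a \<Rightarrow> complex"
    by (rule integrable_bounded[where B = "4 * B\<^sup>2"]) (auto intro!: square_diff_bound that)
  have "(\<integral>x. (cmod (u x - w x))\<^sup>2 \<partial>M) \<le> (\<integral>x. 2 * (cmod (u x - v x))\<^sup>2 + 2 * (cmod (v x - w x))\<^sup>2 \<partial>M)"
    by (rule integral_mono)
      (use b square_diff_le in \<open>auto intro!: int Bochner_Integration.integrable_add integrable_mult_right\<close>)
  also have "\<dots> = 2 * (\<integral>x. (cmod (u x - v x))\<^sup>2 \<partial>M) + 2 * (\<integral>x. (cmod (v x - w x))\<^sup>2 \<partial>M)"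
    using b by (subst Bochner_Integration.integral_add) (auto intro!: int)
  finally show ?thesis .
qed

lemma ergodic_average_Cauchy:
  assumes R: "measure_preserving_map M R" and f: "f \<in> borel_measurable M" "\<And>x. cmod (f x) \<le> C"
    and "\<epsilon> > 0"
  shows "\<exists>N0. \<forall>N\<ge>N0. \<forall>K\<ge>N0.
    (\<integral>x. (cmod (ergodic_average R f N x - ergodic_average R f K x))\<^sup>2 \<partial>M) < \<epsilon>"
proof -
  obtain \<sigma> where \<sigma>: "circle_measure \<sigma>"
    "\<And>d q. (\<integral>x. (cmod (\<Sum>j\<le>d. q j * f ((R ^^ j) x)))\<^sup>2 \<partial>M) =
        (\<integral>t. (cmod (\<Sum>j\<le>d. q j * circ (real j * t)))\<^sup>2 \<partial>\<sigma>)"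
    by (rule obtain_spectral_measure[OF R f]) blast
  have split: "(\<Sum>j\<le>max N K. (of_bool (1 \<le> j \<and> j \<le> N) / of_nat N - of_bool (1 \<le> j \<and> j \<le> K) / of_nat K) * h j) =
      (\<Sum>n=1..N. h n) / of_nat N - (\<Sum>n=1..K. h n) / of_nat K" for h :: "nat \<Rightarrow> complex" and N K
  proof -
    have "(\<Sum>j\<le>max N K. of_bool (1 \<le> j \<and> j \<le> L) / of_nat L * h j) = (\<Sum>n=1..L. h n) / of_nat L"
      if "L \<le> max N K" for L
    proof -
      have "(\<Sum>j\<le>max N K. of_bool (1 \<le> j \<and> j \<le> L) / of_nat L * h j) = (\<Sum>j\<in>{1..L}. h j / of_nat L)"
        using that by (intro sum.mono_neutral_cong_right) auto
      then show ?thesis by (simp add: sum_divide_distrib)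
    qed
    then show ?thesis by (simp add: left_diff_distrib sum_subtractf)
  qed
  show ?thesis
    using circle_measure.integral_character_averages_Cauchy[OF \<sigma>(1) \<open>\<epsilon> > 0\<close>]
    unfolding split[symmetric] ergodic_average_def \<sigma>(2) .
qed

lemma ergodic_average_measurable:
  assumes "measure_preserving_map M R" "f \<in> borel_measurable M"
  shows "ergodic_average R f N \<in> borel_measurable M"
proof -
  note [measurable] = assms(2) measure_preserving_map_measurable[OF assms(1)]
    measure_preserving_map_measurable[OF measure_preserving_map_funpow[OF assms(1)]]
  show ?thesis unfolding ergodic_average_def by measurable
qed

lemma ergodic_average_bounded:
  assumes "\<And>x. cmod (f x) \<le> C"
  shows "cmod (ergodic_average R f N x) \<le> C"
  unfolding ergodic_average_def
  by (rule norm_average_le) (use assms norm_ge_zero order_trans in blast)+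

text \<open>
  The averages are Cauchy in \<open>L\<^sup>2\<close> because, by the spectral measure, this is a statement about
  averages of characters.  The limit is realised as the pointwise limit along a subsequence, with the
  value 0 where that does not exist; it is therefore bounded by the same constant, and it is exactly
  invariant rather than only almost everywhere.
\<close>

theorem mean_ergodic:
  assumes R: "measure_preserving_map M R" and f: "f \<in> borel_measurable M" "\<And>x. cmod (f x) \<le> C"
  obtains F where "F \<in> borel_measurable M" "\<And>x. cmod (F x) \<le> C"
    "\<And>x. x \<in> space M \<Longrightarrow> F (R x) = F x"
    "(\<lambda>N. \<integral>x. (cmod (ergodic_average R f N x - F x))\<^sup>2 \<partial>M) \<longlonglongrightarrow> 0"
    "AE x in M. cond_exp M (invariant_algebra M R) f x = F x"
proof -
  note Rm [measurable] = measure_preserving_map_measurable[OF R]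
  define A where "A = ergodic_average R f"
  have Am [measurable]: "A N \<in> borel_measurable M" for N
    unfolding A_def by (rule ergodic_average_measurable[OF R f(1)])
  have Ab: "cmod (A N x) \<le> C" for N x
    unfolding A_def by (rule ergodic_average_bounded) (rule f)
  have "C \<ge> 0" using f(2) norm_ge_zero order_trans by blast
  have diffb: "cmod (u - v) \<le> 2 * C" if "cmod u \<le> C" "cmod v \<le> C" for u v
    using norm_triangle_ineq4[of u v] that by linarith
  have "\<exists>N. \<forall>i\<ge>N. \<forall>j\<ge>N. (\<integral>x. norm (A i x - A j x) \<partial>M) < e" if e: "e > 0" for e
  proof -
    obtain N where "\<forall>i\<ge>N. \<forall>j\<ge>N. (\<integral>x. (cmod (A i x - A j x))\<^sup>2 \<partial>M) < e\<^sup>2"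
      using ergodic_average_Cauchy[OF R f, of "e\<^sup>2"] e unfolding A_def by auto
    then have "\<forall>i\<ge>N. \<forall>j\<ge>N. (\<integral>x. cmod (A i x - A j x) \<partial>M) < e"
      using that Ab by (auto intro!: integral_cmod_less[where B = "2 * C"] diffb)
    then show ?thesis by blast
  qed
  then obtain r where r: "strict_mono r" "AE x in M. Cauchy (\<lambda>i. A (r i) x)"
    using cauchy_L1_AE_cauchy_subseq[of M A] integrable_bounded[OF Am Ab] by blast
  define F where "F x = (if Cauchy (\<lambda>i. A (r i) x) then lim (\<lambda>i. A (r i) x) else 0)" for x
  have Fm [measurable]: "F \<in> borel_measurable M" unfolding F_def by measurable
  have Flim: "(\<lambda>i. A (r i) x) \<longlonglongrightarrow> F x" if "Cauchy (\<lambda>i. A (r i) x)" for x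
    using that Cauchy_convergent_iff[of "\<lambda>i. A (r i) x"] by (simp add: F_def convergent_LIMSEQ_iff)
  have Fb: "cmod (F x) \<le> C" for x
  proof (cases "Cauchy (\<lambda>i. A (r i) x)")
    case True
    show ?thesis using LIMSEQ_le_const2[OF tendsto_norm[OF Flim[OF True]]] Ab by blast
  qed (simp add: F_def \<open>C \<ge> 0\<close>)
  have Finv: "F (R x) = F x" for x
  proof -
    have "(\<lambda>N. A N (R x) - A N x) \<longlonglongrightarrow> 0"
    proof (rule Lim_null_comparison)
      show "\<forall>\<^sub>F N in sequentially. norm (A N (R x) - A N x) \<le> (2 * C) / real N"
      proof (rule always_eventually, rule allI)
        fix N
        have "(\<Sum>n=1..N. f ((R ^^ n) (R x))) - (\<Sum>n=1..N. f ((R ^^ n) x)) = f ((R ^^ Suc N) x) - f (R x)"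
          by (induction N) (auto simp: funpow_swap1 algebra_simps)
        then have "A N (R x) - A N x = (f ((R ^^ Suc N) x) - f (R x)) / of_nat N"
          unfolding A_def ergodic_average_def by (simp only: diff_divide_distrib[symmetric])
        then show "norm (A N (R x) - A N x) \<le> (2 * C) / real N"
          using diffb[OF f(2) f(2)] by (simp add: norm_divide divide_right_mono)
      qed
    qed (rule lim_const_over_n)
    from LIMSEQ_subseq_LIMSEQ[OF this r(1)]
    have lim: "(\<lambda>i. A (r i) (R x) - A (r i) x) \<longlonglongrightarrow> 0" by (simp add: comp_def)
    have iff: "(\<lambda>i. A (r i) (R x)) \<longlonglongrightarrow> l \<longleftrightarrow> (\<lambda>i. A (r i) x) \<longlonglongrightarrow> l" for l
      using tendsto_add[OF _ lim, of "\<lambda>i. A (r i) x" l] tendsto_diff[OF _ lim, of "\<lambda>i. A (r i) (R x)" l] by auto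
    show ?thesis
      unfolding F_def Cauchy_convergent_iff convergent_def lim_def iff ..
  qed
  have int: "integrable M (\<lambda>x. (cmod (u x - v x))\<^sup>2)"
    if [measurable]: "u \<in> borel_measurable M" "v \<in> borel_measurable M"
      and "\<And>x. cmod (u x) \<le> C" "\<And>x. cmod (v x) \<le> C" for u v :: "'a \<Rightarrow> complex"
    by (rule integrable_bounded[where B = "4 * C\<^sup>2"]) (auto intro!: square_diff_bound that)
  have sub0: "(\<lambda>i. \<integral>x. (cmod (A (r i) x - F x))\<^sup>2 \<partial>M) \<longlonglongrightarrow> (\<integral>x. 0 \<partial>M)"
  proof (rule integral_dominated_convergence[where w = "\<lambda>_. 4 * C\<^sup>2"])
    show "AE x in M. (\<lambda>i. (cmod (A (r i) x - F x))\<^sup>2) \<longlonglongrightarrow> 0"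
      using r(2)
    proof eventually_elim
      case (elim x)
      have "(\<lambda>i. (cmod (A (r i) x - F x))\<^sup>2) \<longlonglongrightarrow> (cmod (F x - F x))\<^sup>2"
        by (intro tendsto_intros Flim elim)
      then show ?case by simp
    qed
    show "AE x in M. norm ((cmod (A (r i) x - F x))\<^sup>2) \<le> 4 * C\<^sup>2" for i
      by (auto intro!: square_diff_bound Ab Fb)
  qed auto
  have conv: "(\<lambda>N. \<integral>x. (cmod (A N x - F x))\<^sup>2 \<partial>M) \<longlonglongrightarrow> 0"
  proof (rule LIMSEQ_I)
    fix e :: real assume "e > 0"
    then obtain N0 where N0: "\<And>N K. N \<ge> N0 \<Longrightarrow> K \<ge> N0 \<Longrightarrow> (\<integral>x. (cmod (A N x - A K x))\<^sup>2 \<partial>M) < e / 4"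
      using ergodic_average_Cauchy[OF R f, of "e / 4"] unfolding A_def by auto
    have "\<forall>\<^sub>F i in sequentially. (\<integral>x. (cmod (A (r i) x - F x))\<^sup>2 \<partial>M) < e / 4"
      using sub0 by (rule order_tendstoD) (use \<open>e > 0\<close> in simp)
    then obtain i0 where i0: "\<And>i. i \<ge> i0 \<Longrightarrow> (\<integral>x. (cmod (A (r i) x - F x))\<^sup>2 \<partial>M) < e / 4"
      by (auto simp: eventually_sequentially)
    define i where "i = max i0 N0"
    have ri: "r i \<ge> N0" using seq_suble[OF r(1), of i] by (simp add: i_def)
    have "norm ((\<integral>x. (cmod (A N x - F x))\<^sup>2 \<partial>M) - 0) < e" if "N \<ge> N0" for N
    proof -
      have "(\<integral>x. (cmod (A N x - F x))\<^sup>2 \<partial>M) \<le>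
          2 * (\<integral>x. (cmod (A N x - A (r i) x))\<^sup>2 \<partial>M) + 2 * (\<integral>x. (cmod (A (r i) x - F x))\<^sup>2 \<partial>M)"
        by (rule integral_square_diff_le[where B = C]) (auto intro: Ab Fb)
      also have "\<dots> < e" using N0[OF that ri] i0[of i] by (simp add: i_def)
      finally show ?thesis by (simp add: integral_nonneg_AE)
    qed
    then show "\<exists>N0. \<forall>N\<ge>N0. norm ((\<integral>x. (cmod (A N x - F x))\<^sup>2 \<partial>M) - 0) < e" by blast
  qed
  \<comment> \<open>The limit has the same integrals as \<open>f\<close> over invariant sets.\<close>
  have ints: "(\<integral>x. indicator B x * F x \<partial>M) = (\<integral>x. indicator B x * f x \<partial>M)" if B: "B \<in> invariant_sets M R" for B
  proof -
    have [measurable]: "B \<in> sets M" using B by (simp add: invariant_sets_def)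
    note [measurable] = f(1) measure_preserving_map_measurable[OF measure_preserving_map_funpow[OF R]]
    have ib: "cmod (indicator B x * z) \<le> C" if "cmod z \<le> C" for x z
      using that \<open>C \<ge> 0\<close> by (auto simp: indicator_def)
    have Bn: "(R ^^ n) x \<in> B \<longleftrightarrow> x \<in> B" if "x \<in> space M" for n x
      using that
    proof (induction n arbitrary: x)
      case (Suc n)
      have "R x \<in> space M" using Suc.prems Rm by (rule measurable_space[rotated])
      then have "(R ^^ Suc n) x \<in> B \<longleftrightarrow> R x \<in> B" using Suc.IH[of "R x"] by (simp add: funpow_swap1)
      also have "\<dots> \<longleftrightarrow> x \<in> B" using B Suc.prems by (auto simp: invariant_sets_def)
      finally show ?case .
    qed simp
    have shift: "(\<integral>x. indicator B x * f ((R ^^ n) x) \<partial>M) = (\<integral>x. indicator B x * f x \<partial>M)" for n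
    proof -
      have "(\<integral>x. indicator B x * f ((R ^^ n) x) \<partial>M) = (\<integral>x. indicator B ((R ^^ n) x) * f ((R ^^ n) x) \<partial>M)"
        by (intro Bochner_Integration.integral_cong refl) (simp add: indicator_def Bn)
      also have "\<dots> = (\<integral>x. indicator B x * f x \<partial>M)"
        by (rule integral_measure_preserving[OF measure_preserving_map_funpow[OF R]]) measurable
      finally show ?thesis .
    qed
    have avg: "(\<integral>x. indicator B x * A N x \<partial>M) = (\<integral>x. indicator B x * f x \<partial>M)" if "N > 0" for N
    proof -
      have "(\<integral>x. indicator B x * A N x \<partial>M) = (\<integral>x. (\<Sum>n=1..N. indicator B x * f ((R ^^ n) x)) / of_nat N \<partial>M)"
        by (simp add: A_def ergodic_average_def sum_distrib_left)
      also have "\<dots> = (\<Sum>n=1..N. \<integral>x. indicator B x * f ((R ^^ n) x) \<partial>M) / of_nat N"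
        by (subst integral_divide_zero, subst Bochner_Integration.integral_sum)
          (auto intro!: integrable_bounded[where B = C] ib f(2))
      also have "\<dots> = (\<integral>x. indicator B x * f x \<partial>M)"
        unfolding shift using that by simp
      finally show ?thesis .
    qed
    have "(\<lambda>i. \<integral>x. indicator B x * A (r i) x \<partial>M) \<longlonglongrightarrow> (\<integral>x. indicator B x * F x \<partial>M)"
    proof (rule integral_dominated_convergence[where w = "\<lambda>_. C"])
      show "AE x in M. (\<lambda>i. indicator B x * A (r i) x) \<longlonglongrightarrow> indicator B x * F x"
        using r(2) by eventually_elim (intro tendsto_intros Flim)
      show "AE x in M. norm (indicator B x * A (r i) x) \<le> C" for i
        by (auto intro: ib Ab)
    qed auto
    moreover have "(\<lambda>i. \<integral>x. indicator B x * A (r i) x \<partial>M) \<longlonglongrightarrow> (\<integral>x. indicator B x * f x \<partial>M)"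
    proof (rule tendsto_eventually)
      show "\<forall>\<^sub>F i in sequentially. (\<integral>x. indicator B x * A (r i) x \<partial>M) = (\<integral>x. indicator B x * f x \<partial>M)"
        using eventually_gt_at_top[of 0]
      proof eventually_elim
        case (elim i)
        then have "r i > 0" using seq_suble[OF r(1), of i] by linarith
        then show ?case by (rule avg)
      qed
    qed
    ultimately show ?thesis by (rule LIMSEQ_unique)
  qed
  interpret sub: finite_measure_subalgebra M "invariant_algebra M R"
    by unfold_locales (rule subalgebra_invariant_algebra[OF Rm])
  have charact: "AE x in M. real_cond_exp M (invariant_algebra M R) (\<lambda>y. L (f y)) x = L (F x)"
    if L: "bounded_linear L" and Lb: "\<And>z. \<bar>L z\<bar> \<le> cmod z" for L :: "complex \<Rightarrow> real"
  proof (rule sub.real_cond_exp_charact)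
    have Lm [measurable]: "L \<in> borel_measurable borel"
      using L by (intro borel_measurable_continuous_onI linear_continuous_on)
    note [measurable] = f(1)
    show "integrable M (\<lambda>y. L (f y))" "integrable M (\<lambda>x. L (F x))"
      by (auto intro!: integrable_bounded[where B = C] order_trans[OF Lb] Fb f(2))
    show "(\<lambda>x. L (F x)) \<in> borel_measurable (invariant_algebra M R)"
      by (rule measurable_compose[OF measurable_invariant_algebra[OF Rm Fm Finv] Lm])
    fix B assume "B \<in> sets (invariant_algebra M R)"
    then have B: "B \<in> invariant_sets M R" by (simp add: sets_invariant_algebra[OF Rm])
    then have [measurable]: "B \<in> sets M" by (simp add: invariant_sets_def)
    have L_ind: "(\<integral>x\<in>B. L (h x) \<partial>M) = L (\<integral>x. indicator B x * h x \<partial>M)"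
      if [measurable]: "h \<in> borel_measurable M" and "\<And>x. cmod (h x) \<le> C" for h
    proof -
      have "integrable M (\<lambda>x. indicator B x * h x)"
        by (rule integrable_bounded[where B = C]) (use that \<open>C \<ge> 0\<close> in \<open>auto simp: indicator_def\<close>)
      then have "L (\<integral>x. indicator B x * h x \<partial>M) = (\<integral>x. L (indicator B x * h x) \<partial>M)"
        by (rule integral_bounded_linear[OF L, symmetric])
      also have "\<dots> = (\<integral>x\<in>B. L (h x) \<partial>M)"
        unfolding set_lebesgue_integral_def
        by (intro Bochner_Integration.integral_cong refl)
          (auto simp: indicator_def linear_0[OF bounded_linear.linear[OF L]])
      finally show ?thesis ..
    qed
    show "(\<integral>x\<in>B. L (f x) \<partial>M) = (\<integral>x\<in>B. L (F x) \<partial>M)"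
      using ints[OF B] by (simp add: L_ind[OF f] L_ind[OF Fm Fb])
  qed
  have "AE x in M. cond_exp M (invariant_algebra M R) f x = F x"
    using charact[OF bounded_linear_Re abs_Re_le_cmod] charact[OF bounded_linear_Im abs_Im_le_cmod]
    by eventually_elim (simp add: cond_exp_def)
  with Fm Fb Finv conv show ?thesis using that unfolding A_def by blast
qed

end

section \<open>Products of an uncorrelated and a singular sequence\<close>

lemma norm_sum_shift_diff_le:
  fixes a :: "nat \<Rightarrow> complex"
  assumes "\<And>n. cmod (a n) \<le> D"
  shows "cmod ((\<Sum>n=1..N. a (n + i)) - (\<Sum>n=1..N. a n)) \<le> 2 * real i * D"
proof (induction i)
  case (Suc i)
  have "(\<Sum>n=1..N. a (n + Suc i)) - (\<Sum>n=1..N. a (n + i)) = a (Suc N + i) - a (1 + i)"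
    by (induction N) (auto simp: algebra_simps)
  then have eq: "(\<Sum>n=1..N. a (n + Suc i)) - (\<Sum>n=1..N. a n) =
      ((\<Sum>n=1..N. a (n + i)) - (\<Sum>n=1..N. a n)) + (a (Suc N + i) - a (1 + i))"
    by (simp add: algebra_simps)
  have "cmod (a (Suc N + i) - a (1 + i)) \<le> 2 * D"
    using norm_triangle_ineq4[of "a (Suc N + i)" "a (1 + i)"] assms[of "Suc N + i"] assms[of "1 + i"] by linarith
  moreover have "2 * real (Suc i) * D = 2 * real i * D + 2 * D" by (simp add: algebra_simps)
  ultimately show ?case
    unfolding eq
    using Suc norm_triangle_ineq[of "(\<Sum>n=1..N. a (n + i)) - (\<Sum>n=1..N. a n)" "a (Suc N + i) - a (1 + i)"]
    by linarith
qed simp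

lemma average_shift_tendsto_0:
  fixes a :: "nat \<Rightarrow> complex"
  assumes "\<And>n. cmod (a n) \<le> D" "(\<lambda>N. (\<Sum>n=1..N. a n) / of_nat N) \<longlonglongrightarrow> 0"
  shows "(\<lambda>N. (\<Sum>n=1..N. a (n + i)) / of_nat N) \<longlonglongrightarrow> 0"
proof -
  have "(\<lambda>N. ((\<Sum>n=1..N. a (n + i)) - (\<Sum>n=1..N. a n)) / of_nat N) \<longlonglongrightarrow> 0"
  proof (rule Lim_null_comparison)
    show "\<forall>\<^sub>F N in sequentially. norm (((\<Sum>n=1..N. a (n + i)) - (\<Sum>n=1..N. a n)) / of_nat N) \<le> (2 * real i * D) / real N"
      unfolding norm_divide norm_of_nat
      by (intro always_eventually allI divide_right_mono norm_sum_shift_diff_le assms) simp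
  qed (rule lim_const_over_n)
  from tendsto_add[OF this assms(2)] show ?thesis
    by (simp add: diff_divide_distrib)
qed

text \<open>The Cauchy-Schwarz inequality for an average of products, one factor of which is bounded.\<close>

lemma norm_average_product_le:
  fixes a b :: "nat \<Rightarrow> complex"
  assumes "\<And>n. cmod (a n) \<le> B"
  shows "(cmod ((\<Sum>n=1..N. a n * b n) / of_nat N))\<^sup>2 \<le> B\<^sup>2 * ((\<Sum>n=1..N. (cmod (b n))\<^sup>2) / real N)"
proof (cases "N = 0")
  case False
  have "B \<ge> 0" using assms norm_ge_zero order_trans by blast
  have "cmod (\<Sum>n=1..N. a n * b n) \<le> B * (\<Sum>n=1..N. cmod (b n))"
    unfolding sum_distrib_left
    by (rule sum_norm_le) (use assms in \<open>simp add: norm_mult mult_right_mono\<close>)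
  then have "(cmod (\<Sum>n=1..N. a n * b n))\<^sup>2 \<le> (B * (\<Sum>n=1..N. cmod (b n)))\<^sup>2"
    by (intro power_mono) auto
  also have "\<dots> \<le> B\<^sup>2 * ((\<Sum>n=1..N. (cmod (b n))\<^sup>2) * real N)"
    using sum_squared_le_sum_of_squares[of "\<lambda>n. cmod (b n)" "{1..N}"]
    unfolding power_mult_distrib by (intro mult_left_mono) auto
  finally have "(cmod (\<Sum>n=1..N. a n * b n))\<^sup>2 / (real N)\<^sup>2 \<le> B\<^sup>2 * ((\<Sum>n=1..N. (cmod (b n))\<^sup>2) * real N) / (real N)\<^sup>2"
    by (rule divide_right_mono) simp
  then show ?thesis
    using False by (simp add: norm_divide power_divide power2_eq_square)
qed simp

lemma square_sum3_le: "(a + b + c)\<^sup>2 \<le> 3 * (a\<^sup>2 + b\<^sup>2 + c\<^sup>2)" for a b c :: real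
  using sum_squares_bound[of a b] sum_squares_bound[of a c] sum_squares_bound[of b c]
  by (simp add: power2_eq_square algebra_simps)

lemma sum_atMost_reverse: "(\<Sum>i\<le>d. h (d - i)) = (\<Sum>i\<le>(d::nat). h i)"
  by (rule sum.reindex_bij_witness[of _ "\<lambda>i. d - i" "\<lambda>i. d - i"]) auto

context prob_space
begin

text \<open>
  If the map is invertible, the combination on the left is the \<open>d\<close>-th iterate of the adjoint of the
  polynomial on the right, applied to \<open>f\<close>.  In general both sides are the same Hermitian form in the
  correlations.
\<close>

lemma integral_norm_reversed_combination:
  assumes R: "measure_preserving_map M R" and f: "f \<in> borel_measurable M" "\<And>x. cmod (f x) \<le> C"
  shows "(\<integral>x. (cmod (\<Sum>j\<le>d. cnj (q j) * f ((R ^^ (d - j)) x)))\<^sup>2 \<partial>M) =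
    (\<integral>x. (cmod (\<Sum>j\<le>d. q j * f ((R ^^ j) x)))\<^sup>2 \<partial>M)"
proof -
  have "(\<Sum>j\<le>d. cnj (q j) * f ((R ^^ (d - j)) x)) = (\<Sum>i\<le>d. cnj (q (d - i)) * f ((R ^^ i) x))" for x
    by (subst sum_atMost_reverse[symmetric]) (rule sum.cong, auto)
  then have "complex_of_real (\<integral>x. (cmod (\<Sum>j\<le>d. cnj (q j) * f ((R ^^ (d - j)) x)))\<^sup>2 \<partial>M) =
      (\<Sum>i\<le>d. \<Sum>m\<le>d. cnj (q (d - i)) * q (d - m) * correlation M R f (int i - int m))"
    using correlation_form[OF R f finite_atMost, of "\<lambda>i. cnj (q (d - i))" d] by simp
  also have "\<dots> = (\<Sum>i\<le>d. \<Sum>m\<le>d. cnj (q (d - i)) * q (d - m) * correlation M R f (int (d - m) - int (d - i)))"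
    by (intro sum.cong refl) (auto simp: of_nat_diff)
  also have "\<dots> = (\<Sum>i\<le>d. \<Sum>m\<le>d. cnj (q i) * q m * correlation M R f (int m - int i))"
    by (subst sum_atMost_reverse[of "\<lambda>i. \<Sum>m\<le>d. cnj (q i) * q (d - m) * correlation M R f (int (d - m) - int i)"])
      (rule sum.cong[OF refl], rule sum_atMost_reverse)
  also have "\<dots> = (\<Sum>m\<le>d. \<Sum>i\<le>d. q m * cnj (q i) * correlation M R f (int m - int i))"
    by (subst sum.swap) (simp add: mult_ac)
  also have "\<dots> = complex_of_real (\<integral>x. (cmod (\<Sum>j\<le>d. q j * f ((R ^^ j) x)))\<^sup>2 \<partial>M)"
    by (rule correlation_form[OF R f finite_atMost, symmetric])
  finally show ?thesis by (simp only: of_real_eq_iff)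
qed

text \<open>On average, the shifts of an uncorrelated sequence behave like orthogonal vectors of norm at most \<open>B\<close>.\<close>

lemma averages_uncorrelated_combination:
  fixes x :: "nat \<Rightarrow> 'a \<Rightarrow> complex"
  assumes xm [measurable]: "\<And>n. x n \<in> borel_measurable M" and xb: "\<And>n w. cmod (x n w) \<le> B"
    and auto0: "\<And>h. h \<ge> 1 \<Longrightarrow> (\<lambda>N. (\<Sum>n=1..N. \<integral>w. x (n + h) w * cnj (x n w) \<partial>M) / of_nat N) \<longlonglongrightarrow> 0"
    and "(\<Sum>j\<le>d. (cmod (r j))\<^sup>2) < \<epsilon>" "B > 0"
  shows "\<forall>\<^sub>F N in sequentially.
    (\<Sum>n=1..N. \<integral>w. (cmod (\<Sum>j\<le>d. r j * x (n + j) w))\<^sup>2 \<partial>M) / real N < B\<^sup>2 * \<epsilon>"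
proof -
  define c where "c j l n = (\<integral>w. x (n + j) w * cnj (x (n + l) w) \<partial>M)" for j l n
  have pint: "integrable M (\<lambda>w. b * (x m w * cnj (x n w)))" for b m n
    by (rule integrable_bounded[where B = "cmod b * (B * B)"])
      (use xb \<open>B > 0\<close> in \<open>auto simp: norm_mult intro!: mult_mono\<close>)
  have norm_inner: "cmod (\<integral>w. x m w * cnj (x n w) \<partial>M) \<le> B * B" for m n
  proof -
    have "cmod (\<integral>w. x m w * cnj (x n w) \<partial>M) \<le> (\<integral>w. cmod (x m w * cnj (x n w)) \<partial>M)"
      by (rule integral_norm_bound)
    also have "\<dots> \<le> B * B"
      by (rule integral_le_bound) (use xb \<open>B > 0\<close> in \<open>auto simp: norm_mult intro!: mult_mono\<close>)
    finally show ?thesis .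
  qed
  have lower: "(\<lambda>N. (\<Sum>n=1..N. c j l n) / of_nat N) \<longlonglongrightarrow> 0" if "l < j" for j l
  proof -
    have "(\<lambda>N. (\<Sum>n=1..N. (\<integral>w. x ((n + l) + (j - l)) w * cnj (x (n + l) w) \<partial>M)) / of_nat N) \<longlonglongrightarrow> 0"
      using that by (intro average_shift_tendsto_0[OF norm_inner] auto0) simp
    then show ?thesis using that by (simp add: c_def)
  qed
  have off: "(\<lambda>N. (\<Sum>n=1..N. c j l n) / of_nat N) \<longlonglongrightarrow> 0" if "j \<noteq> l" for j l
  proof (cases "l < j")
    case False
    have "c j l n = cnj (c l j n)" for n
      using Bochner_Integration.integral_cnj[of M "\<lambda>w. x (n + l) w * cnj (x (n + j) w)"] by (simp add: c_def mult.commute)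
    then have "(\<lambda>N. (\<Sum>n=1..N. c j l n) / of_nat N) = (\<lambda>N. cnj ((\<Sum>n=1..N. c l j n) / of_nat N))"
      by simp
    then show ?thesis
      using tendsto_cnj[OF lower[of j l]] False that by simp
  qed (rule lower)
  define E where "E N = (\<Sum>j\<le>d. \<Sum>l\<in>{..d} - {j}. r j * cnj (r l) * ((\<Sum>n=1..N. c j l n) / of_nat N))" for N
  have "E \<longlonglongrightarrow> (\<Sum>j\<le>d. \<Sum>l\<in>{..d} - {j}. r j * cnj (r l) * 0)"
    unfolding E_def by (intro tendsto_sum tendsto_mult tendsto_const off) auto
  then have "(\<lambda>N. cmod (E N)) \<longlonglongrightarrow> 0" by (simp add: tendsto_norm_zero)
  then have "\<forall>\<^sub>F N in sequentially. cmod (E N) < B\<^sup>2 * (\<epsilon> - (\<Sum>j\<le>d. (cmod (r j))\<^sup>2))"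
    by (rule order_tendstoD) (use assms(4,5) in simp)
  then show ?thesis
  proof eventually_elim
    case (elim N)
    let ?S = "(\<Sum>n=1..N. \<integral>w. (cmod (\<Sum>j\<le>d. r j * x (n + j) w))\<^sup>2 \<partial>M) / real N"
    have expand: "complex_of_real (\<integral>w. (cmod (\<Sum>j\<le>d. r j * x (n + j) w))\<^sup>2 \<partial>M) =
        (\<Sum>j\<le>d. \<Sum>l\<le>d. r j * cnj (r l) * c j l n)" for n
    proof -
      have "complex_of_real ((cmod (\<Sum>j\<le>d. r j * x (n + j) w))\<^sup>2) =
          (\<Sum>j\<le>d. \<Sum>l\<le>d. r j * cnj (r l) * (x (n + j) w * cnj (x (n + l) w)))" for w
        unfolding complex_norm_square cnj_sum sum_product by (simp add: mult_ac)
      moreover have "complex_of_real (\<integral>w. (cmod (\<Sum>j\<le>d. r j * x (n + j) w))\<^sup>2 \<partial>M) =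
          (\<integral>w. complex_of_real ((cmod (\<Sum>j\<le>d. r j * x (n + j) w))\<^sup>2) \<partial>M)"
        by (rule integral_complex_of_real[symmetric])
      ultimately show ?thesis
        by (simp only: Bochner_Integration.integral_sum Bochner_Integration.integrable_sum pint
            integral_mult_right_zero c_def)
    qed
    have "complex_of_real ?S = (\<Sum>n=1..N. \<Sum>j\<le>d. \<Sum>l\<le>d. r j * cnj (r l) * c j l n) / of_nat N"
      by (simp add: expand[symmetric] del: of_real_power)
    also have "(\<Sum>n=1..N. \<Sum>j\<le>d. \<Sum>l\<le>d. r j * cnj (r l) * c j l n) =
        (\<Sum>j\<le>d. \<Sum>n=1..N. \<Sum>l\<le>d. r j * cnj (r l) * c j l n)"
      by (rule sum.swap)
    also have "\<dots> = (\<Sum>j\<le>d. \<Sum>l\<le>d. \<Sum>n=1..N. r j * cnj (r l) * c j l n)"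
      by (rule sum.cong[OF refl], rule sum.swap)
    also have "\<dots> = (\<Sum>j\<le>d. \<Sum>l\<le>d. r j * cnj (r l) * (\<Sum>n=1..N. c j l n))"
      by (simp only: sum_distrib_left)
    also have "\<dots> / of_nat N = (\<Sum>j\<le>d. \<Sum>l\<le>d. r j * cnj (r l) * ((\<Sum>n=1..N. c j l n) / of_nat N))"
    proof -
      have "(\<Sum>j\<le>d. \<Sum>l\<le>d. b j l * s j l) / z = (\<Sum>j\<le>d. \<Sum>l\<le>d. b j l * (s j l / z))"
        for b s :: "nat \<Rightarrow> nat \<Rightarrow> complex" and z
        by (simp add: sum_divide_distrib)
      then show ?thesis .
    qed
    also have "\<dots> = (\<Sum>j\<le>d. r j * cnj (r j) * ((\<Sum>n=1..N. c j j n) / of_nat N)) + E N"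
      unfolding E_def sum.distrib[symmetric]
      by (intro sum.cong refl) (simp add: sum.remove[of "{..d}"])
    finally have S: "complex_of_real ?S = (\<Sum>j\<le>d. r j * cnj (r j) * ((\<Sum>n=1..N. c j j n) / of_nat N)) + E N" .
    have "cmod (\<Sum>j\<le>d. r j * cnj (r j) * ((\<Sum>n=1..N. c j j n) / of_nat N)) \<le> (\<Sum>j\<le>d. (cmod (r j))\<^sup>2 * (B * B))"
    proof (rule sum_norm_le)
      fix j
      have "cmod ((\<Sum>n=1..N. c j j n) / of_nat N) \<le> B * B"
        by (rule norm_average_le) (use norm_inner \<open>B > 0\<close> in \<open>auto simp: c_def\<close>)
      then show "cmod (r j * cnj (r j) * ((\<Sum>n=1..N. c j j n) / of_nat N)) \<le> (cmod (r j))\<^sup>2 * (B * B)"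
        unfolding norm_mult by (simp add: power2_eq_square mult_left_mono)
    qed
    then have "cmod (complex_of_real ?S) \<le> (\<Sum>j\<le>d. (cmod (r j))\<^sup>2) * (B * B) + cmod (E N)"
      unfolding S sum_distrib_right[symmetric] by (intro order_trans[OF norm_triangle_ineq]) auto
    moreover have "?S \<le> cmod (complex_of_real ?S)" by (simp only: norm_of_real abs_ge_self)
    ultimately show "?S < B\<^sup>2 * \<epsilon>"
      using elim by (simp add: power2_eq_square algebra_simps)
  qed
qed

text \<open>
  The core of the argument.  Write \<open>y n\<close> for the \<open>n\<close>-th iterate of \<open>f\<close>.  The polynomial \<open>q\<close> is almost
  the monomial of degree \<open>J\<close> in coefficients but almost annihilates \<open>f\<close>.  Replacing \<open>x (n + J)\<close> by the
  combination of the \<open>x (n + j)\<close> with the conjugated coefficients costs little since \<open>x\<close> is uncorrelated;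
  a shift of the summation index in each term moves the combination to the iterates of \<open>f\<close>, where it
  is small.
\<close>

theorem averages_uncorrelated_times_singular:
  fixes x :: "nat \<Rightarrow> 'a \<Rightarrow> complex"
  assumes T: "measure_preserving_map M T" and f: "f \<in> borel_measurable M" "\<And>w. cmod (f w) \<le> C"
    and small: "\<And>\<epsilon>. \<epsilon> > 0 \<Longrightarrow> \<exists>d J q. J \<le> d \<and>
      (\<integral>w. (cmod (\<Sum>j\<le>d. q j * f ((T ^^ j) w)))\<^sup>2 \<partial>M) < \<epsilon> \<and>
      (\<Sum>j\<le>d. (cmod ((if j = J then 1 else 0) - q j))\<^sup>2) < \<epsilon>"
    and xm: "\<And>n. x n \<in> borel_measurable M" and xb: "\<And>n w. cmod (x n w) \<le> B"
    and auto0: "\<And>h. h \<ge> 1 \<Longrightarrow> (\<lambda>N. (\<Sum>n=1..N. \<integral>w. x (n + h) w * cnj (x n w) \<partial>M) / of_nat N) \<longlonglongrightarrow> 0"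
    and "B > 0" "C > 0"
  shows "(\<lambda>N. \<integral>w. (cmod ((\<Sum>n=1..N. f ((T ^^ n) w) * x n w) / of_nat N))\<^sup>2 \<partial>M) \<longlonglongrightarrow> 0"
proof (rule LIMSEQ_I)
  note Tm = measure_preserving_map_measurable[OF measure_preserving_map_funpow[OF T]]
  note [measurable] = f(1) xm Tm measure_preserving_map_measurable[OF T]
  fix \<eta> :: real assume "\<eta> > 0"
  define \<epsilon> where "\<epsilon> = \<eta> / (9 * (B\<^sup>2 + 1) * (C\<^sup>2 + 1))"
  have "\<epsilon> > 0" using \<open>\<eta> > 0\<close> by (auto simp: \<epsilon>_def intro!: divide_pos_pos mult_pos_pos add_nonneg_pos)
  obtain d J q where q: "J \<le> d" "(\<integral>w. (cmod (\<Sum>j\<le>d. q j * f ((T ^^ j) w)))\<^sup>2 \<partial>M) < \<epsilon>"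
    "(\<Sum>j\<le>d. (cmod ((if j = J then 1 else 0) - q j))\<^sup>2) < \<epsilon>"
    using small[OF \<open>\<epsilon> > 0\<close>] by blast
  define p where "p j = cnj (q j)" for j
  define r where "r j = (if j = J then 1 else 0) - p j" for j
  define y where "y n w = f ((T ^^ n) w)" for n w
  define V where "V n w = (\<Sum>j\<le>d. p j * y (n + J + d - j) w)" for n w
  define W where "W n w = (\<Sum>j\<le>d. r j * x (n + j) w)" for n w
  have [measurable]: "y n \<in> borel_measurable M" for n unfolding y_def by measurable
  have [measurable]: "V n \<in> borel_measurable M" "W n \<in> borel_measurable M" for n
    unfolding V_def W_def by measurable
  have yb: "cmod (y n w) \<le> C" for n w by (simp add: y_def f)
  define K where "K = 2 * real J * (B * C) + (\<Sum>j\<le>d. cmod (p j) * (2 * real (d - j) * (B * C)))"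
  have prodb: "cmod (x m w * y n w) \<le> B * C" for m n w
    unfolding norm_mult using xb yb \<open>B > 0\<close> by (intro mult_mono) auto
  \<comment> \<open>Up to shifts of the index, which cost \<open>K / N\<close>, the average splits into a part where \<open>W\<close> is small
    and a part where \<open>V\<close> is small.\<close>
  have decomp: "cmod ((\<Sum>n=1..N. y n w * x n w) / of_nat N) \<le>
      cmod ((\<Sum>n=1..N. y (n + J) w * W n w) / of_nat N) +
      cmod ((\<Sum>n=1..N. x (n + d) w * V n w) / of_nat N) + K / real N" for N w
  proof -
    define D where "D j = (\<Sum>n=1..N. x (n + d) w * y (n + J + d - j) w) - (\<Sum>n=1..N. x (n + j) w * y (n + J) w)" for j
    define D0 where "D0 = (\<Sum>n=1..N. x (n + J) w * y (n + J) w) - (\<Sum>n=1..N. x n w * y n w)"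
    have Dj: "cmod (D j) \<le> 2 * real (d - j) * (B * C)" if "j \<le> d" for j
    proof -
      have "n + (d - j) + j = n + d" "n + (d - j) + J = n + J + d - j" for n using that by auto
      then show ?thesis
        using norm_sum_shift_diff_le[where a = "\<lambda>n. x (n + j) w * y (n + J) w" and D = "B * C"
            and N = N and i = "d - j", OF prodb]
        unfolding D_def by (simp only:)
    qed
    have D0: "cmod D0 \<le> 2 * real J * (B * C)"
      unfolding D0_def by (rule norm_sum_shift_diff_le[of "\<lambda>n. x n w * y n w", OF prodb])
    have W: "(\<Sum>n=1..N. y (n + J) w * W n w) =
        (\<Sum>n=1..N. x (n + J) w * y (n + J) w) - (\<Sum>j\<le>d. p j * (\<Sum>n=1..N. x (n + j) w * y (n + J) w))"
    proof -
      have "W n w = x (n + J) w - (\<Sum>j\<le>d. p j * x (n + j) w)" for n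
      proof -
        have "W n w = (\<Sum>j\<le>d. if j = J then x (n + j) w else 0) - (\<Sum>j\<le>d. p j * x (n + j) w)"
          unfolding W_def r_def sum_subtractf[symmetric] by (intro sum.cong) (auto simp: algebra_simps)
        then show ?thesis using q(1) by simp
      qed
      then have "(\<Sum>n=1..N. y (n + J) w * W n w) = (\<Sum>n=1..N. x (n + J) w * y (n + J) w) -
          (\<Sum>n=1..N. \<Sum>j\<le>d. p j * (x (n + j) w * y (n + J) w))"
        by (simp add: right_diff_distrib sum_subtractf sum_distrib_left mult_ac)
      also have "(\<Sum>n=1..N. \<Sum>j\<le>d. p j * (x (n + j) w * y (n + J) w)) =
          (\<Sum>j\<le>d. p j * (\<Sum>n=1..N. x (n + j) w * y (n + J) w))"
        by (subst sum.swap) (simp add: sum_distrib_left)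
      finally show ?thesis .
    qed
    have V: "(\<Sum>n=1..N. x (n + d) w * V n w) = (\<Sum>j\<le>d. p j * (\<Sum>n=1..N. x (n + d) w * y (n + J + d - j) w))"
      unfolding V_def sum_distrib_left by (subst sum.swap) (simp add: mult_ac)
    have "(\<Sum>n=1..N. y n w * x n w) = (\<Sum>n=1..N. y (n + J) w * W n w) + (\<Sum>n=1..N. x (n + d) w * V n w)
        - (D0 + (\<Sum>j\<le>d. p j * D j))"
      unfolding W V D0_def D_def by (simp add: right_diff_distrib sum_subtractf mult.commute)
    moreover have "cmod (a + b - e) \<le> cmod a + cmod b + cmod e" for a b e :: complex
      using norm_triangle_ineq4[of "a + b" e] norm_triangle_ineq[of a b] by linarith
    ultimately have "cmod (\<Sum>n=1..N. y n w * x n w) \<le> cmod (\<Sum>n=1..N. y (n + J) w * W n w) +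
        cmod (\<Sum>n=1..N. x (n + d) w * V n w) + cmod (D0 + (\<Sum>j\<le>d. p j * D j))"
      by (simp only:)
    moreover have "cmod (D0 + (\<Sum>j\<le>d. p j * D j)) \<le> K"
      unfolding K_def
    proof (intro norm_triangle_le add_mono D0 sum_norm_le)
      fix j assume "j \<in> {..d}"
      then show "cmod (p j * D j) \<le> cmod (p j) * (2 * real (d - j) * (B * C))"
        unfolding norm_mult by (intro mult_left_mono Dj) auto
    qed
    ultimately have "cmod (\<Sum>n=1..N. y n w * x n w) / real N \<le> (cmod (\<Sum>n=1..N. y (n + J) w * W n w) +
        cmod (\<Sum>n=1..N. x (n + d) w * V n w) + K) / real N"
      by (intro divide_right_mono) auto
    then show ?thesis by (simp add: norm_divide add_divide_distrib)
  qed
  have V2: "(\<integral>w. (cmod (V n w))\<^sup>2 \<partial>M) < \<epsilon>" for n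
  proof -
    have "V n w = (\<Sum>j\<le>d. cnj (q j) * f ((T ^^ (d - j)) ((T ^^ (n + J)) w)))" for w
      unfolding V_def p_def y_def
    proof (intro sum.cong refl)
      fix j assume "j \<in> {..d}"
      then have "n + J + d - j = (d - j) + (n + J)" by simp
      then show "cnj (q j) * f ((T ^^ (n + J + d - j)) w) = cnj (q j) * f ((T ^^ (d - j)) ((T ^^ (n + J)) w))"
        by (simp only: funpow_add comp_apply)
    qed
    then have "(\<integral>w. (cmod (V n w))\<^sup>2 \<partial>M) =
        (\<integral>w. (cmod (\<Sum>j\<le>d. cnj (q j) * f ((T ^^ (d - j)) ((T ^^ (n + J)) w))))\<^sup>2 \<partial>M)"
      by simp
    also have "\<dots> = (\<integral>w. (cmod (\<Sum>j\<le>d. cnj (q j) * f ((T ^^ (d - j)) w)))\<^sup>2 \<partial>M)"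
      by (rule integral_measure_preserving[OF measure_preserving_map_funpow[OF T]]) measurable
    also have "\<dots> < \<epsilon>" using q(2) integral_norm_reversed_combination[OF T f, of q d] by simp
    finally show ?thesis .
  qed
  have Vb: "cmod (V n w) \<le> (\<Sum>j\<le>d. cmod (p j) * C)" for n w
    unfolding V_def by (rule sum_norm_le) (use yb in \<open>auto simp: norm_mult intro!: mult_left_mono\<close>)
  have Wb: "cmod (W n w) \<le> (\<Sum>j\<le>d. cmod (r j) * B)" for n w
    unfolding W_def by (rule sum_norm_le) (use xb in \<open>auto simp: norm_mult intro!: mult_left_mono\<close>)
  have intV: "integrable M (\<lambda>w. (cmod (V n w))\<^sup>2)" for n
    by (rule integrable_bounded[where B = "(\<Sum>j\<le>d. cmod (p j) * C)\<^sup>2"]) (auto intro!: power_mono Vb)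
  have intW: "integrable M (\<lambda>w. (cmod (W n w))\<^sup>2)" for n
    by (rule integrable_bounded[where B = "(\<Sum>j\<le>d. cmod (r j) * B)\<^sup>2"]) (auto intro!: power_mono Wb)
  have "(\<Sum>j\<le>d. (cmod (r j))\<^sup>2) < \<epsilon>"
  proof -
    have "cmod (r j) = cmod ((if j = J then 1 else 0) - q j)" for j
      unfolding r_def p_def by (subst complex_mod_cnj[symmetric]) simp
    then show ?thesis using q(3) by simp
  qed
  then have evW: "\<forall>\<^sub>F N in sequentially. (\<Sum>n=1..N. \<integral>w. (cmod (W n w))\<^sup>2 \<partial>M) / real N < B\<^sup>2 * \<epsilon>"
    unfolding W_def by (intro averages_uncorrelated_combination xm xb auto0 \<open>B > 0\<close>)
  have "(\<lambda>N. (K / real N)\<^sup>2) \<longlonglongrightarrow> 0\<^sup>2"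
    by (intro tendsto_power lim_const_over_n)
  then have evK: "\<forall>\<^sub>F N in sequentially. (K / real N)\<^sup>2 < \<epsilon>"
    by (rule order_tendstoD) (use \<open>\<epsilon> > 0\<close> in simp)
  have "\<forall>\<^sub>F N in sequentially. norm ((\<integral>w. (cmod ((\<Sum>n=1..N. y n w * x n w) / of_nat N))\<^sup>2 \<partial>M) - 0) < \<eta>"
    using evW evK eventually_gt_at_top[of 0]
  proof eventually_elim
    case (elim N)
    have "(\<integral>w. (cmod ((\<Sum>n=1..N. y n w * x n w) / of_nat N))\<^sup>2 \<partial>M) \<le>
        (\<integral>w. 3 * (C\<^sup>2 * ((\<Sum>n=1..N. (cmod (W n w))\<^sup>2) / real N) +
          B\<^sup>2 * ((\<Sum>n=1..N. (cmod (V n w))\<^sup>2) / real N) + (K / real N)\<^sup>2) \<partial>M)"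
    proof (rule integral_mono)
      show "integrable M (\<lambda>w. (cmod ((\<Sum>n=1..N. y n w * x n w) / of_nat N))\<^sup>2)"
      proof (rule integrable_bounded[where B = "(B * C)\<^sup>2"])
        have "cmod ((\<Sum>n=1..N. y n w * x n w) / of_nat N) \<le> B * C" for w
          by (rule norm_average_le) (use prodb \<open>B > 0\<close> \<open>C > 0\<close> in \<open>auto simp: mult.commute\<close>)
        then show "norm ((cmod ((\<Sum>n=1..N. y n w * x n w) / of_nat N))\<^sup>2) \<le> (B * C)\<^sup>2" for w
          by (simp add: power_mono)
      qed measurable
      show "integrable M (\<lambda>w. 3 * (C\<^sup>2 * ((\<Sum>n=1..N. (cmod (W n w))\<^sup>2) / real N) +
          B\<^sup>2 * ((\<Sum>n=1..N. (cmod (V n w))\<^sup>2) / real N) + (K / real N)\<^sup>2))"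
        using intV intW by (intro integrable_mult_right Bochner_Integration.integrable_add
            integrable_divide Bochner_Integration.integrable_sum) auto
      fix w
      let ?a = "cmod ((\<Sum>n=1..N. y (n + J) w * W n w) / of_nat N)"
      let ?b = "cmod ((\<Sum>n=1..N. x (n + d) w * V n w) / of_nat N)"
      have "(cmod ((\<Sum>n=1..N. y n w * x n w) / of_nat N))\<^sup>2 \<le> (?a + ?b + K / real N)\<^sup>2"
        using decomp by (intro power_mono) auto
      also have "\<dots> \<le> 3 * (?a\<^sup>2 + ?b\<^sup>2 + (K / real N)\<^sup>2)" by (rule square_sum3_le)
      also have "\<dots> \<le> 3 * (C\<^sup>2 * ((\<Sum>n=1..N. (cmod (W n w))\<^sup>2) / real N) +
          B\<^sup>2 * ((\<Sum>n=1..N. (cmod (V n w))\<^sup>2) / real N) + (K / real N)\<^sup>2)"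
        by (intro mult_left_mono add_mono norm_average_product_le order_refl) (auto intro: yb xb)
      finally show "(cmod ((\<Sum>n=1..N. y n w * x n w) / of_nat N))\<^sup>2 \<le>
        3 * (C\<^sup>2 * ((\<Sum>n=1..N. (cmod (W n w))\<^sup>2) / real N) +
          B\<^sup>2 * ((\<Sum>n=1..N. (cmod (V n w))\<^sup>2) / real N) + (K / real N)\<^sup>2)" .
    qed
    also have "\<dots> = 3 * (C\<^sup>2 * ((\<Sum>n=1..N. \<integral>w. (cmod (W n w))\<^sup>2 \<partial>M) / real N) +
          B\<^sup>2 * ((\<Sum>n=1..N. \<integral>w. (cmod (V n w))\<^sup>2 \<partial>M) / real N) + (K / real N)\<^sup>2)"
      using intV intW by (simp add: prob_space)
    also have "\<dots> \<le> 3 * (C\<^sup>2 * (B\<^sup>2 * \<epsilon>) + B\<^sup>2 * \<epsilon> + \<epsilon>)"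
    proof -
      have "(\<Sum>n=1..N. \<integral>w. (cmod (V n w))\<^sup>2 \<partial>M) \<le> (\<Sum>n=1..N. \<epsilon>)"
        using V2 by (intro sum_mono) (simp add: less_imp_le)
      then have "(\<Sum>n=1..N. \<integral>w. (cmod (V n w))\<^sup>2 \<partial>M) / real N \<le> \<epsilon>"
        using elim(3) by (simp add: field_simps)
      then show ?thesis using elim(1,2)
        by (intro mult_left_mono add_mono) auto
    qed
    also have "\<dots> \<le> 3 * ((B\<^sup>2 + 1) * (C\<^sup>2 + 1) * \<epsilon>)"
      using \<open>\<epsilon> > 0\<close> by (simp add: algebra_simps)
    also have "\<dots> < \<eta>"
    proof -
      have "(B\<^sup>2 + 1) * (C\<^sup>2 + 1) > 0" by (intro mult_pos_pos add_nonneg_pos) auto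
      then have "3 * ((B\<^sup>2 + 1) * (C\<^sup>2 + 1) * \<epsilon>) = \<eta> / 3"
        unfolding \<epsilon>_def by (simp add: field_simps)
      then show ?thesis using \<open>\<eta> > 0\<close> by simp
    qed
    finally show ?case by (simp add: integral_nonneg_AE)
  qed
  then show "\<exists>N0. \<forall>N\<ge>N0. norm ((\<integral>w. (cmod ((\<Sum>n=1..N. f ((T ^^ n) w) * x n w) / of_nat N))\<^sup>2 \<partial>M) - 0) < \<eta>"
    unfolding eventually_sequentially y_def .
qed

end

section \<open>Singular spectrum and polynomials in the automorphism\<close>

text \<open>For automorphisms, correlations agree with the coefficients that define spectral measures.\<close>

lemma int_iterate_correlation:
  assumes aut: "measure_preserving_automorphism M R" and f: "f \<in> borel_measurable M"
  shows "L2_inner M (\<lambda>x. f (int_iterate M R n x)) f = correlation M R f n"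
proof (cases "0 \<le> n")
  case True
  then show ?thesis by (simp add: L2_inner_def int_iterate_def correlation_def)
next
  case False
  let ?Q = "the_inv_into (space M) R"
  define m where "m = nat (- n)"
  note mp = automorphism_measure_preserving[OF aut]
  note [measurable] = f measure_preserving_map_measurable[OF mp(1)]
    measure_preserving_map_measurable[OF measure_preserving_map_funpow[OF mp(1)]]
    measure_preserving_map_measurable[OF measure_preserving_map_funpow[OF mp(2)]]
  have inj: "inj_on R (space M)" using aut by (simp add: measure_preserving_automorphism_def bij_betw_def)
  have inv: "(?Q ^^ i) ((R ^^ i) x) = x" if "x \<in> space M" for i x
  proof (induction i)
    case (Suc i)
    have "(R ^^ i) x \<in> space M"
      using that measurable_space[OF measure_preserving_map_measurable[OF measure_preserving_map_funpow[OF mp(1)]]] by blast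
    then have "?Q (R ((R ^^ i) x)) = (R ^^ i) x" by (rule the_inv_into_f_f[OF inj])
    then show ?case using Suc by (simp add: funpow_Suc_right del: funpow.simps(2)) (simp add: funpow_swap1)
  qed simp
  have "L2_inner M (\<lambda>x. f (int_iterate M R n x)) f = (\<integral>x. f ((?Q ^^ m) x) * cnj (f x) \<partial>M)"
    using False by (simp add: L2_inner_def int_iterate_def m_def)
  also have "\<dots> = (\<integral>x. f ((?Q ^^ m) ((R ^^ m) x)) * cnj (f ((R ^^ m) x)) \<partial>M)"
    by (rule integral_measure_preserving[OF measure_preserving_map_funpow[OF mp(1)], symmetric]) measurable
  also have "\<dots> = (\<integral>x. f x * cnj (f ((R ^^ m) x)) \<partial>M)"
    by (intro Bochner_Integration.integral_cong refl) (simp add: inv)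
  finally show ?thesis using False by (simp add: correlation_def m_def)
qed

context prob_space
begin

text \<open>
  The hypothesis on the spectrum concerns functions of mean zero.  The constant part of \<open>f\<close> is
  controlled because the polynomial is small at 0 as well.
\<close>

lemma singular_spectrum_small_combination:
  assumes aut: "measure_preserving_automorphism M T" and sing: "singular_spectrum M T"
    and f: "f \<in> borel_measurable M" "\<And>x. cmod (f x) \<le> C" and "\<epsilon> > 0"
  shows "\<exists>d J q. J \<le> d \<and> (\<integral>x. (cmod (\<Sum>j\<le>d. q j * f ((T ^^ j) x)))\<^sup>2 \<partial>M) < \<epsilon> \<and>
      (\<Sum>j\<le>d. (cmod ((if j = J then 1 else 0) - q j))\<^sup>2) < \<epsilon>"
proof -
  note T = automorphism_measure_preserving(1)[OF aut]
  note [measurable] = f(1) measure_preserving_map_measurable[OF T]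
    measure_preserving_map_measurable[OF measure_preserving_map_funpow[OF T]]
  define c where "c = (\<integral>x. f x \<partial>M)"
  define g where "g x = f x - c" for x
  have gm [measurable]: "g \<in> borel_measurable M" unfolding g_def by measurable
  have gb: "cmod (g x) \<le> C + cmod c" for x
    unfolding g_def using norm_triangle_ineq4[of "f x" c] f(2)[of x] by linarith
  have "integrable M f" by (rule integrable_bounded[OF f])
  then have "(\<integral>x. g x \<partial>M) = 0" by (simp add: g_def c_def prob_space)
  moreover have "integrable M (\<lambda>x. (cmod (g x))\<^sup>2)"
    by (rule integrable_bounded[where B = "(C + cmod c)\<^sup>2"]) (auto intro!: power_mono gb)
  ultimately have g0: "g \<in> L2_zero_mean M" by (simp add: L2_zero_mean_def L2_def)
  obtain \<sigma> where \<sigma>: "circle_measure \<sigma>"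
    "\<And>n. (\<integral>t. circ (of_int n * t) \<partial>\<sigma>) = correlation M T g n"
    "\<And>d q. (\<integral>x. (cmod (\<Sum>j\<le>d. q j * g ((T ^^ j) x)))\<^sup>2 \<partial>M) =
        (\<integral>t. (cmod (\<Sum>j\<le>d. q j * circ (real j * t)))\<^sup>2 \<partial>\<sigma>)"
    using obtain_spectral_measure[OF T gm gb] by blast
  interpret \<sigma>: circle_measure \<sigma> by fact
  have "spectral_measure M T g \<sigma>"
    unfolding spectral_measure_def
  proof (intro conjI allI)
    show "(\<integral>t. cis (2 * pi * of_int n * t) \<partial>\<sigma>) = L2_inner M (\<lambda>x. g (int_iterate M T n x)) g" for n
      using \<sigma>(2)[of n] by (simp add: int_iterate_correlation[OF aut] circ_def mult.assoc)
  qed (use \<sigma>.sets_eq \<sigma>.finite_measure_axioms in auto)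
  moreover obtain \<tau> where \<tau>: "maximal_spectral_type M T \<tau>" "mutually_singular \<tau> lebesgue_01"
    using sing unfolding singular_spectrum_def by blast
  ultimately have ac: "null_sets \<tau> \<subseteq> null_sets \<sigma>"
    using g0 unfolding maximal_spectral_type_def dominates_spectrum_def absolutely_continuous_def by blast
  obtain B where B: "B \<in> sets \<tau>" "emeasure \<tau> B = 0" "emeasure lebesgue_01 (space lebesgue_01 - B) = 0"
    using \<tau>(2) unfolding mutually_singular_def by blast
  define N where "N = {0..1} - B"
  have "B \<in> null_sets \<sigma>" using B ac by (auto simp: null_sets_def)
  then have Bs: "B \<in> sets \<sigma>" "emeasure \<sigma> B = 0" by (auto simp: null_sets_def)
  then have B01: "B \<in> sets borel" "B \<subseteq> {0..1}"
    by (auto simp: \<sigma>.sets_eq sets_restrict_space)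
  have N: "N \<in> sets borel" "N \<subseteq> {0..1}" using B01 by (auto simp: N_def)
  have "emeasure lborel N = 0"
    using B(3) N emeasure_restrict_space[of "{0..1}" lborel N] by (simp add: N_def space_restrict_space)
  moreover have "{0..1} - N = B" using B01 by (auto simp: N_def)
  ultimately have Nnull: "emeasure lborel N = 0" "emeasure \<sigma> ({0..1} - N) = 0" using Bs by auto
  define \<epsilon>' where "\<epsilon>' = \<epsilon> / (4 * (1 + (cmod c)\<^sup>2))"
  have pos: "1 + (cmod c)\<^sup>2 > 0" by (intro add_pos_nonneg) auto
  then have "\<epsilon>' > 0" using \<open>\<epsilon> > 0\<close> by (simp add: \<epsilon>'_def)
  obtain d J q where q: "J \<le> d"
    "(\<integral>t. (cmod (\<Sum>j\<le>d. q j * circ (real j * t)))\<^sup>2 \<partial>\<sigma>) < \<epsilon>'"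
    "(cmod (\<Sum>j\<le>d. q j))\<^sup>2 < \<epsilon>'"
    "(\<Sum>j\<le>d. (cmod ((if j = J then 1 else 0) - q j))\<^sup>2) < \<epsilon>'"
    by (rule \<sigma>.singular_approx_polynomial[OF N Nnull \<open>\<epsilon>' > 0\<close>]) (rule that; assumption)
  define u where "u x = (\<Sum>j\<le>d. q j * f ((T ^^ j) x))" for x
  define v where "v x = (\<Sum>j\<le>d. q j * g ((T ^^ j) x))" for x
  have [measurable]: "u \<in> borel_measurable M" "v \<in> borel_measurable M"
    unfolding u_def v_def by measurable
  have uv: "u x - v x = c * (\<Sum>j\<le>d. q j)" for x
    by (simp add: u_def v_def g_def sum_subtractf[symmetric] sum_distrib_left algebra_simps)
  define K where "K = max (\<Sum>j\<le>d. cmod (q j) * C) (\<Sum>j\<le>d. cmod (q j) * (C + cmod c))"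
  have ub: "cmod (u x) \<le> K" for x
    unfolding K_def u_def
    by (rule order_trans[OF sum_norm_le max.cobounded1]) (use f in \<open>auto simp: norm_mult intro!: mult_left_mono\<close>)
  have vb: "cmod (v x) \<le> K" for x
    unfolding K_def v_def
    by (rule order_trans[OF sum_norm_le max.cobounded2]) (use gb in \<open>auto simp: norm_mult intro!: mult_left_mono\<close>)
  have "0 \<le> K" using ub norm_ge_zero order_trans by blast
  have "(\<integral>x. (cmod (u x - 0))\<^sup>2 \<partial>M) \<le> 2 * (\<integral>x. (cmod (u x - v x))\<^sup>2 \<partial>M) + 2 * (\<integral>x. (cmod (v x - 0))\<^sup>2 \<partial>M)"
    by (rule integral_square_diff_le[where B = K]) (use ub vb \<open>0 \<le> K\<close> in auto)
  also have "\<dots> = 2 * ((cmod c)\<^sup>2 * (cmod (\<Sum>j\<le>d. q j))\<^sup>2) + 2 * (\<integral>x. (cmod (v x))\<^sup>2 \<partial>M)"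
    by (simp add: uv norm_mult power_mult_distrib prob_space)
  also have "\<dots> \<le> 2 * ((cmod c)\<^sup>2 * \<epsilon>') + 2 * \<epsilon>'"
    using q(2,3) \<sigma>(3)[of q d] by (intro add_mono mult_left_mono) (auto simp: v_def)
  also have "\<dots> = 2 * (1 + (cmod c)\<^sup>2) * \<epsilon>'" by (simp add: algebra_simps)
  also have "\<dots> = \<epsilon> / 2" using pos by (simp add: \<epsilon>'_def field_simps)
  also have "\<dots> < \<epsilon>" using \<open>\<epsilon> > 0\<close> by simp
  finally have "(\<integral>x. (cmod (u x))\<^sup>2 \<partial>M) < \<epsilon>" by simp
  moreover have "\<epsilon>' \<le> \<epsilon>"
  proof -
    have "\<epsilon>' * (4 * (1 + (cmod c)\<^sup>2)) = \<epsilon>" using pos by (simp add: \<epsilon>'_def)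
    moreover have "\<epsilon>' * 1 \<le> \<epsilon>' * (4 * (1 + (cmod c)\<^sup>2))" using \<open>\<epsilon>' > 0\<close> by (intro mult_left_mono) auto
    ultimately show ?thesis by simp
  qed
  ultimately show ?thesis using q(1,4) unfolding u_def by (intro exI[of _ d] exI[of _ J] exI[of _ q]) auto
qed

end

section \<open>Uniform distribution and character averages\<close>

lemma circ_add_1: "circ (t + 1) = circ t"
  using circ_of_int[of 1] by (simp add: circ_add)

text \<open>
  Invariance of the Haar measure under translation by \<open>\<alpha>\<close> forces the integral of the character to vanish
  as soon as the character is not 1 at \<open>\<alpha>\<close>.
\<close>

lemma uniformly_distributed_in_character:
  assumes "uniformly_distributed_in (orbit_closure \<alpha>) x" "circ \<alpha> \<noteq> 1"
  shows "(\<lambda>N. (\<Sum>n=1..N. circ (x n)) / of_nat N) \<longlonglongrightarrow> 0"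
proof -
  obtain H where H: "haar_probability (orbit_closure \<alpha>) H" "uniformly_distributed_wrt H x"
    using assms(1) unfolding uniformly_distributed_in_def by blast
  have sets: "sets H = sets (restrict_space borel {0..<1})" using H(1) by (simp add: haar_probability_def)
  have "\<alpha> \<in> {of_nat n * \<alpha> + of_int m | (n::nat) (m::int). n \<ge> 1}"
    by (rule CollectI, rule exI[of _ 1], rule exI[of _ 0]) simp
  then have "\<alpha> \<in> orbit_closure \<alpha>" unfolding orbit_closure_def by (rule subsetD[OF closure_subset])
  then have inv: "distr H H (\<lambda>t. frac (t + \<alpha>)) = H" using H(1) by (auto simp: haar_probability_def)
  have m1: "(\<lambda>t. frac (t + \<alpha>)) \<in> measurable H H"
    unfolding measurable_cong_sets[OF sets sets]
  proof (intro measurable_restrict_space2 measurable_restrict_space1)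
    show "(\<lambda>t. frac (t + \<alpha>)) \<in> borel_measurable borel" unfolding frac_def by measurable
  qed (simp add: frac_lt_1)
  have m2: "circ \<in> borel_measurable H"
    unfolding measurable_cong_sets[OF sets refl] by (rule measurable_restrict_space1) measurable
  have "(\<integral>t. circ t \<partial>H) = (\<integral>t. circ t \<partial>distr H H (\<lambda>t. frac (t + \<alpha>)))" by (simp add: inv)
  also have "\<dots> = (\<integral>t. circ (frac (t + \<alpha>)) \<partial>H)" by (rule integral_distr[OF m1 m2])
  also have "\<dots> = (\<integral>t. circ t \<partial>H) * circ \<alpha>" by (simp add: circ_frac circ_add)
  finally have "(\<integral>t. circ t \<partial>H) * (1 - circ \<alpha>) = 0" by (simp add: algebra_simps)
  then have "(\<integral>t. circ t \<partial>H) = 0" using assms(2) by simp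
  moreover have "(\<lambda>N. (\<Sum>n=1..N. circ (x n)) / of_nat N) \<longlonglongrightarrow> (\<integral>t. circ t \<partial>H)"
    using H(2) unfolding uniformly_distributed_wrt_def
    using continuous_on_circ[OF continuous_on_id] circ_add_1 by blast
  ultimately show ?thesis by simp
qed

lemma uniformly_distributed_mod1_character:
  assumes "uniformly_distributed_mod1 x"
  shows "(\<lambda>N. (\<Sum>n=1..N. circ (x n)) / of_nat N) \<longlonglongrightarrow> 0"
proof -
  have "(\<integral>t. circ t \<partial>restrict_space lborel {0..<1}) = (\<integral>t. indicator {0..<1} t *\<^sub>R circ t \<partial>lborel)"
    by (rule integral_restrict_space) auto
  also have "\<dots> = (\<integral>t. indicator {0..1} t *\<^sub>R circ t \<partial>lborel)"
  proof (rule integral_cong_AE)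
    show "AE t in lborel. indicator {0..<1} t *\<^sub>R circ t = indicator {0..1} t *\<^sub>R circ t"
      using AE_lborel_singleton[of 1] by eventually_elim (auto simp: indicator_def)
  qed auto
  also have "\<dots> = (\<integral>t. circ t \<partial>lebesgue_01)"
    by (rule integral_restrict_space[symmetric]) auto
  also have "\<dots> = 0" using integral_circ_lebesgue[of 1] by simp
  finally have "(\<integral>t. circ t \<partial>restrict_space lborel {0..<1}) = 0" .
  moreover have "(\<lambda>N. (\<Sum>n=1..N. circ (x n)) / of_nat N) \<longlonglongrightarrow> (\<integral>t. circ t \<partial>restrict_space lborel {0..<1})"
    using assms unfolding uniformly_distributed_mod1_def uniformly_distributed_wrt_def
    using continuous_on_circ[OF continuous_on_id] circ_add_1 by blast
  ultimately show ?thesis by simp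
qed

section \<open>Ergodic averages, autocorrelations and the spectral measure\<close>

context prob_space
begin

text \<open>
  The mass of the spectral measure on the solutions of \<open>q t \<in> \<int>\<close> is the limit of the correlations of
  \<open>f\<close> with its averages along the multiples of \<open>q\<close>.
\<close>

lemma spectral_measure_null_of_ergodic_averages:
  assumes S: "measure_preserving_map M S" and f: "f \<in> borel_measurable M" "\<And>x. cmod (f x) \<le> C" and "C > 0"
    and \<sigma>: "circle_measure \<sigma>" "\<And>n. (\<integral>t. circ (of_int n * t) \<partial>\<sigma>) = correlation M S f n"
    and lim: "(\<lambda>N. \<integral>x. (cmod (ergodic_average (S ^^ q) f N x))\<^sup>2 \<partial>M) \<longlonglongrightarrow> 0"
  shows "AE t in \<sigma>. circ (real q * t) \<noteq> 1"
proof -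
  interpret \<sigma>: circle_measure \<sigma> by fact
  note Sq = measure_preserving_map_funpow[OF S, of q]
  note [measurable] = f(1) ergodic_average_measurable[OF Sq f(1)]
    measure_preserving_map_measurable[OF S]
    measure_preserving_map_measurable[OF measure_preserving_map_funpow[OF S]]
  define I where "I t = (if circ (real q * t) = 1 then 1 else 0 :: complex)" for t
  have [measurable]: "I \<in> borel_measurable borel" unfolding I_def by measurable
  have "(\<lambda>N. \<integral>t. (\<Sum>n=1..N. circ (real n * (real q * t))) / of_nat N \<partial>\<sigma>) \<longlonglongrightarrow> (\<integral>t. I t \<partial>\<sigma>)"
  proof (rule integral_dominated_convergence[where w = "\<lambda>_. 1"])
    show "AE t in \<sigma>. (\<lambda>N. (\<Sum>n=1..N. circ (real n * (real q * t))) / of_nat N) \<longlonglongrightarrow> I t"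
    proof (rule AE_I2)
      show "(\<lambda>N. (\<Sum>n=1..N. circ (real n * (real q * t))) / of_nat N) \<longlonglongrightarrow> I t" for t
        using average_powers_tendsto[of "circ (real q * t)"] by (simp only: I_def circ_power norm_circ)
    qed
    show "AE t in \<sigma>. norm ((\<Sum>n=1..N. circ (real n * (real q * t))) / of_nat N) \<le> 1" for N
      by (intro AE_I2 norm_average_le) auto
  qed (auto intro!: \<sigma>.integrable_bounded)
  moreover have "(\<integral>t. (\<Sum>n=1..N. circ (real n * (real q * t))) / of_nat N \<partial>\<sigma>) =
      (\<integral>x. ergodic_average (S ^^ q) f N x * cnj (f x) \<partial>M)" for N
  proof -
    have "(\<integral>t. (\<Sum>n=1..N. circ (real n * (real q * t))) / of_nat N \<partial>\<sigma>) =
        (\<Sum>n=1..N. \<integral>t. circ (of_int (int (q * n)) * t) \<partial>\<sigma>) / of_nat N"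
      by (subst integral_divide_zero, subst Bochner_Integration.integral_sum)
        (auto intro!: \<sigma>.integrable_bounded[where B = 1] simp: mult_ac)
    also have "\<dots> = (\<Sum>n=1..N. \<integral>x. f (((S ^^ q) ^^ n) x) * cnj (f x) \<partial>M) / of_nat N"
      unfolding \<sigma>(2) by (simp only: correlation_def of_nat_0_le_iff if_True nat_int funpow_mult mult.commute)
    also have "\<dots> = (\<integral>x. (\<Sum>n=1..N. f (((S ^^ q) ^^ n) x) * cnj (f x)) / of_nat N \<partial>M)"
    proof -
      have "cmod (f u * cnj (f v)) \<le> C * C" for u v
        using f(2) \<open>C > 0\<close> by (auto simp: norm_mult intro!: mult_mono)
      then show ?thesis
        by (subst integral_divide_zero, subst Bochner_Integration.integral_sum)
          (auto intro!: integrable_bounded[where B = "C * C"] simp: funpow_mult)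
    qed
    also have "\<dots> = (\<integral>x. ergodic_average (S ^^ q) f N x * cnj (f x) \<partial>M)"
      by (simp add: ergodic_average_def sum_distrib_right)
    finally show ?thesis .
  qed
  moreover have "(\<lambda>N. \<integral>x. ergodic_average (S ^^ q) f N x * cnj (f x) \<partial>M) \<longlonglongrightarrow> 0"
  proof (rule LIMSEQ_I)
    fix e :: real assume "e > 0"
    then have "e / C > 0" using \<open>C > 0\<close> by simp
    then have "\<forall>\<^sub>F N in sequentially. (\<integral>x. (cmod (ergodic_average (S ^^ q) f N x))\<^sup>2 \<partial>M) < (e / C)\<^sup>2"
      by (intro order_tendstoD(2)[OF lim] zero_less_power)
    then have "\<forall>\<^sub>F N in sequentially. norm ((\<integral>x. ergodic_average (S ^^ q) f N x * cnj (f x) \<partial>M) - 0) < e"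
    proof eventually_elim
      case (elim N)
      have b: "cmod (ergodic_average (S ^^ q) f N x) \<le> C" for x
        by (rule ergodic_average_bounded) (rule f)
      have 1: "(\<integral>x. cmod (ergodic_average (S ^^ q) f N x) \<partial>M) < e / C"
        by (rule integral_cmod_less[OF _ b elim \<open>e / C > 0\<close>]) measurable
      have "cmod (\<integral>x. ergodic_average (S ^^ q) f N x * cnj (f x) \<partial>M) \<le>
          (\<integral>x. cmod (ergodic_average (S ^^ q) f N x * cnj (f x)) \<partial>M)"
        by (rule integral_norm_bound)
      also have "\<dots> \<le> (\<integral>x. cmod (ergodic_average (S ^^ q) f N x) * C \<partial>M)"
      proof (rule integral_mono)
        show "integrable M (\<lambda>x. cmod (ergodic_average (S ^^ q) f N x * cnj (f x)))"
          by (rule integrable_bounded[where B = "C * C"])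
            (use f(2) b \<open>C > 0\<close> in \<open>auto simp: norm_mult intro!: mult_mono\<close>)
        show "integrable M (\<lambda>x. cmod (ergodic_average (S ^^ q) f N x) * C)"
          by (rule integrable_bounded[where B = "C * C"])
            (use b \<open>C > 0\<close> in \<open>auto simp: abs_mult\<close>)
      qed (use f(2) in \<open>auto simp: norm_mult intro!: mult_left_mono\<close>)
      also have "\<dots> < e" using 1 \<open>C > 0\<close> by (simp add: field_simps)
      finally show ?case by simp
    qed
    then show "\<exists>N0. \<forall>N\<ge>N0. norm ((\<integral>x. ergodic_average (S ^^ q) f N x * cnj (f x) \<partial>M) - 0) < e"
      unfolding eventually_sequentially .
  qed
  ultimately have I0: "(\<integral>t. I t \<partial>\<sigma>) = 0" using LIMSEQ_unique by fastforce
  have "I t = complex_of_real (indicator {t. circ (real q * t) = 1} t)" for t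
    by (simp add: I_def indicator_def)
  then have "(\<integral>t. indicator {t. circ (real q * t) = 1} t \<partial>\<sigma>) = (0::real)"
    using I0 by (simp only: integral_complex_of_real of_real_eq_0_iff)
  moreover have "integrable \<sigma> (\<lambda>t. indicator {t. circ (real q * t) = 1} t :: real)"
    by (rule \<sigma>.integrable_bounded[where B = 1]) (auto simp: indicator_def)
  ultimately have "AE t in \<sigma>. indicator {t. circ (real q * t) = 1} t = (0::real)"
    by (subst (asm) integral_nonneg_eq_0_iff_AE) auto
  then show ?thesis by eventually_elim (auto simp: indicator_def)
qed

lemma autocorrelation_tendsto_0:
  assumes S: "measure_preserving_map M S" and f: "f \<in> borel_measurable M"
    and \<sigma>: "circle_measure \<sigma>" "\<And>n. (\<integral>t. circ (of_int n * t) \<partial>\<sigma>) = correlation M S f n"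
    and lim: "AE t in \<sigma>. (\<lambda>N. (\<Sum>n=1..N. circ ((real (k (n + h)) - real (k n)) * t)) / of_nat N) \<longlonglongrightarrow> 0"
  shows "(\<lambda>N. (\<Sum>n=1..N. \<integral>x. f ((S ^^ k (n + h)) x) * cnj (f ((S ^^ k n) x)) \<partial>M) / of_nat N) \<longlonglongrightarrow> 0"
proof -
  interpret \<sigma>: circle_measure \<sigma> by fact
  have "(\<lambda>N. \<integral>t. (\<Sum>n=1..N. circ ((real (k (n + h)) - real (k n)) * t)) / of_nat N \<partial>\<sigma>) \<longlonglongrightarrow> (\<integral>t. 0 \<partial>\<sigma>)"
  proof (rule integral_dominated_convergence[where w = "\<lambda>_. 1"])
    show "AE t in \<sigma>. norm ((\<Sum>n=1..N. circ ((real (k (n + h)) - real (k n)) * t)) / of_nat N) \<le> 1" for N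
      by (intro AE_I2 norm_average_le) auto
  qed (use lim in \<open>auto intro!: \<sigma>.integrable_bounded\<close>)
  moreover have "(\<integral>t. (\<Sum>n=1..N. circ ((real (k (n + h)) - real (k n)) * t)) / of_nat N \<partial>\<sigma>) =
      (\<Sum>n=1..N. \<integral>x. f ((S ^^ k (n + h)) x) * cnj (f ((S ^^ k n) x)) \<partial>M) / of_nat N" for N
  proof -
    have "(\<integral>t. (\<Sum>n=1..N. circ ((real (k (n + h)) - real (k n)) * t)) / of_nat N \<partial>\<sigma>) =
        (\<Sum>n=1..N. \<integral>t. circ (of_int (int (k (n + h)) - int (k n)) * t) \<partial>\<sigma>) / of_nat N"
      by (subst integral_divide_zero, subst Bochner_Integration.integral_sum)
        (auto intro!: \<sigma>.integrable_bounded[where B = 1])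
    then show ?thesis unfolding \<sigma>(2) correlation_shift[OF S f] .
  qed
  ultimately show ?thesis by (simp only: integral_zero)
qed

lemma cond_exp_ergodic:
  assumes S: "measure_preserving_map M S" and erg: "ergodic M S"
    and f: "f \<in> borel_measurable M" "\<And>x. cmod (f x) \<le> C"
  shows "AE x in M. cond_exp M (invariant_algebra M S) f x = (\<integral>x. f x \<partial>M)"
proof -
  note Sm = measure_preserving_map_measurable[OF S]
  interpret sub: finite_measure_subalgebra M "invariant_algebra M S"
    by unfold_locales (rule subalgebra_invariant_algebra[OF Sm])
  have int: "integrable M f" by (rule integrable_bounded[OF f])
  have real: "AE x in M. real_cond_exp M (invariant_algebra M S) u x = (\<integral>x. u x \<partial>M)"
    if u: "integrable M u" for u :: "'a \<Rightarrow> real"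
  proof (rule sub.real_cond_exp_charact[OF _ u])
    fix A assume "A \<in> sets (invariant_algebra M S)"
    then have A: "A \<in> invariant_sets M S" by (simp add: sets_invariant_algebra[OF Sm])
    then have [measurable]: "A \<in> sets M" by (simp add: invariant_sets_def)
    have c: "(\<integral>x\<in>A. (\<integral>x. u x \<partial>M) \<partial>M) = prob A * (\<integral>x. u x \<partial>M)"
      by (simp add: set_lebesgue_integral_def)
    consider "prob A = 0" | "prob A = 1" using erg A by (auto simp: ergodic_def)
    then show "(\<integral>x\<in>A. u x \<partial>M) = (\<integral>x\<in>A. (\<integral>x. u x \<partial>M) \<partial>M)"
    proof cases
      case 1
      then have "AE x in M. x \<notin> A" by (subst (asm) prob_eq_0) auto
      then have "(\<integral>x\<in>A. u x \<partial>M) = (\<integral>x. 0 \<partial>M)"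
        unfolding set_lebesgue_integral_def using u
        by (intro integral_cong_AE) (auto elim: eventually_mono)
      then show ?thesis using c 1 by simp
    next
      case 2
      then have "AE x in M. x \<in> A" by (subst (asm) prob_eq_1) auto
      then have "(\<integral>x\<in>A. u x \<partial>M) = (\<integral>x. u x \<partial>M)"
        unfolding set_lebesgue_integral_def using u
        by (intro integral_cong_AE) (auto elim: eventually_mono)
      then show ?thesis using c 2 by simp
    qed
  qed auto
  show ?thesis
    using real[OF integrable_Re[OF int]] real[OF integrable_Im[OF int]]
    by eventually_elim (simp add: cond_exp_def complex_eq_iff int)
qed

end

section \<open>A lower bound for products of conditional expectations\<close>

text \<open>The inequality between arithmetic and geometric mean for three positive numbers of product 1.\<close>

lemma three_le_sum_of_reciprocal_weights:
  fixes a p r :: real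
  assumes "a > 0" "p > 0" "r > 0"
  shows "3 \<le> p * r / a\<^sup>2 + a / p + a / r"
proof -
  define s where "s = sqrt (p * r)"
  have s: "s > 0" "s\<^sup>2 = p * r" using assms by (auto simp: s_def)
  have "p + r \<ge> 2 * s" unfolding s_def using arith_geo_mean_sqrt[of p r] assms by simp
  then have "2 * a / s \<le> a / p + a / r"
  proof -
    have "a / p + a / r = a * (p + r) / s\<^sup>2" using assms s by (simp add: field_simps)
    moreover have "2 * a / s = a * (2 * s) / s\<^sup>2" using s(1) by (simp add: power2_eq_square)
    ultimately show ?thesis
      using \<open>p + r \<ge> 2 * s\<close> assms by (simp add: divide_right_mono)
  qed
  moreover have "3 \<le> s\<^sup>2 / a\<^sup>2 + 2 * a / s"
  proof -
    have "0 \<le> (s - a)\<^sup>2 * (s + 2 * a)" using s assms by auto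
    also have "\<dots> = s ^ 3 + 2 * a ^ 3 - 3 * a\<^sup>2 * s" by (simp add: power2_eq_square power3_eq_cube algebra_simps)
    finally have "3 * (a\<^sup>2 * s) \<le> s ^ 3 + 2 * a ^ 3" by simp
    then have "3 \<le> (s ^ 3 + 2 * a ^ 3) / (a\<^sup>2 * s)" using assms s by (simp add: pos_le_divide_eq)
    also have "\<dots> = s\<^sup>2 / a\<^sup>2 + 2 * a / s" using assms s by (simp add: field_simps power2_eq_square power3_eq_cube)
    finally show ?thesis .
  qed
  ultimately show ?thesis using s by simp
qed

context prob_space
begin

lemma integral_indicator_over_cond_exp_le_1:
  assumes sub: "subalgebra M F" and A [measurable]: "A \<in> sets M" and "\<delta> > 0"
    and u: "u = real_cond_exp M F (indicator A)"
  shows "(\<integral>x. indicator A x / (max 0 (u x) + \<delta>) \<partial>M) \<le> 1"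
proof -
  interpret F: finite_measure_subalgebra M F by unfold_locales (rule sub)
  have uF [measurable]: "u \<in> borel_measurable F" by (simp add: u)
  have [measurable]: "u \<in> borel_measurable M" by (simp add: u)
  define w where "w x = 1 / (max 0 (u x) + \<delta>)" for x
  have wF: "w \<in> borel_measurable F" unfolding w_def by measurable
  have wb: "0 \<le> w x" "w x \<le> 1 / \<delta>" "w x * u x \<le> 1" for x
    using \<open>\<delta> > 0\<close> by (auto simp: w_def divide_simps max_def)
  have [measurable]: "w \<in> borel_measurable M" unfolding w_def by measurable
  have int: "integrable M (\<lambda>x. w x * indicator A x)"
    by (rule integrable_bounded[where B = "1 / \<delta>"]) (use wb \<open>\<delta> > 0\<close> in \<open>auto simp: indicator_def\<close>)
  have iA: "(indicator A :: 'a \<Rightarrow> real) \<in> borel_measurable M" by measurable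
  have "(\<integral>x. indicator A x / (max 0 (u x) + \<delta>) \<partial>M) = (\<integral>x. w x * indicator A x \<partial>M)"
    by (simp add: w_def)
  also have "\<dots> = (\<integral>x. w x * u x \<partial>M)"
    unfolding u by (rule F.real_cond_exp_intg(2)[OF int wF iA, symmetric])
  also have "\<dots> \<le> (\<integral>x. 1 \<partial>M)"
    using F.real_cond_exp_intg(1)[OF int wF iA] wb by (intro integral_mono) (auto simp: u)
  finally show ?thesis by (simp add: prob_space)
qed

text \<open>
  With \<open>u\<close> and \<open>v\<close> the two conditional expectations and \<open>a\<close> the measure of \<open>A\<close>, the inequality of the means
  gives \<open>3 \<le> u v / a\<^sup>2 + a / u + a / v\<close>, to be integrated over \<open>A\<close>; the integral of \<open>1 / u\<close> over \<open>A\<close> is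
  at most 1.  Adding \<open>\<delta>\<close> to \<open>u\<close> and \<open>v\<close> avoids division by 0.
\<close>

theorem integral_cond_exp_product_ge_cube:
  assumes sub: "subalgebra M F" "subalgebra M G" and A [measurable]: "A \<in> sets M"
  shows "(\<integral>x. indicator A x * (real_cond_exp M F (indicator A) x * real_cond_exp M G (indicator A) x) \<partial>M)
    \<ge> prob A ^ 3"
proof -
  interpret F: finite_measure_subalgebra M F by unfold_locales (rule sub)
  interpret G: finite_measure_subalgebra M G by unfold_locales (rule sub)
  define u where "u = real_cond_exp M F (indicator A)"
  define v where "v = real_cond_exp M G (indicator A)"
  have [measurable]: "u \<in> borel_measurable M" "v \<in> borel_measurable M" by (simp_all add: u_def v_def)
  have iA: "integrable M (indicator A :: 'a \<Rightarrow> real)" by (simp add: less_top[symmetric])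
  have u01: "AE x in M. 0 \<le> u x" "AE x in M. u x \<le> 1"
    unfolding u_def by (rule F.real_cond_exp_ge_c[OF iA] F.real_cond_exp_le_c[OF iA]; simp add: indicator_def)+
  have v01: "AE x in M. 0 \<le> v x" "AE x in M. v x \<le> 1"
    unfolding v_def by (rule G.real_cond_exp_ge_c[OF iA] G.real_cond_exp_le_c[OF iA]; simp add: indicator_def)+
  \<comment> \<open>Versions with values in \<open>[0, 1]\<close> everywhere.\<close>
  define u' where "u' x = max 0 (min 1 (u x))" for x
  define v' where "v' x = max 0 (min 1 (v x))" for x
  have [measurable]: "u' \<in> borel_measurable M" "v' \<in> borel_measurable M"
    unfolding u'_def v'_def by measurable
  have b: "0 \<le> u' x" "u' x \<le> 1" "0 \<le> v' x" "v' x \<le> 1" for x by (auto simp: u'_def v'_def)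
  have eq: "AE x in M. u' x = u x \<and> v' x = v x \<and> max 0 (u x) = u' x \<and> max 0 (v x) = v' x"
    using u01 v01 by eventually_elim (auto simp: u'_def v'_def)
  define a where "a = prob A"
  define L where "L = (\<integral>x. indicator A x * (u' x * v' x) \<partial>M)"
  have int: "integrable M (\<lambda>x. indicator A x * h x)"
    if "h \<in> borel_measurable M" "\<And>x. 0 \<le> h x" "\<And>x. h x \<le> B" for h :: "'a \<Rightarrow> real" and B
  proof (rule integrable_bounded[where B = B])
    show "norm (indicator A x * h x) \<le> B" for x
      using that(2,3)[of x] by (auto simp: indicator_def)
  qed (use that in measurable)
  have uv: "0 \<le> u' x * v' x" "u' x * v' x \<le> 1" for x
    using b by (auto simp: mult_le_one)
  have "a ^ 3 \<le> L"
  proof (cases "a = 0")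
    case True
    have "L \<ge> 0" unfolding L_def by (rule integral_nonneg_AE) (use b in auto)
    then show ?thesis using True by simp
  next
    case False
    then have "a > 0" by (simp add: a_def zero_less_measure_iff)
    have approx: "a ^ 3 \<le> L + 3 * \<delta>" if \<delta>: "0 < \<delta>" "\<delta> \<le> 1" for \<delta>
    proof -
      define P where "P x = (u' x + \<delta>) * (v' x + \<delta>)" for x
      have Pb: "0 \<le> P x" "P x \<le> u' x * v' x + 3 * \<delta>" "P x \<le> 4" for x
      proof -
        show "0 \<le> P x" unfolding P_def using b[of x] \<delta> by auto
        have "\<delta> * u' x \<le> \<delta> * 1" "\<delta> * v' x \<le> \<delta> * 1" "\<delta> * \<delta> \<le> \<delta> * 1"
          using b[of x] \<delta> by (auto intro!: mult_left_mono)
        then show "P x \<le> u' x * v' x + 3 * \<delta>" unfolding P_def by (simp add: algebra_simps)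
        then show "P x \<le> 4" using uv[of x] \<delta> by linarith
      qed
      have [measurable]: "P \<in> borel_measurable M" unfolding P_def by measurable
      have I1: "integrable M (\<lambda>x. indicator A x * P x)"
        by (rule int[of _ "4"]) (use Pb in auto)
      have I2: "integrable M (\<lambda>x. indicator A x * (1 / (u' x + \<delta>)))"
        by (rule int[of _ "1 / \<delta>"]) (use b \<delta> in \<open>auto intro!: divide_left_mono mult_pos_pos add_nonneg_pos\<close>)
      have I3: "integrable M (\<lambda>x. indicator A x * (1 / (v' x + \<delta>)))"
        by (rule int[of _ "1 / \<delta>"]) (use b \<delta> in \<open>auto intro!: divide_left_mono mult_pos_pos add_nonneg_pos\<close>)
      have J2: "(\<integral>x. indicator A x * (1 / (u' x + \<delta>)) \<partial>M) \<le> 1"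
      proof -
        have "(\<integral>x. indicator A x * (1 / (u' x + \<delta>)) \<partial>M) = (\<integral>x. indicator A x / (max 0 (u x) + \<delta>) \<partial>M)"
          by (rule integral_cong_AE) (use eq in \<open>auto elim: eventually_mono\<close>)
        then show ?thesis using integral_indicator_over_cond_exp_le_1[OF sub(1) A \<delta>(1) u_def] by simp
      qed
      have J3: "(\<integral>x. indicator A x * (1 / (v' x + \<delta>)) \<partial>M) \<le> 1"
      proof -
        have "(\<integral>x. indicator A x * (1 / (v' x + \<delta>)) \<partial>M) = (\<integral>x. indicator A x / (max 0 (v x) + \<delta>) \<partial>M)"
          by (rule integral_cong_AE) (use eq in \<open>auto elim: eventually_mono\<close>)
        then show ?thesis using integral_indicator_over_cond_exp_le_1[OF sub(2) A \<delta>(1) v_def] by simp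
      qed
      have "3 * a = (\<integral>x. 3 * indicator A x \<partial>M)" by (simp add: a_def)
      also have "\<dots> \<le> (\<integral>x. indicator A x * P x / a\<^sup>2 + a * (indicator A x * (1 / (u' x + \<delta>))) +
          a * (indicator A x * (1 / (v' x + \<delta>))) \<partial>M)"
      proof (rule integral_mono)
        show "integrable M (\<lambda>x. 3 * indicator A x :: real)" using iA by simp
        show "integrable M (\<lambda>x. indicator A x * P x / a\<^sup>2 + a * (indicator A x * (1 / (u' x + \<delta>))) +
          a * (indicator A x * (1 / (v' x + \<delta>))))"
          by (intro Bochner_Integration.integrable_add integrable_divide integrable_mult_right I1 I2 I3)
        fix x
        show "3 * indicator A x \<le> indicator A x * P x / a\<^sup>2 + a * (indicator A x * (1 / (u' x + \<delta>))) +
          a * (indicator A x * (1 / (v' x + \<delta>)))"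
          using three_le_sum_of_reciprocal_weights[OF \<open>a > 0\<close>, of "u' x + \<delta>" "v' x + \<delta>"] b[of x] \<delta>
          by (cases "x \<in> A") (auto simp: P_def add_nonneg_pos)
      qed
      also have "\<dots> = (\<integral>x. indicator A x * P x \<partial>M) / a\<^sup>2 + a * (\<integral>x. indicator A x * (1 / (u' x + \<delta>)) \<partial>M) +
          a * (\<integral>x. indicator A x * (1 / (v' x + \<delta>)) \<partial>M)"
        by (simp only: Bochner_Integration.integral_add Bochner_Integration.integrable_add integrable_divide
            integrable_mult_right I1 I2 I3 integral_divide_zero integral_mult_right_zero)
      also have "\<dots> \<le> (\<integral>x. indicator A x * P x \<partial>M) / a\<^sup>2 + a * 1 + a * 1"
        using J2 J3 \<open>a > 0\<close> by (intro add_mono mult_left_mono) auto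
      finally have "a \<le> (\<integral>x. indicator A x * P x \<partial>M) / a\<^sup>2" by simp
      then have "a ^ 3 \<le> (\<integral>x. indicator A x * P x \<partial>M)"
        using \<open>a > 0\<close> by (simp add: pos_le_divide_eq power2_eq_square power3_eq_cube)
      also have "\<dots> \<le> (\<integral>x. indicator A x * (u' x * v' x) + 3 * \<delta> \<partial>M)"
      proof (rule integral_mono[OF I1])
        show "integrable M (\<lambda>x. indicator A x * (u' x * v' x) + 3 * \<delta>)"
          by (intro Bochner_Integration.integrable_add int[of _ "1"]) (use uv in auto)
        show "indicator A x * P x \<le> indicator A x * (u' x * v' x) + 3 * \<delta>" for x
          using Pb(2)[of x] \<delta> by (auto simp: indicator_def)
      qed
      also have "\<dots> = L + 3 * \<delta>"
        unfolding L_def by (subst Bochner_Integration.integral_add) (use uv in \<open>auto intro!: int[of _ "1"] simp: prob_space\<close>)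
      finally show ?thesis .
    qed
    show ?thesis
    proof (rule field_le_epsilon)
      fix e :: real assume "e > 0"
      define \<delta> where "\<delta> = min 1 (e / 3)"
      have "a ^ 3 \<le> L + 3 * \<delta>" using \<open>e > 0\<close> by (intro approx) (auto simp: \<delta>_def)
      then show "a ^ 3 \<le> L + e" by (simp add: \<delta>_def min_def split: if_splits)
    qed
  qed
  also have "L = (\<integral>x. indicator A x * (u x * v x) \<partial>M)"
    unfolding L_def by (rule integral_cong_AE) (use eq in \<open>auto elim: eventually_mono\<close>)
  finally show ?thesis by (simp add: a_def u_def v_def)
qed

end

section \<open>Convergence of the averages\<close>

text \<open>
  The property of the powers \<open>S ^^ k n\<close> on which convergence rests.  For a bounded function \<open>g\<close> whose
  ergodic averages tend to the invariant function \<open>G\<close>, which is also its conditional expectation, these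
  powers move \<open>g - G\<close> along a sequence whose autocorrelations at all positive lags average to 0.
  \<open>G\<close> is characterised in both ways, so that a proof of the property may use either.
\<close>

definition uncorrelated_along :: "'a measure \<Rightarrow> ('a \<Rightarrow> 'a) \<Rightarrow> (nat \<Rightarrow> nat) \<Rightarrow> bool" where
  "uncorrelated_along M S k \<longleftrightarrow>
     (\<forall>g G C. g \<in> borel_measurable M \<longrightarrow> (\<forall>x. cmod (g x) \<le> C) \<longrightarrow>
        G \<in> borel_measurable M \<longrightarrow> (\<forall>x. cmod (G x) \<le> C) \<longrightarrow> (\<forall>x\<in>space M. G (S x) = G x) \<longrightarrow>
        (\<lambda>N. \<integral>x. (cmod (ergodic_average S g N x - G x))\<^sup>2 \<partial>M) \<longlonglongrightarrow> 0 \<longrightarrow>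
        (AE x in M. cond_exp M (invariant_algebra M S) g x = G x) \<longrightarrow>
        (\<forall>h\<ge>1. (\<lambda>N. (\<Sum>n=1..N. \<integral>x. (g ((S ^^ k (n + h)) x) - G ((S ^^ k (n + h)) x)) *
            cnj (g ((S ^^ k n) x) - G ((S ^^ k n) x)) \<partial>M) / of_nat N) \<longlonglongrightarrow> 0))"

context prob_space
begin

lemma invariant_funpow:
  assumes "measure_preserving_map M S" "\<And>x. x \<in> space M \<Longrightarrow> G (S x) = G x" "x \<in> space M"
  shows "G ((S ^^ n) x) = G x"
proof (induction n)
  case (Suc n)
  have "(S ^^ n) x \<in> space M"
    by (rule measurable_space[OF measure_preserving_map_measurable[OF
            measure_preserving_map_funpow[OF assms(1)]] assms(3)])
  then show ?case using Suc assms(2) by simp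
qed simp

lemma ergodic_average_diff_invariant:
  assumes S: "measure_preserving_map M S" and G: "\<And>x. x \<in> space M \<Longrightarrow> G (S x) = G x"
    and "x \<in> space M" "N > 0"
  shows "ergodic_average S (\<lambda>x. g x - G x) N x = ergodic_average S g N x - G x"
  using assms(4) by (simp add: ergodic_average_def sum_subtractf diff_divide_distrib 
      invariant_funpow[of S G, OF assms(1) assms(2) assms(3)])

text \<open>
  As \<open>g - G\<close> has vanishing ergodic averages, its spectral measure does not charge the point 0 of the
  circle, the only one at which the averages of the characters do not tend to 0.
\<close>

lemma uncorrelated_along_orbit_closure:
  assumes S: "measure_preserving_map M S"
    and ud: "\<And>(\<alpha>::real) h. h \<ge> 1 \<Longrightarrow>
      uniformly_distributed_in (orbit_closure \<alpha>) (\<lambda>n. (real (k (n + h)) - real (k n)) * \<alpha>)"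
  shows "uncorrelated_along M S k"
  unfolding uncorrelated_along_def
proof (intro allI impI)
  fix g G :: "'a \<Rightarrow> complex" and C :: real and h :: nat
  assume gm [measurable]: "g \<in> borel_measurable M" and Gm [measurable]: "G \<in> borel_measurable M"
    and b: "\<forall>x. cmod (g x) \<le> C" "\<forall>x. cmod (G x) \<le> C"
    and Ginv: "\<forall>x\<in>space M. G (S x) = G x"
    and lim: "(\<lambda>N. \<integral>x. (cmod (ergodic_average S g N x - G x))\<^sup>2 \<partial>M) \<longlonglongrightarrow> 0"
    and "h \<ge> 1"
  define f where "f x = g x - G x" for x
  have fm: "f \<in> borel_measurable M" unfolding f_def by measurable
  have fb: "cmod (f x) \<le> 2 * C + 1" for x
    unfolding f_def using norm_triangle_ineq4[of "g x" "G x"] b[THEN spec, of x] by linarith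
  have "C \<ge> 0" using b(1) norm_ge_zero order_trans by blast
  then have "2 * C + 1 > 0" by simp
  obtain \<sigma> where \<sigma>: "circle_measure \<sigma>" "\<And>n. (\<integral>t. circ (of_int n * t) \<partial>\<sigma>) = correlation M S f n"
    by (rule obtain_spectral_measure[OF S fm fb]) (rule that; assumption)
  have "(\<lambda>N. \<integral>x. (cmod (ergodic_average (S ^^ 1) f N x))\<^sup>2 \<partial>M) \<longlonglongrightarrow> 0"
  proof (rule Lim_transform_eventually[OF lim])
    show "\<forall>\<^sub>F N in sequentially. (\<integral>x. (cmod (ergodic_average S g N x - G x))\<^sup>2 \<partial>M) =
        (\<integral>x. (cmod (ergodic_average (S ^^ 1) f N x))\<^sup>2 \<partial>M)"
      using eventually_gt_at_top[of 0]
    proof eventually_elim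
      case (elim N)
      show ?case
        by (intro Bochner_Integration.integral_cong refl)
          (use ergodic_average_diff_invariant[OF S, of G _ N g] Ginv elim in \<open>auto simp: f_def[abs_def]\<close>)
    qed
  qed
  from spectral_measure_null_of_ergodic_averages[OF S fm fb \<open>2 * C + 1 > 0\<close> \<sigma> this]
  have "AE t in \<sigma>. circ t \<noteq> 1" by simp
  then have "AE t in \<sigma>. (\<lambda>N. (\<Sum>n=1..N. circ ((real (k (n + h)) - real (k n)) * t)) / of_nat N) \<longlonglongrightarrow> 0"
    by eventually_elim (rule uniformly_distributed_in_character[OF ud[OF \<open>h \<ge> 1\<close>]])
  from autocorrelation_tendsto_0[OF S fm \<sigma> this]
  show "(\<lambda>N. (\<Sum>n=1..N. \<integral>x. (g ((S ^^ k (n + h)) x) - G ((S ^^ k (n + h)) x)) *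
            cnj (g ((S ^^ k n) x) - G ((S ^^ k n) x)) \<partial>M) / of_nat N) \<longlonglongrightarrow> 0"
    by (simp only: f_def)
qed

text \<open>
  Here nothing is known about the averages of the characters at rational points, but total ergodicity
  implies that the spectral measure of \<open>g - G\<close> does not charge them.
\<close>

lemma uncorrelated_along_totally_ergodic:
  assumes S: "measure_preserving_map M S" and te: "totally_ergodic M S"
    and ud: "\<And>(\<alpha>::real) h. \<alpha> \<notin> \<rat> \<Longrightarrow> h \<ge> 1 \<Longrightarrow>
      uniformly_distributed_mod1 (\<lambda>n. (real (k (n + h)) - real (k n)) * \<alpha>)"
  shows "uncorrelated_along M S k"
  unfolding uncorrelated_along_def
proof (intro allI impI)
  fix g G :: "'a \<Rightarrow> complex" and C :: real and h :: nat
  assume gm [measurable]: "g \<in> borel_measurable M" and Gm [measurable]: "G \<in> borel_measurable M"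
    and b: "\<forall>x. cmod (g x) \<le> C" "\<forall>x. cmod (G x) \<le> C"
    and GE: "AE x in M. cond_exp M (invariant_algebra M S) g x = G x"
    and "h \<ge> 1"
  define f where "f x = g x - G x" for x
  have fm [measurable]: "f \<in> borel_measurable M" unfolding f_def by measurable
  have fb: "cmod (f x) \<le> 2 * C + 1" for x
    unfolding f_def using norm_triangle_ineq4[of "g x" "G x"] b[THEN spec, of x] by linarith
  have "C \<ge> 0" using b(1) norm_ge_zero order_trans by blast
  then have "2 * C + 1 > 0" by simp
  have "ergodic M (S ^^ 1)" using te by (simp add: totally_ergodic_def del: funpow.simps)
  then have "ergodic M S" by simp
  have "AE x in M. G x = (\<integral>x. g x \<partial>M)"
    using cond_exp_ergodic[OF S \<open>ergodic M S\<close> gm b(1)[rule_format]] GE by eventually_elim simp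
  then have "(\<integral>x. G x \<partial>M) = (\<integral>x. (\<integral>x. g x \<partial>M) \<partial>M)" by (intro integral_cong_AE) auto
  then have f0: "(\<integral>x. f x \<partial>M) = 0"
    using Bochner_Integration.integral_diff[OF integrable_bounded[OF gm b(1)[rule_format]]
        integrable_bounded[OF Gm b(2)[rule_format]]]
    by (simp add: f_def prob_space)
  obtain \<sigma> where \<sigma>: "circle_measure \<sigma>" "\<And>n. (\<integral>t. circ (of_int n * t) \<partial>\<sigma>) = correlation M S f n"
    by (rule obtain_spectral_measure[OF S fm fb]) (rule that; assumption)
  interpret \<sigma>: circle_measure \<sigma> by fact
  have q: "AE t in \<sigma>. circ (real q * t) \<noteq> 1" if "q \<ge> 1" for q
  proof (rule spectral_measure_null_of_ergodic_averages[OF S fm fb \<open>2 * C + 1 > 0\<close> \<sigma>])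
    note Sq = measure_preserving_map_funpow[OF S, of q]
    obtain F where F: "F \<in> borel_measurable M"
      "(\<lambda>N. \<integral>x. (cmod (ergodic_average (S ^^ q) f N x - F x))\<^sup>2 \<partial>M) \<longlonglongrightarrow> 0"
      "AE x in M. cond_exp M (invariant_algebra M (S ^^ q)) f x = F x"
      by (rule mean_ergodic[OF Sq fm fb]) (rule that; assumption)
    note [measurable] = F(1) ergodic_average_measurable[OF Sq fm]
    have "ergodic M (S ^^ q)" using te that by (simp add: totally_ergodic_def)
    from cond_exp_ergodic[OF Sq this fm fb] F(3) have "AE x in M. F x = 0"
      by eventually_elim (simp add: f0)
    then have "(\<integral>x. (cmod (ergodic_average (S ^^ q) f N x - F x))\<^sup>2 \<partial>M) =
        (\<integral>x. (cmod (ergodic_average (S ^^ q) f N x))\<^sup>2 \<partial>M)" for N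
      by (intro integral_cong_AE) (auto elim: eventually_mono)
    then show "(\<lambda>N. \<integral>x. (cmod (ergodic_average (S ^^ q) f N x))\<^sup>2 \<partial>M) \<longlonglongrightarrow> 0" using F(2) by simp
  qed
  have "AE t in \<sigma>. \<forall>q::nat. q \<ge> 1 \<longrightarrow> circ (real q * t) \<noteq> 1"
    unfolding AE_all_countable using q by (auto simp: AE_impI)
  then have "AE t in \<sigma>. t \<notin> \<rat>"
  proof eventually_elim
    case (elim t)
    show ?case
    proof
      assume "t \<in> \<rat>"
      then obtain m :: int and n :: nat where mn: "n \<noteq> 0" "t = of_int m / of_nat n"
        by (rule Rats_cases') (auto dest: zero_less_imp_eq_int)
      then have "real n * t = of_int m" by simp
      then show False using elim[rule_format, of n] mn(1) by simp
    qed
  qed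
  then have "AE t in \<sigma>. (\<lambda>N. (\<Sum>n=1..N. circ ((real (k (n + h)) - real (k n)) * t)) / of_nat N) \<longlonglongrightarrow> 0"
    by eventually_elim (rule uniformly_distributed_mod1_character[OF ud[OF _ \<open>h \<ge> 1\<close>]])
  from autocorrelation_tendsto_0[OF S fm \<sigma> this]
  show "(\<lambda>N. (\<Sum>n=1..N. \<integral>x. (g ((S ^^ k (n + h)) x) - G ((S ^^ k (n + h)) x)) *
            cnj (g ((S ^^ k n) x) - G ((S ^^ k n) x)) \<partial>M) / of_nat N) \<longlonglongrightarrow> 0"
    by (simp only: f_def)
qed

text \<open>
  Split \<open>g\<close> into \<open>G\<close> and \<open>g - G\<close>.  The first part reduces to the mean ergodic theorem for \<open>T\<close>, the second
  contributes nothing in the limit.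
\<close>

theorem bounded_averages_converge:
  assumes T: "measure_preserving_automorphism M T" and S: "measure_preserving_map M S"
    and sing: "singular_spectrum M T" and unc: "uncorrelated_along M S k"
    and f: "f \<in> borel_measurable M" "\<And>x. cmod (f x) \<le> C"
    and g: "g \<in> borel_measurable M" "\<And>x. cmod (g x) \<le> C" and "C > 0"
  obtains F G where "F \<in> borel_measurable M" "G \<in> borel_measurable M"
    "\<And>x. cmod (F x) \<le> C" "\<And>x. cmod (G x) \<le> C"
    "AE x in M. cond_exp M (invariant_algebra M T) f x = F x"
    "AE x in M. cond_exp M (invariant_algebra M S) g x = G x"
    "(\<lambda>N. \<integral>x. (cmod ((\<Sum>n=1..N. f ((T ^^ n) x) * g ((S ^^ k n) x)) / of_nat N - F x * G x))\<^sup>2 \<partial>M) \<longlonglongrightarrow> 0"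
proof -
  note Tmp = automorphism_measure_preserving(1)[OF T]
  note [measurable] = f(1) g(1) measure_preserving_map_measurable[OF Tmp]
    measure_preserving_map_measurable[OF S]
    measure_preserving_map_measurable[OF measure_preserving_map_funpow[OF Tmp]]
    measure_preserving_map_measurable[OF measure_preserving_map_funpow[OF S]]
    ergodic_average_measurable[OF Tmp f(1)]
  obtain F where F [measurable]: "F \<in> borel_measurable M" and Fb: "\<And>x. cmod (F x) \<le> C"
    and Flim: "(\<lambda>N. \<integral>x. (cmod (ergodic_average T f N x - F x))\<^sup>2 \<partial>M) \<longlonglongrightarrow> 0"
    and FE: "AE x in M. cond_exp M (invariant_algebra M T) f x = F x"
    by (rule mean_ergodic[OF Tmp f]) (rule that; assumption)
  obtain G where G [measurable]: "G \<in> borel_measurable M" and Gb: "\<And>x. cmod (G x) \<le> C"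
    and Ginv: "\<And>x. x \<in> space M \<Longrightarrow> G (S x) = G x"
    and Glim: "(\<lambda>N. \<integral>x. (cmod (ergodic_average S g N x - G x))\<^sup>2 \<partial>M) \<longlonglongrightarrow> 0"
    and GE: "AE x in M. cond_exp M (invariant_algebra M S) g x = G x"
    by (rule mean_ergodic[OF S g]) (rule that; assumption)
  define x where "x n w = g ((S ^^ k n) w) - G ((S ^^ k n) w)" for n w
  have xm [measurable]: "x n \<in> borel_measurable M" for n unfolding x_def by measurable
  have xb: "cmod (x n w) \<le> 2 * C" for n w
    unfolding x_def using norm_triangle_ineq4[of "g ((S ^^ k n) w)" "G ((S ^^ k n) w)"]
      g(2)[of "(S ^^ k n) w"] Gb[of "(S ^^ k n) w"] by linarith
  have auto0: "(\<lambda>N. (\<Sum>n=1..N. \<integral>w. x (n + h) w * cnj (x n w) \<partial>M) / of_nat N) \<longlonglongrightarrow> 0" if "h \<ge> 1" for h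
    unfolding x_def
    using unc[unfolded uncorrelated_along_def, rule_format, OF g G Gb Ginv Glim GE that] .
  have lim1: "(\<lambda>N. \<integral>w. (cmod ((\<Sum>n=1..N. f ((T ^^ n) w) * x n w) / of_nat N))\<^sup>2 \<partial>M) \<longlonglongrightarrow> 0"
    by (rule averages_uncorrelated_times_singular[OF Tmp f singular_spectrum_small_combination[OF T sing f]
          xm xb auto0]) (use \<open>C > 0\<close> in auto)
  define U where "U N w = (\<Sum>n=1..N. f ((T ^^ n) w) * g ((S ^^ k n) w)) / of_nat N" for N w
  have [measurable]: "U N \<in> borel_measurable M" for N unfolding U_def by measurable
  have prod: "cmod (a * b) \<le> C * C" if "cmod a \<le> C" "cmod b \<le> C" for a b
    using that \<open>C > 0\<close> by (auto simp: norm_mult intro!: mult_mono)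
  have Ub: "cmod (U N w) \<le> C * C" for N w
    unfolding U_def by (rule norm_average_le) (use prod f g \<open>C > 0\<close> in auto)
  have Ab: "cmod (ergodic_average T f N w) \<le> C" for N w
    by (rule ergodic_average_bounded) (rule f)
  have le: "(\<integral>w. (cmod (U N w - F w * G w))\<^sup>2 \<partial>M) \<le>
      2 * (\<integral>w. (cmod ((\<Sum>n=1..N. f ((T ^^ n) w) * x n w) / of_nat N))\<^sup>2 \<partial>M) +
      2 * (C\<^sup>2 * (\<integral>w. (cmod (ergodic_average T f N w - F w))\<^sup>2 \<partial>M))" for N
  proof -
    have "(\<integral>w. (cmod (U N w - F w * G w))\<^sup>2 \<partial>M) \<le>
        2 * (\<integral>w. (cmod (U N w - ergodic_average T f N w * G w))\<^sup>2 \<partial>M) +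
        2 * (\<integral>w. (cmod (ergodic_average T f N w * G w - F w * G w))\<^sup>2 \<partial>M)"
      by (rule integral_square_diff_le[where B = "C * C"]) (auto intro: Ub prod Ab Gb Fb)
    also have "(\<integral>w. (cmod (U N w - ergodic_average T f N w * G w))\<^sup>2 \<partial>M) =
        (\<integral>w. (cmod ((\<Sum>n=1..N. f ((T ^^ n) w) * x n w) / of_nat N))\<^sup>2 \<partial>M)"
    proof (intro Bochner_Integration.integral_cong refl)
      fix w assume "w \<in> space M"
      have "x n w = g ((S ^^ k n) w) - G w" for n
        unfolding x_def by (subst invariant_funpow[of S G, OF S Ginv \<open>w \<in> space M\<close>]) auto
      then have "U N w - ergodic_average T f N w * G w = (\<Sum>n=1..N. f ((T ^^ n) w) * x n w) / of_nat N"
        by (simp add: U_def ergodic_average_def sum_distrib_right diff_divide_distrib[symmetric] sum_subtractf[symmetric] right_diff_distrib)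
      then show "(cmod (U N w - ergodic_average T f N w * G w))\<^sup>2 =
          (cmod ((\<Sum>n=1..N. f ((T ^^ n) w) * x n w) / of_nat N))\<^sup>2" by simp
    qed
    also have "(\<integral>w. (cmod (ergodic_average T f N w * G w - F w * G w))\<^sup>2 \<partial>M) \<le>
        (\<integral>w. C\<^sup>2 * (cmod (ergodic_average T f N w - F w))\<^sup>2 \<partial>M)"
    proof (rule integral_mono)
      show "integrable M (\<lambda>w. (cmod (ergodic_average T f N w * G w - F w * G w))\<^sup>2)"
        by (rule integrable_bounded[where B = "4 * (C * C)\<^sup>2"]) (auto intro!: square_diff_bound prod Ab Gb Fb)
      show "integrable M (\<lambda>w. C\<^sup>2 * (cmod (ergodic_average T f N w - F w))\<^sup>2)"
        by (intro integrable_mult_right integrable_bounded[where B = "4 * C\<^sup>2"])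
          (auto intro!: square_diff_bound Ab Fb)
      fix w
      have "(cmod (ergodic_average T f N w * G w - F w * G w))\<^sup>2 =
          (cmod (G w))\<^sup>2 * (cmod (ergodic_average T f N w - F w))\<^sup>2"
        unfolding left_diff_distrib[symmetric] norm_mult power_mult_distrib by (rule mult.commute)
      then show "(cmod (ergodic_average T f N w * G w - F w * G w))\<^sup>2 \<le>
          C\<^sup>2 * (cmod (ergodic_average T f N w - F w))\<^sup>2"
        by (simp add: mult_right_mono power_mono Gb)
    qed
    finally show ?thesis by simp
  qed
  have "(\<lambda>N. \<integral>w. (cmod (U N w - F w * G w))\<^sup>2 \<partial>M) \<longlonglongrightarrow> 0"
  proof (rule tendsto_sandwich[where f = "\<lambda>_. 0"])
    show "(\<lambda>N. 2 * (\<integral>w. (cmod ((\<Sum>n=1..N. f ((T ^^ n) w) * x n w) / of_nat N))\<^sup>2 \<partial>M) +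
      2 * (C\<^sup>2 * (\<integral>w. (cmod (ergodic_average T f N w - F w))\<^sup>2 \<partial>M))) \<longlonglongrightarrow> 0"
      using tendsto_add[OF tendsto_mult_left[OF lim1, of 2] 
          tendsto_mult_left[OF tendsto_mult_left[OF Flim, of "C\<^sup>2"], of 2]] by simp
    show "\<forall>\<^sub>F N in sequentially. 0 \<le> (\<integral>w. (cmod (U N w - F w * G w))\<^sup>2 \<partial>M)" by simp
  qed (use le in auto)
  then show ?thesis
    by (intro that[OF F G Fb Gb FE GE]) (simp only: U_def)
qed

end

section \<open>Essentially bounded functions and recurrence\<close>

context prob_space
begin

lemma Linf_bounded_version:
  assumes "f \<in> Linf M"
  obtains f' C where "C > 0" "f' \<in> borel_measurable M" "\<And>x. cmod (f' x) \<le> C" "AE x in M. f x = f' x"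
proof -
  obtain B where [measurable]: "f \<in> borel_measurable M" and B: "AE x in M. cmod (f x) \<le> B"
    using assms by (auto simp: Linf_def)
  define C where "C = max 1 B"
  define f' where "f' x = (if cmod (f x) \<le> C then f x else 0)" for x
  have "f' \<in> borel_measurable M" unfolding f'_def by measurable
  moreover have "cmod (f' x) \<le> C" for x by (auto simp: f'_def C_def)
  moreover have "AE x in M. f x = f' x" using B by eventually_elim (auto simp: f'_def C_def)
  moreover have "C > 0" by (simp add: C_def)
  ultimately show ?thesis using that by blast
qed

lemma measurable_cond_exp: "cond_exp M F f \<in> borel_measurable M"
proof -
  have "cond_exp M F f = (\<lambda>x. Complex (real_cond_exp M F (\<lambda>y. Re (f y)) x) (real_cond_exp M F (\<lambda>y. Im (f y)) x))"
    by (simp add: fun_eq_iff cond_exp_def)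
  then show ?thesis unfolding Complex_eq by simp
qed

lemma cond_exp_cong_AE:
  assumes sub: "subalgebra M F" and "AE x in M. f x = g x"
    and [measurable]: "f \<in> borel_measurable M" "g \<in> borel_measurable M"
  shows "AE x in M. cond_exp M F f x = cond_exp M F g x"
proof -
  interpret F: finite_measure_subalgebra M F by unfold_locales (rule sub)
  have "AE x in M. real_cond_exp M F (\<lambda>y. Re (f y)) x = real_cond_exp M F (\<lambda>y. Re (g y)) x"
    using assms(2) by (intro F.real_cond_exp_cong) (auto elim: eventually_mono)
  moreover have "AE x in M. real_cond_exp M F (\<lambda>y. Im (f y)) x = real_cond_exp M F (\<lambda>y. Im (g y)) x"
    using assms(2) by (intro F.real_cond_exp_cong) (auto elim: eventually_mono)
  ultimately show ?thesis by eventually_elim (simp add: cond_exp_def)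
qed

theorem averages_tendsto_L2:
  assumes T: "measure_preserving_automorphism M T" and S: "measure_preserving_map M S"
    and sing: "singular_spectrum M T" and unc: "uncorrelated_along M S k"
    and f: "f \<in> Linf M" and g: "g \<in> Linf M"
  shows "tendsto_L2 M (\<lambda>N x. (\<Sum>n=1..N. f ((T ^^ n) x) * g ((S ^^ k n) x)) / of_nat N)
     (\<lambda>x. cond_exp M (invariant_algebra M T) f x * cond_exp M (invariant_algebra M S) g x)"
proof -
  note Tmp = automorphism_measure_preserving(1)[OF T]
  have fm: "f \<in> borel_measurable M" and gm: "g \<in> borel_measurable M" using f g by (auto simp: Linf_def)
  obtain f' C1 where f': "C1 > 0" "f' \<in> borel_measurable M" "\<And>x. cmod (f' x) \<le> C1" "AE x in M. f x = f' x"
    by (rule Linf_bounded_version[OF f]) (rule that; assumption)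
  obtain g' C2 where g': "C2 > 0" "g' \<in> borel_measurable M" "\<And>x. cmod (g' x) \<le> C2" "AE x in M. g x = g' x"
    by (rule Linf_bounded_version[OF g]) (rule that; assumption)
  define C where "C = max C1 C2"
  have C: "C > 0" "\<And>x. cmod (f' x) \<le> C" "\<And>x. cmod (g' x) \<le> C"
    using f'(1,3) g'(3) by (auto simp: C_def le_max_iff_disj)
  note [measurable] = fm gm f'(2) g'(2) measurable_cond_exp
    measure_preserving_map_measurable[OF Tmp] measure_preserving_map_measurable[OF S]
    measure_preserving_map_measurable[OF measure_preserving_map_funpow[OF Tmp]]
    measure_preserving_map_measurable[OF measure_preserving_map_funpow[OF S]]
  obtain F G where [measurable]: "F \<in> borel_measurable M" "G \<in> borel_measurable M"
    and FG: "\<And>x. cmod (F x) \<le> C" "\<And>x. cmod (G x) \<le> C"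
    and FE: "AE x in M. cond_exp M (invariant_algebra M T) f' x = F x"
    and GE: "AE x in M. cond_exp M (invariant_algebra M S) g' x = G x"
    and lim: "(\<lambda>N. \<integral>x. (cmod ((\<Sum>n=1..N. f' ((T ^^ n) x) * g' ((S ^^ k n) x)) / of_nat N - F x * G x))\<^sup>2 \<partial>M) \<longlonglongrightarrow> 0"
    by (rule bounded_averages_converge[OF T S sing unc f'(2) C(2) g'(2) C(3) C(1)]) (rule that; assumption)
  define l where "l x = cond_exp M (invariant_algebra M T) f x * cond_exp M (invariant_algebra M S) g x" for x
  define U where "U N x = (\<Sum>n=1..N. f ((T ^^ n) x) * g ((S ^^ k n) x)) / of_nat N" for N x
  define U' where "U' N x = (\<Sum>n=1..N. f' ((T ^^ n) x) * g' ((S ^^ k n) x)) / of_nat N" for N x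
  have [measurable]: "l \<in> borel_measurable M" "U N \<in> borel_measurable M" "U' N \<in> borel_measurable M" for N
    unfolding l_def U_def U'_def by measurable
  have prod: "cmod (a * b) \<le> C * C" if "cmod a \<le> C" "cmod b \<le> C" for a b
    using that C(1) by (auto simp: norm_mult intro!: mult_mono)
  have U'b: "cmod (U' N x) \<le> C * C" for N x
    unfolding U'_def by (rule norm_average_le) (use prod C in auto)
  have UE: "AE x in M. U N x = U' N x" for N
  proof -
    have "AE x in M. \<forall>n. f ((T ^^ n) x) = f' ((T ^^ n) x)"
      unfolding AE_all_countable using AE_measure_preserving[OF measure_preserving_map_funpow[OF Tmp] f'(4)] by blast
    moreover have "AE x in M. \<forall>n. g ((S ^^ k n) x) = g' ((S ^^ k n) x)"
      unfolding AE_all_countable using AE_measure_preserving[OF measure_preserving_map_funpow[OF S] g'(4)] by blast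
    ultimately show ?thesis by eventually_elim (simp add: U_def U'_def)
  qed
  have lE: "AE x in M. l x = F x * G x"
    using cond_exp_cong_AE[OF subalgebra_invariant_algebra[OF measure_preserving_map_measurable[OF Tmp]]
        f'(4) fm f'(2)]
      cond_exp_cong_AE[OF subalgebra_invariant_algebra[OF measure_preserving_map_measurable[OF S]]
        g'(4) gm g'(2)] FE GE
    by eventually_elim (simp add: l_def)
  have L2: "u \<in> L2 M" if [measurable]: "u \<in> borel_measurable M" "v \<in> borel_measurable M"
    and "AE x in M. u x = v x" "\<And>x. cmod (v x) \<le> C * C" for u v
  proof -
    have "integrable M (\<lambda>x. (cmod (v x))\<^sup>2)"
      by (rule integrable_bounded[where B = "(C * C)\<^sup>2"]) (use that in \<open>auto intro!: power_mono\<close>)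
    then have "integrable M (\<lambda>x. (cmod (u x))\<^sup>2)"
      by (rule integrable_cong_AE_imp) (use that(3) in \<open>auto elim: eventually_mono\<close>)
    then show ?thesis by (simp add: L2_def)
  qed
  have "(\<integral>x. (cmod (U N x - l x))\<^sup>2 \<partial>M) = (\<integral>x. (cmod (U' N x - F x * G x))\<^sup>2 \<partial>M)" for N
  proof (rule integral_cong_AE)
    show "AE x in M. (cmod (U N x - l x))\<^sup>2 = (cmod (U' N x - F x * G x))\<^sup>2"
      using UE[of N] lE by eventually_elim simp
  qed measurable
  then have "(\<lambda>N. \<integral>x. (cmod (U N x - l x))\<^sup>2 \<partial>M) \<longlonglongrightarrow> 0" using lim by (simp add: U'_def)
  moreover have "U N \<in> L2 M" for N by (rule L2[OF _ _ UE U'b]) measurable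
  moreover have "l \<in> L2 M" by (rule L2[OF _ _ lE]) (auto intro: prod FG)
  ultimately show ?thesis unfolding tendsto_L2_def l_def U_def by blast
qed

lemma cond_exp_indicator:
  assumes sub: "subalgebra M F"
  shows "AE x in M. cond_exp M F (indicator A) x = complex_of_real (real_cond_exp M F (indicator A) x)"
proof -
  interpret F: finite_measure_subalgebra M F by unfold_locales (rule sub)
  have "(\<lambda>y. Re (indicator A y)) = indicator A" "(\<lambda>y. Im (indicator A y)) = (\<lambda>_. 0)"
    by (auto simp: fun_eq_iff indicator_def)
  moreover have "AE x in M. real_cond_exp M F (\<lambda>_. 0) x = 0"
    by (rule F.real_cond_exp_F_meas) auto
  ultimately show ?thesis by (auto simp: cond_exp_def complex_eq_iff elim: eventually_mono)
qed

theorem averages_recurrence: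
  assumes T: "measure_preserving_automorphism M T" and S: "measure_preserving_map M S"
    and sing: "singular_spectrum M T" and unc: "uncorrelated_along M S k"
    and A [measurable]: "A \<in> sets M"
  shows "\<exists>L. (\<lambda>N. (\<Sum>n=1..N. measure M
                   (A \<inter> ((T ^^ n) -` A \<inter> space M) \<inter> ((S ^^ k n) -` A \<inter> space M))) / real N)
             \<longlonglongrightarrow> L \<and> L \<ge> (measure M A) ^ 3"
proof -
  note Tmp = automorphism_measure_preserving(1)[OF T]
  note Tm [measurable] = measure_preserving_map_measurable[OF Tmp]
  note Sm [measurable] = measure_preserving_map_measurable[OF S]
  note [measurable] = measure_preserving_map_measurable[OF measure_preserving_map_funpow[OF Tmp]]
    measure_preserving_map_measurable[OF measure_preserving_map_funpow[OF S]]
  let ?f = "indicator A :: 'a \<Rightarrow> complex"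
  have f: "?f \<in> borel_measurable M" "\<And>x. cmod (?f x) \<le> 1" by (auto simp: indicator_def)
  obtain F G where [measurable]: "F \<in> borel_measurable M" "G \<in> borel_measurable M"
    and FG: "\<And>x. cmod (F x) \<le> 1" "\<And>x. cmod (G x) \<le> 1"
    and FE: "AE x in M. cond_exp M (invariant_algebra M T) ?f x = F x"
    and GE: "AE x in M. cond_exp M (invariant_algebra M S) ?f x = G x"
    and lim: "(\<lambda>N. \<integral>x. (cmod ((\<Sum>n=1..N. ?f ((T ^^ n) x) * ?f ((S ^^ k n) x)) / of_nat N - F x * G x))\<^sup>2 \<partial>M) \<longlonglongrightarrow> 0"
    by (rule bounded_averages_converge[OF T S sing unc f f zero_less_one]) (rule that; assumption)
  define U where "U N x = (\<Sum>n=1..N. ?f ((T ^^ n) x) * ?f ((S ^^ k n) x)) / of_nat N" for N x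
  have [measurable]: "U N \<in> borel_measurable M" for N unfolding U_def by measurable
  have prod: "cmod (a * b) \<le> 1" if "cmod a \<le> 1" "cmod b \<le> 1" for a b
    using that by (simp add: norm_mult mult_le_one)
  have Ub: "cmod (U N x) \<le> 1" for N x
    unfolding U_def by (rule norm_average_le) (use prod f(2) in auto)
  define B where "B n = A \<inter> ((T ^^ n) -` A \<inter> space M) \<inter> ((S ^^ k n) -` A \<inter> space M)" for n
  have [measurable]: "B n \<in> sets M" for n unfolding B_def by measurable
  define L where "L = (\<integral>x. indicator A x * (real_cond_exp M (invariant_algebra M T) (indicator A) x *
      real_cond_exp M (invariant_algebra M S) (indicator A) x) \<partial>M)"
  have lhs: "(\<integral>x. ?f x * U N x \<partial>M) = complex_of_real ((\<Sum>n=1..N. measure M (B n)) / real N)" for N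
  proof -
    have "(\<integral>x. ?f x * U N x \<partial>M) = (\<integral>x. (\<Sum>n=1..N. complex_of_real (indicator (B n) x)) / of_nat N \<partial>M)"
    proof (intro Bochner_Integration.integral_cong refl)
      fix x assume "x \<in> space M"
      then have "?f x * (?f ((T ^^ n) x) * ?f ((S ^^ k n) x)) = complex_of_real (indicator (B n) x)" for n
        by (auto simp: B_def indicator_def)
      then show "?f x * U N x = (\<Sum>n=1..N. complex_of_real (indicator (B n) x)) / of_nat N"
        by (simp only: U_def times_divide_eq_right sum_distrib_left)
    qed
    also have "\<dots> = (\<Sum>n=1..N. complex_of_real (measure M (B n))) / of_nat N"
    proof -
      have "(\<integral>x. complex_of_real (indicator (B n) x) \<partial>M) = complex_of_real (measure M (B n))" for n
        by (subst integral_complex_of_real) (simp add: sets.Int_space_eq2)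
      then show ?thesis
        by (subst integral_divide_zero, subst Bochner_Integration.integral_sum)
          (auto intro!: integrable_bounded[where B = 1] simp: indicator_def)
    qed
    finally show ?thesis by simp
  qed
  have rhs: "(\<integral>x. ?f x * (F x * G x) \<partial>M) = complex_of_real L"
  proof -
    have "AE x in M. ?f x * (F x * G x) = complex_of_real (indicator A x *
      (real_cond_exp M (invariant_algebra M T) (indicator A) x *
      real_cond_exp M (invariant_algebra M S) (indicator A) x))"
      using cond_exp_indicator[OF subalgebra_invariant_algebra[OF Tm], of A]
        cond_exp_indicator[OF subalgebra_invariant_algebra[OF Sm], of A] FE GE
      by eventually_elim (simp add: indicator_def)
    then have "(\<integral>x. ?f x * (F x * G x) \<partial>M) = (\<integral>x. complex_of_real (indicator A x *
      (real_cond_exp M (invariant_algebra M T) (indicator A) x *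
      real_cond_exp M (invariant_algebra M S) (indicator A) x)) \<partial>M)"
      by (intro integral_cong_AE) measurable
    then show ?thesis unfolding L_def by (simp only: integral_complex_of_real)
  qed
  have "(\<lambda>N. complex_of_real ((\<Sum>n=1..N. measure M (B n)) / real N)) \<longlonglongrightarrow> complex_of_real L"
    unfolding lhs[symmetric] rhs[symmetric]
  proof (rule LIMSEQ_I)
    fix e :: real assume "e > 0"
    then have "\<forall>\<^sub>F N in sequentially. (\<integral>x. (cmod (U N x - F x * G x))\<^sup>2 \<partial>M) < e\<^sup>2"
      unfolding U_def by (intro order_tendstoD(2)[OF lim]) simp
    then have "\<forall>\<^sub>F N in sequentially. norm ((\<integral>x. ?f x * U N x \<partial>M) - (\<integral>x. ?f x * (F x * G x) \<partial>M)) < e"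
    proof eventually_elim
      case (elim N)
      have b: "cmod (U N x - F x * G x) \<le> 2" for x
        using norm_triangle_ineq4[of "U N x" "F x * G x"] Ub[of N x] prod[OF FG(1)[of x] FG(2)[of x]] by linarith
      have 1: "integrable M (\<lambda>x. ?f x * U N x)" "integrable M (\<lambda>x. ?f x * (F x * G x))"
        by (rule integrable_bounded[where B = 1]; use prod f(2) Ub FG in auto)+
      have "norm ((\<integral>x. ?f x * U N x \<partial>M) - (\<integral>x. ?f x * (F x * G x) \<partial>M)) =
          norm (\<integral>x. ?f x * (U N x - F x * G x) \<partial>M)"
        using 1 by (simp add: right_diff_distrib)
      also have "\<dots> \<le> (\<integral>x. cmod (?f x * (U N x - F x * G x)) \<partial>M)" by (rule integral_norm_bound)
      also have "\<dots> \<le> (\<integral>x. cmod (U N x - F x * G x) \<partial>M)"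
      proof (rule integral_mono)
        show le: "cmod (?f x * (U N x - F x * G x)) \<le> cmod (U N x - F x * G x)" for x
          by (simp add: indicator_def)
        show "integrable M (\<lambda>x. cmod (?f x * (U N x - F x * G x)))"
          by (rule integrable_bounded[where B = 2]) (use order_trans[OF le b] in auto)
        show "integrable M (\<lambda>x. cmod (U N x - F x * G x))"
          by (rule integrable_bounded[where B = 2]) (use b in auto)
      qed
      also have "\<dots> < e"
        by (rule integral_cmod_less[OF _ b elim \<open>e > 0\<close>]) measurable
      finally show ?case .
    qed
    then show "\<exists>N0. \<forall>N\<ge>N0. norm ((\<integral>x. ?f x * U N x \<partial>M) - (\<integral>x. ?f x * (F x * G x) \<partial>M)) < e"
      unfolding eventually_sequentially .
  qed
  then have "(\<lambda>N. (\<Sum>n=1..N. measure M (B n)) / real N) \<longlonglongrightarrow> L" by (simp only: tendsto_of_real_iff)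
  moreover have "L \<ge> measure M A ^ 3"
    unfolding L_def by (intro integral_cond_exp_product_ge_cube subalgebra_invariant_algebra Tm Sm A)
  ultimately show ?thesis unfolding B_def by blast
qed

end

theorem theorem1p8:
  fixes M :: "'a measure" and T S :: "'a \<Rightarrow> 'a" and k :: "nat \<Rightarrow> nat"
  assumes "prob_space M"
    and "measure_preserving_automorphism M T"
    and "measure_preserving_automorphism M S"
    and "singular_spectrum M T"
    and "\<forall>n\<ge>1. k n \<ge> 1"
  shows
    "((\<forall>(\<alpha>::real) (h::nat). h \<ge> 1 \<longrightarrow>
          uniformly_distributed_in (orbit_closure \<alpha>) (\<lambda>n. (real (k (n + h)) - real (k n)) * \<alpha>))
      \<longrightarrow>
        (\<forall>f\<in>Linf M. \<forall>g\<in>Linf M.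
           tendsto_L2 M
             (\<lambda>N x. (\<Sum>n=1..N. f ((T ^^ n) x) * g ((S ^^ k n) x)) / of_nat N)
             (\<lambda>x. cond_exp M (invariant_algebra M T) f x * cond_exp M (invariant_algebra M S) g x))
        \<and>
        (\<forall>A\<in>sets M. \<exists>L.
           (\<lambda>N. (\<Sum>n=1..N. measure M
                   (A \<inter> ((T ^^ n) -` A \<inter> space M) \<inter> ((S ^^ k n) -` A \<inter> space M))) / real N)
             \<longlonglongrightarrow> L \<and> L \<ge> (measure M A) ^ 3))
     \<and>
     ((\<forall>(\<alpha>::real) (h::nat). \<alpha> \<notin> \<rat> \<longrightarrow> h \<ge> 1 \<longrightarrow>
          uniformly_distributed_mod1 (\<lambda>n. (real (k (n + h)) - real (k n)) * \<alpha>))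
      \<longrightarrow> totally_ergodic M S
      \<longrightarrow>
        (\<forall>f\<in>Linf M. \<forall>g\<in>Linf M.
           tendsto_L2 M
             (\<lambda>N x. (\<Sum>n=1..N. f ((T ^^ n) x) * g ((S ^^ k n) x)) / of_nat N)
             (\<lambda>x. cond_exp M (invariant_algebra M T) f x * cond_exp M (invariant_algebra M S) g x))
        \<and>
        (\<forall>A\<in>sets M. \<exists>L.
           (\<lambda>N. (\<Sum>n=1..N. measure M
                   (A \<inter> ((T ^^ n) -` A \<inter> space M) \<inter> ((S ^^ k n) -` A \<inter> space M))) / real N)
             \<longlonglongrightarrow> L \<and> L \<ge> (measure M A) ^ 3))"
proof -
  interpret prob_space M by fact
  note S = automorphism_measure_preserving(1)[OF assms(3)]
  note conclusions = averages_tendsto_L2[OF assms(2) S assms(4)] averages_recurrence[OF assms(2) S assms(4)]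
  show ?thesis
  proof (intro conjI impI ballI, goal_cases)
    case (1 f g)
    then show ?case by (intro conclusions(1)[OF uncorrelated_along_orbit_closure[OF S]]) auto
  next
    case (2 A)
    then show ?case by (intro conclusions(2)[OF uncorrelated_along_orbit_closure[OF S]]) auto
  next
    case (3 f g)
    then show ?case by (intro conclusions(1)[OF uncorrelated_along_totally_ergodic[OF S]]) auto
  next
    case (4 A)
    then show ?case by (intro conclusions(2)[OF uncorrelated_along_totally_ergodic[OF S]]) auto
  qed
qed

end
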